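(* Let $n \ge 1$, let $\lambda$ and $\mu$ be partitions of $n$, and let $\ell > 2$ be a natural number. If $\chi^\lambda(g) = \chi^\mu(g)$ for all $\ell'$-elements $g$ of $S_n$ (that is, all $g \in S_n$ whose order is not divisible by $\ell$), then $\lambda = \mu$.
   Context: For a partition $\lambda$ of $n$, $\chi^\lambda$ denotes the ordinary irreducible character of the symmetric group $S_n$ afforded by the Specht module $S^\lambda$ over a field of characteristic zero. The number $\ell$ need not be prime. *)

theory Defs
  imports
    "HOL-Algebra.Sym_Groups"
    "HOL-Algebra.Multiplicative_Group"
    "HOL-Combinatorics.Permutations"
    "HOL-Library.Function_Algebras"
begin

section \<open>Partitions and tableaux\<close>

definition is_partition_of :: "nat list \<Rightarrow> nat \<Rightarrow> bool" where
  "is_partition_of lam n \<longleftrightarrow>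
     sorted_wrt (\<ge>) lam \<and> (\<forall>k \<in> set lam. k > 0) \<and> sum_list lam = n"

text \<open>Rows and columns of Young diagrams are numbered from 0; entries of tableaux, as well as the
  points moved by the symmetric group, are numbered from 1.\<close>

definition young_diagram :: "nat list \<Rightarrow> (nat \<times> nat) set" where
  "young_diagram lam = {(i, j). i < length lam \<and> j < lam ! i}"

text \<open>Values of a tableau outside the diagram are irrelevant: nothing below depends on them.\<close>

definition is_tableau :: "nat list \<Rightarrow> (nat \<times> nat \<Rightarrow> nat) \<Rightarrow> bool" where
  "is_tableau lam t \<longleftrightarrow> bij_betw t (young_diagram lam) {1..sum_list lam}"

definition tableau_row :: "nat list \<Rightarrow> (nat \<times> nat \<Rightarrow> nat) \<Rightarrow> nat \<Rightarrow> nat set" where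
  "tableau_row lam t i = {t (i, j) |j. (i, j) \<in> young_diagram lam}"

definition tableau_col :: "nat list \<Rightarrow> (nat \<times> nat \<Rightarrow> nat) \<Rightarrow> nat \<Rightarrow> nat set" where
  "tableau_col lam t j = {t (i, j) |i. (i, j) \<in> young_diagram lam}"

text \<open>The tabloid of a tableau (its class under row equivalence) is represented by the list of its
  rows, each row being regarded as a set.\<close>

definition tabloid :: "nat list \<Rightarrow> (nat \<times> nat \<Rightarrow> nat) \<Rightarrow> nat set list" where
  "tabloid lam t = map (tableau_row lam t) [0..<length lam]"

definition col_stabilizer :: "nat list \<Rightarrow> (nat \<times> nat \<Rightarrow> nat) \<Rightarrow> (nat \<Rightarrow> nat) set" where
  "col_stabilizer lam t =
     {p. p permutes {1..sum_list lam} \<and> (\<forall>j. p ` tableau_col lam t j = tableau_col lam t j)}"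


section \<open>Traces on subspaces of function spaces\<close>

definition fun_scale :: "'k::field \<Rightarrow> ('a \<Rightarrow> 'k) \<Rightarrow> 'a \<Rightarrow> 'k" where
  "fun_scale c v = (\<lambda>x. c * v x)"

global_interpretation fn: vector_space "fun_scale :: 'k::field \<Rightarrow> ('a \<Rightarrow> 'k) \<Rightarrow> 'a \<Rightarrow> 'k"
  by unfold_locales (auto simp: fun_scale_def fun_eq_iff algebra_simps)

definition is_basis_of :: "('a \<Rightarrow> 'k::field) set \<Rightarrow> ('a \<Rightarrow> 'k) set \<Rightarrow> bool" where
  "is_basis_of B V \<longleftrightarrow> fn.independent B \<and> fn.span B = V"

text \<open>The trace, on a finite-dimensional subspace \<open>V\<close>, of a linear map that leaves \<open>V\<close> invariant.
  The choice of the basis is immaterial, see \<open>trace_on_eq\<close> below, whose assumptions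
  hold for Specht modules by \<open>perm_act_linear\<close>, \<open>specht_module_finite_basis\<close> and
  \<open>specht_module_invariant\<close>.\<close>

definition trace_on :: "('a \<Rightarrow> 'k::field) set \<Rightarrow> (('a \<Rightarrow> 'k) \<Rightarrow> 'a \<Rightarrow> 'k) \<Rightarrow> 'k" where
  "trace_on V f = (let B = (SOME B. is_basis_of B V) in \<Sum>b\<in>B. fn.representation B (f b) b)"

lemma trace_basis_independent:
  fixes f :: "('a \<Rightarrow> 'k::field) \<Rightarrow> 'a \<Rightarrow> 'k"
  assumes f: "Vector_Spaces.linear fun_scale fun_scale f"
    and B: "is_basis_of B V" "finite B" and C: "is_basis_of C V" "finite C"
    and inv: "f ` V \<subseteq> V"
  shows "(\<Sum>b\<in>B. fn.representation B (f b) b) = (\<Sum>c\<in>C. fn.representation C (f c) c)"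
proof -
  interpret f: Vector_Spaces.linear fun_scale fun_scale f by (rule f)
  have iB: "fn.independent B" and sB: "fn.span B = V"
    and iC: "fn.independent C" and sC: "fn.span C = V"
    using B C by (auto simp: is_basis_of_def)
  have CV: "C \<subseteq> V" and BV: "B \<subseteq> V" using sC sB fn.span_superset by blast+
  have fV: "f v \<in> V" if "v \<in> V" for v using inv that by blast
  have 1: "fn.representation B (f b) b =
      (\<Sum>c\<in>C. fn.representation C b c * fn.representation B (f c) b)" if b: "b \<in> B" for b
  proof -
    have "(\<Sum>c\<in>C. fun_scale (fn.representation C b c) c) = b"
      using iC sC b BV C(2) by (intro fn.sum_representation_eq) auto
    then have "f b = f (\<Sum>c\<in>C. fun_scale (fn.representation C b c) c)" by simp
    also have "\<dots> = (\<Sum>c\<in>C. fun_scale (fn.representation C b c) (f c))"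
      by (simp add: f.sum f.scale)
    finally have "fn.representation B (f b) =
        fn.representation B (\<Sum>c\<in>C. fun_scale (fn.representation C b c) (f c))" by simp
    also have "\<dots> = (\<lambda>b'. \<Sum>c\<in>C. fn.representation C b c * fn.representation B (f c) b')"
      using iB sB CV fV
      by (subst fn.representation_sum) (auto simp: fn.span_scale fn.representation_scale subset_iff)
    finally show ?thesis by simp
  qed
  have 2: "fn.representation C (f c) c =
      (\<Sum>b\<in>B. fn.representation B (f c) b * fn.representation C b c)" if c: "c \<in> C" for c
  proof -
    have "(\<Sum>b\<in>B. fun_scale (fn.representation B (f c) b) b) = f c"
      using iB sB c CV fV B(2) by (intro fn.sum_representation_eq) auto
    then have "fn.representation C (f c) =
        fn.representation C (\<Sum>b\<in>B. fun_scale (fn.representation B (f c) b) b)" by simp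
    also have "\<dots> = (\<lambda>c'. \<Sum>b\<in>B. fn.representation B (f c) b * fn.representation C b c')"
      using iC sC BV
      by (subst fn.representation_sum) (auto simp: fn.span_scale fn.representation_scale subset_iff)
    finally show ?thesis by simp
  qed
  have "(\<Sum>b\<in>B. fn.representation B (f b) b) =
      (\<Sum>b\<in>B. \<Sum>c\<in>C. fn.representation C b c * fn.representation B (f c) b)"
    using 1 by (intro sum.cong) auto
  also have "\<dots> = (\<Sum>c\<in>C. \<Sum>b\<in>B. fn.representation B (f c) b * fn.representation C b c)"
    by (subst sum.swap) (simp add: mult.commute)
  also have "\<dots> = (\<Sum>c\<in>C. fn.representation C (f c) c)"
    using 2 by (intro sum.cong) auto
  finally show ?thesis .
qed

lemma trace_on_eq:
  fixes f :: "('a \<Rightarrow> 'k::field) \<Rightarrow> 'a \<Rightarrow> 'k"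
  assumes f: "Vector_Spaces.linear fun_scale fun_scale f"
    and B: "is_basis_of B V" "finite B" and inv: "f ` V \<subseteq> V"
  shows "trace_on V f = (\<Sum>b\<in>B. fn.representation B (f b) b)"
proof -
  define C where "C = (SOME C. is_basis_of C V)"
  have C: "is_basis_of C V" unfolding C_def using B(1) by (rule someI)
  have "C \<subseteq> fn.span B" "fn.independent C"
    using B(1) C fn.span_superset by (auto simp: is_basis_of_def)
  then have "finite C" using fn.independent_span_bound[OF B(2)] by blast
  then show ?thesis
    unfolding trace_on_def Let_def C_def[symmetric]
    using trace_basis_independent[OF f C _ B inv] by simp
qed


section \<open>Specht modules and their characters\<close>

text \<open>The permutation module on tabloids consists of functions from tabloids to the field, the
  tabloid \<open>T\<close> being identified with the function that is 1 at \<open>T\<close> and 0 elsewhere.\<close>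

definition polytabloid :: "nat list \<Rightarrow> (nat \<times> nat \<Rightarrow> nat) \<Rightarrow> nat set list \<Rightarrow> 'k::field_char_0" where
  "polytabloid lam t =
     (\<lambda>T. \<Sum>p\<in>col_stabilizer lam t. of_int (sign p) * of_bool (T = tabloid lam (p \<circ> t)))"

definition specht_module :: "nat list \<Rightarrow> (nat set list \<Rightarrow> 'k::field_char_0) set" where
  "specht_module lam = fn.span {polytabloid lam t |t. is_tableau lam t}"

text \<open>A permutation acts on a tabloid by acting on its entries, hence on functions of tabloids by
  \<open>(g \<cdot> v) T = v (g\<^sup>-\<^sup>1 T)\<close>.\<close>

definition perm_act :: "(nat \<Rightarrow> nat) \<Rightarrow> (nat set list \<Rightarrow> 'k) \<Rightarrow> nat set list \<Rightarrow> 'k" where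
  "perm_act g v = (\<lambda>T. v (map ((`) (Hilbert_Choice.inv g)) T))"

definition specht_character :: "nat list \<Rightarrow> (nat \<Rightarrow> nat) \<Rightarrow> 'k::field_char_0" where
  "specht_character lam g = trace_on (specht_module lam) (perm_act g)"

lemma perm_act_linear:
  "Vector_Spaces.linear fun_scale fun_scale
     (perm_act g :: (nat set list \<Rightarrow> 'k::field) \<Rightarrow> nat set list \<Rightarrow> 'k)"
  by unfold_locales (auto simp: perm_act_def fun_scale_def fun_eq_iff algebra_simps)

lemma perm_act_polytabloid:
  assumes g: "g permutes {1..sum_list lam}"
  shows "perm_act g (polytabloid lam t) = polytabloid lam (g \<circ> t)"
proof
  fix T
  let ?i = "Hilbert_Choice.inv g"
  have bg: "bij g" using g by (rule permutes_bij)
  have [simp]: "?i \<circ> g = id" "g \<circ> ?i = id" using permutes_inv_o[OF g] by auto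
  have [simp]: "?i (g x) = x" "g (?i x) = x" for x using permutes_inverses[OF g] by auto
  have row: "tableau_row lam (h \<circ> s) i = h ` tableau_row lam s i" for h s i
    by (auto simp: tableau_row_def)
  have col: "tableau_col lam (h \<circ> s) j = h ` tableau_col lam s j" for h s j
    by (auto simp: tableau_col_def)
  have tab: "tabloid lam (h \<circ> s) = map ((`) h) (tabloid lam s)" for h s
    by (simp add: tabloid_def row)
  have mapeq: "map ((`) ?i) T = S \<longleftrightarrow> T = map ((`) g) S" for S
    by (auto simp: map_idI image_image comp_def)
  have ig: "?i permutes {1..sum_list lam}" using g by (rule permutes_inv)
  have perm: "permutation q" if "q permutes {1..sum_list lam}" for q
    using that permutation_permutes by blast
  have sgn: "sign (g \<circ> p \<circ> ?i) = sign p" if "p permutes {1..sum_list lam}" for p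
    using perm[OF that] perm[OF g] perm[OF ig]
    by (simp add: sign_compose permutation_compose sign_inverse sign_idempotent
        mult.commute mult.left_commute)
  show "perm_act g (polytabloid lam t) T = polytabloid lam (g \<circ> t) T"
    unfolding perm_act_def polytabloid_def
  proof (rule sum.reindex_bij_witness[where i = "\<lambda>q. ?i \<circ> q \<circ> g" and j = "\<lambda>p. g \<circ> p \<circ> ?i"])
    fix p assume p: "p \<in> col_stabilizer lam t"
    then have pp: "p permutes {1..sum_list lam}" by (simp add: col_stabilizer_def)
    show "?i \<circ> (g \<circ> p \<circ> ?i) \<circ> g = p" by (simp add: fun_eq_iff)
    have "g \<circ> p \<circ> ?i permutes {1..sum_list lam}"
      by (intro permutes_compose g pp ig)
    moreover have "(g \<circ> p \<circ> ?i) ` tableau_col lam (g \<circ> t) j = g ` p ` tableau_col lam t j" for j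
      by (simp add: col image_image)
    ultimately show "g \<circ> p \<circ> ?i \<in> col_stabilizer lam (g \<circ> t)"
      using p by (simp add: col_stabilizer_def col)
    have "g \<circ> p \<circ> ?i \<circ> (g \<circ> t) = g \<circ> (p \<circ> t)" by (simp add: fun_eq_iff)
    then show "of_int (sign (g \<circ> p \<circ> ?i)) * of_bool (T = tabloid lam (g \<circ> p \<circ> ?i \<circ> (g \<circ> t))) =
        of_int (sign p) * of_bool (map ((`) ?i) T = tabloid lam (p \<circ> t))"
      using sgn[OF pp] by (simp add: tab[of g] mapeq)
  next
    fix q assume q: "q \<in> col_stabilizer lam (g \<circ> t)"
    then have qp: "q permutes {1..sum_list lam}" by (simp add: col_stabilizer_def)
    show "g \<circ> (?i \<circ> q \<circ> g) \<circ> ?i = q" by (simp add: fun_eq_iff)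
    have "?i \<circ> q \<circ> g permutes {1..sum_list lam}"
      by (intro permutes_compose g qp ig)
    moreover have "(?i \<circ> q \<circ> g) ` tableau_col lam t j =
        ?i ` q ` tableau_col lam (g \<circ> t) j" for j
      by (simp add: col image_image)
    moreover have "q ` tableau_col lam (g \<circ> t) j = g ` tableau_col lam t j" for j
      using q by (simp add: col_stabilizer_def col)
    moreover have "?i ` g ` tableau_col lam t j = tableau_col lam t j" for j
      by (simp add: image_image)
    ultimately show "?i \<circ> q \<circ> g \<in> col_stabilizer lam t"
      by (simp add: col_stabilizer_def)
  qed
qed

lemma specht_module_invariant:
  assumes g: "g permutes {1..sum_list lam}"
  shows "perm_act g ` specht_module lam \<subseteq> (specht_module lam :: (nat set list \<Rightarrow> 'k::field_char_0) set)"
proof -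
  interpret Vector_Spaces.linear fun_scale fun_scale
    "perm_act g :: (nat set list \<Rightarrow> 'k) \<Rightarrow> nat set list \<Rightarrow> 'k"
    by (rule perm_act_linear)
  have "is_tableau lam (g \<circ> t)" if "is_tableau lam t" for t
    using that bij_betw_trans permutes_imp_bij[OF g] by (auto simp: is_tableau_def)
  then show ?thesis
    unfolding specht_module_def span_image[symmetric]
    by (intro fn.span_mono) (auto simp: perm_act_polytabloid[OF g])
qed

lemma specht_module_finite_basis:
  "\<exists>B :: (nat set list \<Rightarrow> 'k::field_char_0) set. finite B \<and> is_basis_of B (specht_module lam)"
proof -
  define TT where "TT = {T. set T \<subseteq> Pow {1..sum_list lam} \<and> length T = length lam}"
  define D where "D = (\<lambda>S T. of_bool (T = S) :: 'k) ` TT"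
  have finD: "finite D" unfolding D_def TT_def by (intro finite_imageI finite_lists_length_eq) auto
  have "polytabloid lam t \<in> fn.span D" if t: "is_tableau lam t" for t
  proof -
    have "tabloid lam (p \<circ> t) \<in> TT" if p: "p \<in> col_stabilizer lam t" for p
    proof -
      have "t x \<in> {1..sum_list lam}" if "x \<in> young_diagram lam" for x
        using t that by (auto simp: is_tableau_def bij_betw_def)
      moreover have "p y \<in> {1..sum_list lam}" if "y \<in> {1..sum_list lam}" for y
        using p that permutes_in_image[of p "{1..sum_list lam}" y]
        by (simp add: col_stabilizer_def)
      ultimately have "p (t x) \<in> {1..sum_list lam}" if "x \<in> young_diagram lam" for x
        using that by blast
      then show ?thesis unfolding TT_def by (auto simp: tabloid_def tableau_row_def)
    qed
    then have "(\<Sum>p\<in>col_stabilizer lam t.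
        fun_scale (of_int (sign p)) (\<lambda>T. of_bool (T = tabloid lam (p \<circ> t)) :: 'k)) \<in> fn.span D"
      by (intro fn.span_sum fn.span_scale fn.span_base) (auto simp: D_def)
    also have "(\<Sum>p\<in>col_stabilizer lam t.
        fun_scale (of_int (sign p)) (\<lambda>T. of_bool (T = tabloid lam (p \<circ> t)) :: 'k)) = polytabloid lam t"
    proof
      fix T
      have "sum h A T = (\<Sum>p\<in>A. h p T)"
        for h :: "(nat \<Rightarrow> nat) \<Rightarrow> nat set list \<Rightarrow> 'k" and A
        by (induction A rule: infinite_finite_induct) auto
      then show "(\<Sum>p\<in>col_stabilizer lam t.
        fun_scale (of_int (sign p)) (\<lambda>T. of_bool (T = tabloid lam (p \<circ> t)) :: 'k)) T
          = polytabloid lam t T"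
        by (simp add: polytabloid_def fun_scale_def)
    qed
    finally show ?thesis .
  qed
  then have "(specht_module lam :: (nat set list \<Rightarrow> 'k) set) \<subseteq> fn.span D"
    unfolding specht_module_def by (intro fn.span_minimal) auto
  moreover obtain B :: "(nat set list \<Rightarrow> 'k) set"
    where B: "B \<subseteq> specht_module lam" "fn.independent B" "specht_module lam \<subseteq> fn.span B"
    using fn.basis_exists by metis
  moreover have "fn.span B \<subseteq> specht_module lam"
    using B(1) by (intro fn.span_minimal) (auto simp: specht_module_def)
  moreover have "finite B"
    using fn.independent_span_bound[OF finD B(2)] B(1) calculation(1) by blast
  ultimately show ?thesis unfolding is_basis_of_def by blast
qed

end

theory Submission
  imports Defs "HOL-Combinatorics.Orbits" "HOL-Computational_Algebra.Primes"
begin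

text \<open>
  Fix a divisor \<open>q\<close> of \<open>l\<close> that is an odd prime or \<open>4\<close>. A permutation without cycles of length
  divisible by \<open>q\<close> has order not divisible by \<open>l\<close>; such permutations will be called regular.
  Products of regular permutations with disjoint supports are regular, and so are transpositions,
  because \<open>q > 2\<close>. It is shown by induction on \<open>n\<close> that two partitions of \<open>n\<close> are equal if
  their characters are proportional on regular permutations.

  The induction removes first hooks. Let \<open>K\<close> consist of the \<open>k\<close> largest points and let \<open>e\<close> be a
  function on the natural numbers with period \<open>q\<close>. The class function on the permutations of \<open>K\<close>
  whose value at \<open>x\<close> is the sum of \<open>(-1)^|Y| e(|Y|) sign (x|Y)\<close> over the \<open>x\<close>-invariant subsets
  \<open>Y\<close> of \<open>K\<close> vanishes if \<open>x\<close> has a cycle of length divisible by \<open>q\<close>: adding this cycle to \<open>Y\<close>,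
  or removing it, changes the sign of the term (\<open>cycle_weight_zero\<close>). Hence averages of a
  character against this class function involve regular permutations only
  (\<open>weighted_sum_transfer\<close>). On the other hand the sum over \<open>Y\<close> expresses them by averages over
  the Young subgroups \<open>Sym (K - Y) \<times> Sym Y\<close>, with the trivial character on the first factor and
  the sign on the second. Averaging a Specht character over \<open>a\<close> points with the trivial character
  gives zero if \<open>a\<close> exceeds the length of the first row, and gives \<open>a!\<close> times the character of the
  partition without its first row if \<open>a\<close> is this length (\<open>row_average_vanish\<close>,
  \<open>row_average_removal\<close>); with the sign, the same holds for the first column
  (\<open>column_average_vanish\<close>, \<open>column_average_removal\<close>). So if \<open>k\<close> exceeds the length \<open>h\<close> of the
  first hook, the average is zero; if \<open>k = h\<close>, only those \<open>Y\<close> contribute whose size is the number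
  of rows or one less, and the average is a multiple of the character of the partition without its
  first hook, with a factor that a suitable \<open>e\<close> makes nonzero (\<open>weighted_sum_hook\<close>).

  Consequently two partitions with proportional characters have first hooks of equal length, and
  by induction they agree outside these hooks. The arm of the first hook is found from a
  transposition: the sum of all transpositions acts on the Specht module as the sum of the
  contents of the cells, so this sum is determined by the quotient of the values at a
  transposition and at the identity, which a constant factor does not change. If \<open>h\<close> and the
  diagram outside the first hook are known, the sum of the contents determines the difference of
  the lengths of the first row and of the first column (\<open>content_sum_hook\<close>), and \<open>h\<close> determines
  their sum.

  The two removal theorems rest on exchange relations with opposite roles. The Garnir relation
  rewrites a polytabloid by exchanging one entry with all entries of a column further left; it
  shows that the sign-isotypic part for a set \<open>A\<close> of points is generated by the tableaux with \<open>A\<close>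
  in the first column. The row relation, which holds for the coefficients of every vector of the
  Specht module, shows that a vector invariant under \<open>Sym A\<close> is determined by its coefficients at
  the tabloids with first row \<open>A\<close>.
\<close>

section \<open>Traces on subspaces\<close>

lemma sum_fun_apply: "sum h A x = (\<Sum>p\<in>A. h p x)"
  by (induction A rule: infinite_finite_induct) auto

lemma trace_on_cong:
  fixes f f' :: "('a \<Rightarrow> 'k::field) \<Rightarrow> 'a \<Rightarrow> 'k"
  assumes "is_basis_of B V" and "\<And>v. v \<in> V \<Longrightarrow> f v = f' v"
  shows "trace_on V f = trace_on V f'"
proof -
  define C where "C = (SOME C. is_basis_of C V)"
  have "is_basis_of C V" unfolding C_def using assms(1) by (rule someI)
  then have "C \<subseteq> V" using fn.span_superset by (auto simp: is_basis_of_def)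
  then show ?thesis using assms(2) unfolding trace_on_def Let_def C_def[symmetric]
    by (intro sum.cong) auto
qed

lemma subspace_finite_basis:
  fixes V W :: "('a \<Rightarrow> 'k::field) set"
  assumes "is_basis_of B V" "finite B" and W: "fn.subspace W" "W \<subseteq> V"
  obtains C D where "is_basis_of C W" "finite C" "is_basis_of D V" "finite D" "C \<subseteq> D"
proof -
  have sub: "fn.subspace V" and BV: "fn.span B = V" using assms(1) by (auto simp: is_basis_of_def)
  obtain C where C: "C \<subseteq> W" "fn.independent C" "W \<subseteq> fn.span C" by (rule fn.basis_exists)
  have "fn.span C = W" using C W(1) fn.span_subspace by blast
  obtain D where D: "C \<subseteq> D" "D \<subseteq> V" "fn.independent D" "V \<subseteq> fn.span D"
    using fn.maximal_independent_subset_extend[of C V] C W by blast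
  have "fn.span D = V" using D sub fn.span_subspace by blast
  moreover have "finite D" using fn.independent_span_bound[OF assms(2) D(3)] D(2) BV by auto
  moreover have "finite C" using \<open>finite D\<close> D(1) finite_subset by blast
  ultimately show ?thesis using that[of C D] C D \<open>fn.span C = W\<close> by (auto simp: is_basis_of_def)
qed

text \<open>Extend a basis of \<open>W\<close> to a basis of \<open>V\<close>. The basis vectors outside \<open>W\<close> contribute nothing
  because \<open>f\<close> maps them into \<open>W\<close>.\<close>

lemma trace_on_subspace:
  fixes f :: "('a \<Rightarrow> 'k::field) \<Rightarrow> 'a \<Rightarrow> 'k"
  assumes f: "Vector_Spaces.linear fun_scale fun_scale f"
    and V: "is_basis_of B V" "finite B" and W: "fn.subspace W" "W \<subseteq> V" and fV: "f ` V \<subseteq> W"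
  shows "trace_on V f = trace_on W f"
proof -
  obtain C D where CD: "is_basis_of C W" "finite C" "is_basis_of D V" "finite D" "C \<subseteq> D"
    using subspace_finite_basis[OF V W] by blast
  have sp: "fn.span C = W" "fn.span D = V" "fn.independent D" "fn.independent C"
    using CD by (auto simp: is_basis_of_def)
  have rep: "fn.representation D (f d) = fn.representation C (f d)" if "d \<in> D" for d
    using that sp CD fV fn.span_superset[of D] by (intro fn.representation_extend) auto
  have "trace_on V f = (\<Sum>d\<in>D. fn.representation D (f d) d)"
    using f CD fV W by (intro trace_on_eq) auto
  also have "\<dots> = (\<Sum>d\<in>D. fn.representation C (f d) d)" using rep by (intro sum.cong) auto
  also have "\<dots> = (\<Sum>d\<in>C. fn.representation C (f d) d)"
    using CD fn.representation_ne_zero[of C] by (intro sum.mono_neutral_right) blast+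
  also have "\<dots> = trace_on W f" using f CD fV W by (intro trace_on_eq[symmetric]) auto
  finally show ?thesis .
qed

lemma trace_on_intertwine:
  fixes f :: "('a \<Rightarrow> 'k::field) \<Rightarrow> 'a \<Rightarrow> 'k" and f' :: "('b \<Rightarrow> 'k) \<Rightarrow> 'b \<Rightarrow> 'k"
  assumes f: "Vector_Spaces.linear fun_scale fun_scale f"
    and f': "Vector_Spaces.linear fun_scale fun_scale f'"
    and h: "Vector_Spaces.linear fun_scale fun_scale (h :: ('a \<Rightarrow> 'k) \<Rightarrow> 'b \<Rightarrow> 'k)"
    and V: "is_basis_of B V" "finite B" and fV: "f ` V \<subseteq> V"
    and ker: "\<And>v. v \<in> V \<Longrightarrow> h v = 0 \<Longrightarrow> v = 0"
    and comm: "\<And>v. v \<in> V \<Longrightarrow> h (f v) = f' (h v)"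
  shows "trace_on (h ` V) f' = trace_on V f"
proof -
  interpret h: Vector_Spaces.linear fun_scale fun_scale h by (rule h)
  have B: "fn.span B = V" "fn.independent B" using V by (auto simp: is_basis_of_def)
  have sV: "fn.subspace V" using B(1) by auto
  have BV: "B \<subseteq> V" using B(1) fn.span_superset by blast
  have inj: "inj_on h V" unfolding h.inj_on_iff_eq_0[OF sV] using ker by blast
  have ind: "fn.independent (h ` B)" using B inj by (intro h.independent_injective_image) auto
  have sp: "fn.span (h ` B) = h ` V" using B by (simp add: h.span_image)
  have basis: "is_basis_of (h ` B) (h ` V)" using ind sp by (simp add: is_basis_of_def)
  have rep: "fn.representation (h ` B) (h v) (h b) = fn.representation B v b"
    if v: "v \<in> V" and b: "b \<in> B" for v b
  proof -
    have "v = (\<Sum>c\<in>B. fun_scale (fn.representation B v c) c)"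
      using B v V by (intro fn.sum_representation_eq[symmetric]) auto
    then have "h v = (\<Sum>c\<in>B. fun_scale (fn.representation B v c) (h c))"
      by (metis (no_types, lifting) h.sum h.scale sum.cong)
    then have "fn.representation (h ` B) (h v) =
        fn.representation (h ` B) (\<Sum>c\<in>B. fun_scale (fn.representation B v c) (h c))" by simp
    also have "\<dots> = (\<lambda>x. \<Sum>c\<in>B. fn.representation (h ` B) (fun_scale (fn.representation B v c) (h c)) x)"
      by (intro fn.representation_sum ind fn.span_scale fn.span_base) auto
    finally have "fn.representation (h ` B) (h v) (h b) =
        (\<Sum>c\<in>B. fn.representation B v c * (if h b = h c then 1 else 0))"
      by (simp add: fn.representation_scale[OF ind fn.span_base] fn.representation_basis[OF ind])
    also have "\<dots> = (\<Sum>c\<in>B. if c = b then fn.representation B v c else 0)"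
      using b BV inj by (intro sum.cong) (auto simp: inj_on_def)
    also have "\<dots> = fn.representation B v b" using V b by simp
    finally show ?thesis .
  qed
  have "trace_on (h ` V) f' = (\<Sum>c\<in>h ` B. fn.representation (h ` B) (f' c) c)"
    using basis V comm fV by (intro trace_on_eq f') (auto simp: image_iff, metis imageI subset_iff)
  also have "\<dots> = (\<Sum>b\<in>B. fn.representation (h ` B) (f' (h b)) (h b))"
    using inj BV by (subst sum.reindex) (auto intro: inj_on_subset)
  also have "\<dots> = (\<Sum>b\<in>B. fn.representation B (f b) b)"
    using BV fV by (intro sum.cong) (auto simp: comm[symmetric] rep image_subset_iff subset_iff)
  also have "\<dots> = trace_on V f" using V fV by (intro trace_on_eq[symmetric] f) auto
  finally show ?thesis .
qed

lemma trace_on_sum: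
  fixes F :: "'i \<Rightarrow> ('a \<Rightarrow> 'k::field) \<Rightarrow> 'a \<Rightarrow> 'k"
  assumes "is_basis_of B V" and "\<And>i v. i \<in> I \<Longrightarrow> v \<in> V \<Longrightarrow> F i v \<in> V"
  shows "trace_on V (\<lambda>v. \<Sum>i\<in>I. fun_scale (c i) (F i v)) = (\<Sum>i\<in>I. c i * trace_on V (F i))"
proof -
  define C where "C = (SOME C. is_basis_of C V)"
  have "is_basis_of C V" unfolding C_def using assms(1) by (rule someI)
  then have C: "fn.span C = V" "fn.independent C" "C \<subseteq> V"
    using fn.span_superset by (auto simp: is_basis_of_def)
  have "fn.representation C (\<Sum>i\<in>I. fun_scale (c i) (F i b)) b =
      (\<Sum>i\<in>I. c i * fn.representation C (F i b) b)" if "b \<in> C" for b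
    using that C assms(2)
    by (subst fn.representation_sum) (auto simp: fn.representation_scale fn.span_scale subset_iff
        intro!: sum.cong)
  then show ?thesis unfolding trace_on_def Let_def C_def[symmetric]
    by (simp add: sum_distrib_left) (rule sum.swap)
qed

lemma trace_on_scalar:
  fixes c :: "'k::field"
  assumes "is_basis_of B V" "finite B" and "\<And>v. v \<in> V \<Longrightarrow> f v = fun_scale c v"
  shows "trace_on V f = c * of_nat (card B)"
proof -
  have lin: "Vector_Spaces.linear fun_scale fun_scale (fun_scale c :: ('a \<Rightarrow> 'k) \<Rightarrow> _)"
    by unfold_locales (auto simp: fun_scale_def fun_eq_iff algebra_simps)
  have B: "fn.span B = V" "fn.independent B" using assms by (auto simp: is_basis_of_def)
  have "trace_on V f = trace_on V (fun_scale c)"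
    using assms by (intro trace_on_cong) auto
  also have "\<dots> = (\<Sum>b\<in>B. fn.representation B (fun_scale c b) b)"
    using assms lin B fn.span_scale by (intro trace_on_eq) auto
  also have "\<dots> = (\<Sum>b\<in>B. c)"
    using B by (intro sum.cong) (auto simp: fn.representation_scale fn.representation_basis fn.span_base)
  finally show ?thesis by simp
qed

section \<open>Tableaux, tabloids and polytabloids\<close>

text \<open>The involution may have fixed points: \<open>f\<close> vanishes there, since \<open>2\<close> is invertible.\<close>

lemma sum_antisymmetric_involution:
  fixes f :: "'a \<Rightarrow> 'k::field_char_0"
  assumes "\<And>x. x \<in> A \<Longrightarrow> i x \<in> A" "\<And>x. x \<in> A \<Longrightarrow> i (i x) = x" "\<And>x. x \<in> A \<Longrightarrow> f (i x) = - f x"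
  shows "sum f A = 0"
proof -
  have "sum f A = (\<Sum>x\<in>A. - f x)"
    using assms by (intro sum.reindex_bij_witness[where i = i and j = i]) auto
  then show ?thesis by (simp add: sum_negf)
qed

lemma perm_act_comp:
  assumes "bij g" "bij h"
  shows "perm_act g (perm_act h v) = perm_act (g \<circ> h) v"
proof -
  have "(`) (inv' h) \<circ> (`) (inv' g) = (`) (inv' (g \<circ> h))"
    using assms by (simp add: o_inv_distrib fun_eq_iff image_comp)
  then show ?thesis unfolding perm_act_def by (metis (no_types, lifting) list.map_comp)
qed

lemma tableau_row_comp: "tableau_row lam (p \<circ> t) i = p ` tableau_row lam t i"
  by (auto simp: tableau_row_def)

lemma tableau_col_comp: "tableau_col lam (p \<circ> t) j = p ` tableau_col lam t j"
  by (auto simp: tableau_col_def)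

lemma tabloid_comp: "tabloid lam (p \<circ> t) = map ((`) p) (tabloid lam t)"
  by (simp add: tabloid_def tableau_row_comp)

lemma is_tableau_comp:
  "is_tableau lam t \<Longrightarrow> p permutes {1..sum_list lam} \<Longrightarrow> is_tableau lam (p \<circ> t)"
  using permutes_imp_bij bij_betw_trans unfolding is_tableau_def by blast

lemma tabloid_cong:
  "(\<And>x. x \<in> young_diagram lam \<Longrightarrow> s x = t x) \<Longrightarrow> tabloid lam s = tabloid lam t"
  by (force simp: tabloid_def tableau_row_def)

lemma col_stabilizer_cong:
  assumes "\<And>x. x \<in> young_diagram lam \<Longrightarrow> s x = t x"
  shows "col_stabilizer lam s = col_stabilizer lam t"
proof -
  have "tableau_col lam s = tableau_col lam t"
    using assms by (force simp: tableau_col_def fun_eq_iff)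
  then show ?thesis by (simp add: col_stabilizer_def)
qed

lemma polytabloid_cong:
  assumes "\<And>x. x \<in> young_diagram lam \<Longrightarrow> s x = t x"
  shows "polytabloid lam s = polytabloid lam t"
proof -
  have "tabloid lam (p \<circ> s) = tabloid lam (p \<circ> t)" for p
    using assms by (intro tabloid_cong) auto
  then show ?thesis using col_stabilizer_cong[OF assms] by (simp add: polytabloid_def)
qed

lemma finite_col_stabilizer [simp]: "finite (col_stabilizer lam t)"
  unfolding col_stabilizer_def
  by (rule finite_subset[OF _ finite_permutations[of "{1..sum_list lam}"]]) auto

lemma col_stabilizer_permutes: "p \<in> col_stabilizer lam t \<Longrightarrow> p permutes {1..sum_list lam}"
  by (simp add: col_stabilizer_def)

lemma col_stabilizer_comp:
  "p \<in> col_stabilizer lam t \<Longrightarrow> q \<in> col_stabilizer lam t \<Longrightarrow> p \<circ> q \<in> col_stabilizer lam t"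
  by (simp add: col_stabilizer_def permutes_compose image_image[symmetric])

lemma col_stabilizer_inv:
  "p \<in> col_stabilizer lam t \<Longrightarrow> inv' p \<in> col_stabilizer lam t"
proof -
  assume p: "p \<in> col_stabilizer lam t"
  then have P: "p permutes {1..sum_list lam}" by (rule col_stabilizer_permutes)
  have "inv' p ` p ` S = S" for S
    by (simp add: image_image permutes_inverses[OF P])
  then have "inv' p ` tableau_col lam t j = tableau_col lam t j" for j
    using p by (metis (mono_tags, lifting) col_stabilizer_def mem_Collect_eq)
  then show ?thesis using permutes_inv[OF P] by (simp add: col_stabilizer_def)
qed

lemma sign_comp_permutes:
  assumes "finite S" "p permutes S" "q permutes S"
  shows "sign (p \<circ> q) = sign p * sign q"
  using assms by (metis permutation_permutes sign_compose)

lemma transpose_image_disjoint: "a \<notin> S \<Longrightarrow> b \<notin> S \<Longrightarrow> transpose a b ` S = S"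
  by (force simp: transpose_def image_iff)

lemma tableau_entry: "is_tableau lam t \<Longrightarrow> c \<in> young_diagram lam \<Longrightarrow> t c \<in> {1..sum_list lam}"
  by (auto simp: is_tableau_def bij_betw_def)

lemma tableau_eq_iff:
  "is_tableau lam t \<Longrightarrow> c \<in> young_diagram lam \<Longrightarrow> d \<in> young_diagram lam \<Longrightarrow> t c = t d \<longleftrightarrow> c = d"
  by (auto simp: is_tableau_def bij_betw_def inj_on_eq_iff)

lemma tableau_col_disjoint:
  assumes "is_tableau lam t" "x \<in> tableau_col lam t j" "x \<in> tableau_col lam t j'"
  shows "j = j'"
proof -
  obtain i i' where "(i, j) \<in> young_diagram lam" "x = t (i, j)"
      "(i', j') \<in> young_diagram lam" "x = t (i', j')"
    using assms(2,3) by (auto simp: tableau_col_def)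
  then show ?thesis using tableau_eq_iff[OF assms(1), of "(i, j)" "(i', j')"] by simp
qed

lemma tableau_row_disjoint:
  assumes "is_tableau lam t" "x \<in> tableau_row lam t i" "x \<in> tableau_row lam t i'"
  shows "i = i'"
proof -
  obtain j j' where "(i, j) \<in> young_diagram lam" "x = t (i, j)"
      "(i', j') \<in> young_diagram lam" "x = t (i', j')"
    using assms(2,3) by (auto simp: tableau_row_def)
  then show ?thesis using tableau_eq_iff[OF assms(1), of "(i, j)" "(i', j')"] by simp
qed

lemma tableau_obtain_cell:
  assumes "is_tableau lam t" "x \<in> {1..sum_list lam}"
  obtains i j where "(i, j) \<in> young_diagram lam" "x = t (i, j)"
  using assms by (metis bij_betw_imp_surj_on imageE is_tableau_def surj_pair)

lemma transpose_col_stabilizer: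
  assumes t: "is_tableau lam t" and xy: "x \<in> tableau_col lam t j" "y \<in> tableau_col lam t j"
  shows "transpose x y \<in> col_stabilizer lam t"
proof -
  have "x \<in> {1..sum_list lam}" "y \<in> {1..sum_list lam}"
    using xy tableau_entry[OF t] by (auto simp: tableau_col_def)
  then have "transpose x y permutes {1..sum_list lam}" by (rule permutes_swap_id)
  moreover have "transpose x y ` tableau_col lam t j' = tableau_col lam t j'" for j'
  proof (cases "j' = j")
    case True then show ?thesis using xy by (auto simp: transpose_image_eq)
  next
    case False then show ?thesis using tableau_col_disjoint[OF t] xy by (intro transpose_image_disjoint) auto
  qed
  ultimately show ?thesis by (simp add: col_stabilizer_def)
qed

lemma col_stabilizer_col:
  assumes "p \<in> col_stabilizer lam t"
  shows "tableau_col lam (p \<circ> t) j = tableau_col lam t j"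
  using assms by (simp add: tableau_col_comp col_stabilizer_def)

lemma col_stabilizer_tableau_comp:
  assumes "p \<in> col_stabilizer lam t"
  shows "col_stabilizer lam (p \<circ> t) = col_stabilizer lam t"
  using col_stabilizer_col[OF assms] by (simp add: col_stabilizer_def)

lemma polytabloid_col_stabilizer:
  assumes p: "p \<in> col_stabilizer lam t"
  shows "polytabloid lam (p \<circ> t) = fun_scale (of_int (sign p)) (polytabloid lam t :: _ \<Rightarrow> 'k::field_char_0)"
proof
  fix T
  let ?N = "{1..sum_list lam}"
  note P = col_stabilizer_permutes
  have "polytabloid lam (p \<circ> t) T = (\<Sum>q\<in>col_stabilizer lam t. of_int (sign q) * of_bool (T = tabloid lam (q \<circ> (p \<circ> t))) :: 'k)"
    by (simp add: polytabloid_def col_stabilizer_tableau_comp[OF p])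
  also have "\<dots> = (\<Sum>q\<in>col_stabilizer lam t. of_int (sign p) * (of_int (sign q) * of_bool (T = tabloid lam (q \<circ> t))))"
  proof (rule sum.reindex_bij_witness[where i = "\<lambda>q. q \<circ> inv' p" and j = "\<lambda>q. q \<circ> p"])
    fix q assume q: "q \<in> col_stabilizer lam t"
    show "q \<circ> p \<circ> inv' p = q" "q \<circ> inv' p \<circ> p = q"
      using permutes_inverses[OF P[OF p]] by (auto simp: fun_eq_iff)
    show "q \<circ> p \<in> col_stabilizer lam t" "q \<circ> inv' p \<in> col_stabilizer lam t"
      using p q by (auto intro: col_stabilizer_comp col_stabilizer_inv)
    have "of_int (sign p) * of_int (sign (q \<circ> p)) = (of_int (sign q) :: 'k)"
      unfolding of_int_mult[symmetric] sign_comp_permutes[OF _ P[OF q] P[OF p], simplified]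
      by (simp add: sign_def)
    then show "of_int (sign p) * (of_int (sign (q \<circ> p)) * of_bool (T = tabloid lam (q \<circ> p \<circ> t))) =
         of_int (sign q) * (of_bool (T = tabloid lam (q \<circ> (p \<circ> t))) :: 'k)"
      by (simp only: comp_assoc mult.assoc[symmetric])
  qed
  also have "\<dots> = fun_scale (of_int (sign p)) (polytabloid lam t) T"
    by (simp only: fun_scale_def polytabloid_def sum_distrib_left)
  finally show "polytabloid lam (p \<circ> t) T = fun_scale (of_int (sign p)) (polytabloid lam t :: _ \<Rightarrow> 'k) T" .
qed

text \<open>Only the identity preserves all rows and all columns of a tableau, so the tabloid of \<open>t\<close> occurs
  exactly once in its polytabloid. In particular Specht modules are not zero.\<close>

lemma polytabloid_tabloid_eq_1:
  assumes t: "is_tableau lam t"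
  shows "polytabloid lam t (tabloid lam t) = (1::'k::field_char_0)"
proof -
  have "p = id" if p: "p \<in> col_stabilizer lam t" and eq: "tabloid lam t = tabloid lam (p \<circ> t)" for p
  proof
    fix x show "p x = id x"
    proof (cases "x \<in> {1..sum_list lam}")
      case False then show ?thesis using col_stabilizer_permutes[OF p] by (simp add: permutes_not_in)
    next
      case True
      then obtain i j where c: "(i, j) \<in> young_diagram lam" "x = t (i, j)" using tableau_obtain_cell[OF t] by blast
      have "p x \<in> tableau_col lam t j" using col_stabilizer_col[OF p, of j] c by (auto simp: tableau_col_def)
      then obtain i' where i': "(i', j) \<in> young_diagram lam" "p x = t (i', j)" by (auto simp: tableau_col_def)
      have "tableau_row lam t i = tableau_row lam (p \<circ> t) i"
        using eq c(1) by (auto simp: tabloid_def young_diagram_def)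
      moreover have "p x \<in> tableau_row lam (p \<circ> t) i" using c by (force simp: tableau_row_def)
      ultimately have "p x \<in> tableau_row lam t i" by simp
      moreover have "p x \<in> tableau_row lam t i'" using i' by (auto simp: tableau_row_def)
      ultimately have "i' = i" using tableau_row_disjoint[OF t] by blast
      then show ?thesis using i' c by simp
    qed
  qed
  moreover have "id \<in> col_stabilizer lam t" by (simp add: col_stabilizer_def permutes_id)
  ultimately have "{p \<in> col_stabilizer lam t. tabloid lam t = tabloid lam (p \<circ> t)} = {id}" by auto
  moreover have "polytabloid lam t (tabloid lam t) =
      (\<Sum>p\<in>{p \<in> col_stabilizer lam t. tabloid lam t = tabloid lam (p \<circ> t)}. of_int (sign p) :: 'k)"
    unfolding polytabloid_def by (intro sum.mono_neutral_cong_right) auto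
  ultimately show ?thesis by simp
qed

lemma polytabloid_support:
  assumes "is_tableau lam t" "polytabloid lam t T \<noteq> (0::'k::field_char_0)"
  obtains s where "is_tableau lam s" "T = tabloid lam s"
proof -
  have "\<exists>p\<in>col_stabilizer lam t. T = tabloid lam (p \<circ> t)"
  proof (rule ccontr)
    assume "\<not> ?thesis"
    then have "polytabloid lam t T = (0::'k)" unfolding polytabloid_def by (intro sum.neutral) auto
    then show False using assms(2) by simp
  qed
  then obtain p where "p \<in> col_stabilizer lam t" "T = tabloid lam (p \<circ> t)" by blast
  then show ?thesis using that is_tableau_comp[OF assms(1)] col_stabilizer_permutes by blast
qed

lemma specht_module_subspace: "fn.subspace (specht_module lam)"
  by (simp add: specht_module_def)

lemma specht_module_support:
  assumes "v \<in> specht_module lam" "v T \<noteq> (0::'k::field_char_0)"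
  obtains s where "is_tableau lam s" "T = tabloid lam s"
proof -
  have "\<forall>T. v T \<noteq> 0 \<longrightarrow> (\<exists>s. is_tableau lam s \<and> T = tabloid lam s)"
    using assms(1) unfolding specht_module_def
  proof (induction rule: fn.span_induct_alt)
    case base then show ?case by simp
  next
    case (step c x y)
    then obtain t where t: "is_tableau lam t" "x = polytabloid lam t" by blast
    show ?case
    proof (intro allI impI)
      fix T assume "(fun_scale c x + y) T \<noteq> 0"
      then have "c * x T + y T \<noteq> 0" by (simp add: fun_scale_def)
      show "\<exists>s. is_tableau lam s \<and> T = tabloid lam s"
      proof (cases "x T = 0")
        case False
        then have "polytabloid lam t T \<noteq> (0::'k)" using t by simp
        then show ?thesis by (rule polytabloid_support[OF t(1)]) blast
      next
        case True
        then have "y T \<noteq> 0" using \<open>c * x T + y T \<noteq> 0\<close> by simp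
        then show ?thesis using step(2) by blast
      qed
    qed
  qed
  then show ?thesis using assms(2) that by blast
qed

lemma young_diagram_finite [simp]: "finite (young_diagram lam)"
proof -
  have "young_diagram lam = Sigma {..<length lam} (\<lambda>i. {..<lam ! i})" by (auto simp: young_diagram_def)
  then show ?thesis by simp
qed

lemma card_young_diagram: "card (young_diagram lam) = sum_list lam"
proof -
  have "young_diagram lam = Sigma {..<length lam} (\<lambda>i. {..<lam ! i})" by (auto simp: young_diagram_def)
  then show ?thesis by (simp add: sum_list_sum_nth atLeast0LessThan)
qed

lemma ex_tableau: "\<exists>t. is_tableau lam t"
  unfolding is_tableau_def
  by (rule finite_same_card_bij) (auto simp: card_young_diagram)

lemma specht_module_basis:
  obtains B :: "(nat set list \<Rightarrow> 'k::field_char_0) set"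
  where "finite B" "is_basis_of B (specht_module lam)" "B \<noteq> {}"
proof -
  obtain B :: "(nat set list \<Rightarrow> 'k) set" where B: "finite B" "is_basis_of B (specht_module lam)"
    using specht_module_finite_basis by blast
  obtain t where t: "is_tableau lam t" using ex_tableau by blast
  have "polytabloid lam t \<noteq> (0 :: _ \<Rightarrow> 'k)" using polytabloid_tabloid_eq_1[OF t, where 'k='k] by force
  moreover have "polytabloid lam t \<in> (specht_module lam :: (_ \<Rightarrow> 'k) set)"
    using t unfolding specht_module_def by (intro fn.span_base) auto
  ultimately have "B \<noteq> {}" using B(2) by (auto simp: is_basis_of_def)
  then show ?thesis using that B by blast
qed

lemma perm_act_id [simp]: "perm_act id v = v"
  by (simp add: perm_act_def)

text \<open>The value is the dimension, and the field has characteristic zero.\<close>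

lemma specht_character_id_nonzero: "specht_character lam id \<noteq> (0::'k::field_char_0)"
proof -
  obtain B :: "(nat set list \<Rightarrow> 'k) set" where B: "finite B" "is_basis_of B (specht_module lam)" "B \<noteq> {}"
    by (rule specht_module_basis)
  have "specht_character lam id = 1 * (of_nat (card B) :: 'k)"
    unfolding specht_character_def
    by (rule trace_on_scalar[OF B(2,1)]) (simp add: fun_scale_def)
  then show ?thesis using B by simp
qed

lemma specht_character_conj:
  assumes g: "g permutes {1..sum_list lam}" and h: "h permutes {1..sum_list lam}"
  shows "specht_character lam (h \<circ> g \<circ> inv' h) = (specht_character lam g :: 'k::field_char_0)"
proof -
  let ?V = "specht_module lam :: (nat set list \<Rightarrow> 'k) set"
  note i = permutes_inv[OF h]
  note b = permutes_bij[OF g] permutes_bij[OF h] permutes_bij[OF i]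
  have inj: "v = 0" if "perm_act h v = 0" for v :: "nat set list \<Rightarrow> 'k"
  proof -
    have "v = perm_act (inv' h) (perm_act h v)"
      using b permutes_inv_o[OF h] by (simp add: perm_act_comp)
    also have "\<dots> = 0" unfolding that by (simp add: perm_act_def fun_eq_iff)
    finally show ?thesis .
  qed
  have "?V \<subseteq> perm_act h ` ?V"
  proof
    fix v assume v: "v \<in> ?V"
    have "v = perm_act h (perm_act (inv' h) v)"
      using b permutes_inv_o[OF h] by (simp add: perm_act_comp)
    then show "v \<in> perm_act h ` ?V" using specht_module_invariant[OF i] v by blast
  qed
  then have im: "perm_act h ` ?V = ?V" using specht_module_invariant[OF h] by blast
  obtain B :: "(nat set list \<Rightarrow> 'k) set" where B: "finite B" "is_basis_of B ?V"
    using specht_module_finite_basis by blast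
  have "h \<circ> g \<circ> inv' h \<circ> h = h \<circ> g"
    using permutes_inv_o[OF h] by (simp add: comp_assoc)
  then have "trace_on (perm_act h ` ?V) (perm_act (h \<circ> g \<circ> inv' h)) = trace_on ?V (perm_act g)"
    using specht_module_invariant[OF g] inj b
    by (intro trace_on_intertwine[OF perm_act_linear perm_act_linear perm_act_linear B(2,1)])
       (auto simp: perm_act_comp bij_comp)
  then show ?thesis by (simp add: specht_character_def im)
qed

section \<open>Exchange relations\<close>

lemma col_stabilizer_mem:
  "p \<in> col_stabilizer lam t \<Longrightarrow> x \<in> tableau_col lam t j \<Longrightarrow> p x \<in> tableau_col lam t j"
  unfolding col_stabilizer_def by blast

lemma tabloid_nth: "i < length lam \<Longrightarrow> tabloid lam t ! i = tableau_row lam t i"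
  by (simp add: tabloid_def)

lemma map_image_transpose_cancel [simp]:
  "map ((`) (transpose x y)) (map ((`) (transpose x y)) T) = T"
  by (simp add: image_image map_idI)

lemma polytabloid_transpose:
  assumes "x \<in> {1..sum_list lam}" "y \<in> {1..sum_list lam}"
  shows "polytabloid lam (transpose x y \<circ> t) T =
    (polytabloid lam t (map ((`) (transpose x y)) T) :: 'k::field_char_0)"
proof -
  have "transpose x y permutes {1..sum_list lam}" using assms by (rule permutes_swap_id)
  then have "polytabloid lam (transpose x y \<circ> t) =
      perm_act (transpose x y) (polytabloid lam t :: _ \<Rightarrow> 'k)"
    by (rule perm_act_polytabloid[symmetric])
  then show ?thesis by (simp add: perm_act_def)
qed

lemma tabloid_transpose_same_row:
  assumes t: "is_tableau lam t" and xy: "x \<in> tableau_row lam t i" "y \<in> tableau_row lam t i"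
  shows "tabloid lam (transpose x y \<circ> t) = tabloid lam t"
proof -
  have "transpose x y ` tableau_row lam t i' = tableau_row lam t i'" for i'
  proof (cases "i' = i")
    case True then show ?thesis using xy by (simp add: transpose_image_eq)
  next
    case False
    then have "x \<notin> tableau_row lam t i'" "y \<notin> tableau_row lam t i'"
      using xy tableau_row_disjoint[OF t] by blast+
    then show ?thesis by (rule transpose_image_disjoint)
  qed
  then show ?thesis by (simp add: tabloid_def tableau_row_comp)
qed

lemma sign_transpose_comp:
  assumes "p permutes {1..n::nat}" "x \<in> {1..n}" "y \<in> {1..n}" "x \<noteq> y"
  shows "sign (transpose x y \<circ> p) = - sign p"
  using sign_comp_permutes[OF _ permutes_swap_id[OF assms(2,3)] assms(1)] assms(4)
  by (simp add: sign_swap_id)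

lemma transpose_conj:
  assumes "x \<noteq> y" "y \<noteq> z" "x \<noteq> z"
  shows "transpose x z \<circ> transpose y z = transpose x y \<circ> transpose x z"
  using assms by (auto simp: fun_eq_iff transpose_def)

text \<open>After a column permutation \<open>p\<close>, the row of \<open>x\<close> contains one entry \<open>m p\<close> of column \<open>j\<close>, because
  column \<open>j\<close> is further left. Exchanging \<open>x\<close> with \<open>m p\<close> does not change the tabloid, so the terms
  with \<open>y = m p\<close> add up to the polytabloid of \<open>t\<close>. The remaining terms cancel in pairs: exchanging
  \<open>y\<close> and \<open>m p\<close> first leads to the same tabloid with the opposite sign.\<close>

lemma garnir_relation:
  fixes T :: "nat set list"
  assumes t: "is_tableau lam t" and jj: "j < j'" and x: "x \<in> tableau_col lam t j'"
  shows "(\<Sum>y\<in>tableau_col lam t j. polytabloid lam (transpose x y \<circ> t) T)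
      = (polytabloid lam t T :: 'k::field_char_0)"
proof -
  let ?C = "col_stabilizer lam t" and ?Y = "tableau_col lam t j" and ?N = "{1..sum_list lam}"
  define cell where "cell = inv_into (young_diagram lam) t"
  define r where "r p = fst (cell (inv' p x))" for p
  \<comment> \<open>\<open>r p\<close> is the row of \<open>x\<close> in the tableau \<open>p \<circ> t\<close>, and \<open>m p\<close> is the entry of column \<open>j\<close> in this row\<close>
  define m where "m p = p (t (r p, j))" for p
  note P = col_stabilizer_permutes
  have xN: "x \<in> ?N" using x tableau_entry[OF t] by (auto simp: tableau_col_def)
  have YN: "?Y \<subseteq> ?N" using tableau_entry[OF t] by (auto simp: tableau_col_def)
  have finY: "finite ?Y" using YN finite_subset by blast
  have xY: "x \<notin> ?Y" using tableau_col_disjoint[OF t x] jj by blast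
  have inj: "inj_on t (young_diagram lam)" using t by (simp add: is_tableau_def bij_betw_def)
  have cell_t: "cell (t c) = c" if "c \<in> young_diagram lam" for c
    using that inj by (simp add: cell_def)
  have rp: "(r p, j') \<in> young_diagram lam \<and> (r p, j) \<in> young_diagram lam \<and> p (t (r p, j')) = x"
    if p: "p \<in> ?C" for p
  proof -
    have "inv' p x \<in> tableau_col lam t j'"
      using x col_stabilizer_inv[OF p] by (auto simp: col_stabilizer_def)
    then obtain i where i: "(i, j') \<in> young_diagram lam" "inv' p x = t (i, j')"
      by (auto simp: tableau_col_def)
    then have "r p = i" by (simp add: r_def cell_t)
    moreover have "p (t (i, j')) = x" using i(2) permutes_inverses[OF P[OF p]] by metis
    ultimately show ?thesis using i jj by (auto simp: young_diagram_def)
  qed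
  have mY: "m p \<in> ?Y" if p: "p \<in> ?C" for p
    unfolding m_def using rp[OF p] by (intro col_stabilizer_mem[OF p]) (auto simp: tableau_col_def)
  have same: "tabloid lam (transpose x (m p) \<circ> (p \<circ> t)) = tabloid lam (p \<circ> t)" if p: "p \<in> ?C" for p
    using rp[OF p] is_tableau_comp[OF t P[OF p]]
    by (intro tabloid_transpose_same_row[where i = "r p"]) (force simp: tableau_row_def m_def)+
  define F :: "(nat \<Rightarrow> nat) \<times> nat \<Rightarrow> 'k" where
    "F = (\<lambda>(p, y). of_int (sign p) * of_bool (T = tabloid lam (transpose x y \<circ> (p \<circ> t))))"
  let ?A = "{z \<in> ?C \<times> ?Y. snd z \<noteq> m (fst z)}" and ?B = "{z \<in> ?C \<times> ?Y. snd z = m (fst z)}"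
  have "(\<Sum>y\<in>?Y. polytabloid lam (transpose x y \<circ> t) T) = (\<Sum>y\<in>?Y. \<Sum>p\<in>?C. F (p, y))"
  proof (intro sum.cong refl)
    fix y assume "y \<in> ?Y"
    then have y: "y \<in> ?N" using YN by blast
    have "(map ((`) (transpose x y)) T = tabloid lam s) = (T = tabloid lam (transpose x y \<circ> s))" for s
      unfolding tabloid_comp by (metis map_image_transpose_cancel)
    then show "polytabloid lam (transpose x y \<circ> t) T = (\<Sum>p\<in>?C. F (p, y))"
      unfolding polytabloid_transpose[OF xN y]
      by (simp only: polytabloid_def F_def prod.case)
  qed
  also have "\<dots> = (\<Sum>z\<in>?C \<times> ?Y. F z)"
    by (subst sum.swap) (simp add: sum.cartesian_product)
  also have "\<dots> = (\<Sum>z\<in>?A \<union> ?B. F z)" by (intro sum.cong) auto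
  also have "\<dots> = (\<Sum>z\<in>?A. F z) + (\<Sum>z\<in>?B. F z)"
    using finY by (intro sum.union_disjoint finite_Collect_conjI disjI1 finite_cartesian_product) auto
  also have "(\<Sum>z\<in>?A. F z) = 0"
  proof (rule sum_antisymmetric_involution[where i = "\<lambda>(p, y). (transpose y (m p) \<circ> p, m p)"])
    fix z assume "z \<in> ?A"
    then obtain p y where z: "z = (p, y)" and p: "p \<in> ?C" and y: "y \<in> ?Y" "y \<noteq> m p" by auto
    let ?p = "transpose y (m p) \<circ> p"
    have ne: "x \<noteq> y" "x \<noteq> m p" using xY y mY[OF p] by auto
    have p': "?p \<in> ?C"
      using transpose_col_stabilizer[OF t y(1) mY[OF p]] p by (rule col_stabilizer_comp)
    have "inv' ?p x = inv' p x"
      using P[OF p] ne by (simp add: o_inv_distrib permutes_bij)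
    then have r': "r ?p = r p" by (simp add: r_def)
    have "m ?p = ?p (t (r ?p, j))" by (rule m_def)
    also have "\<dots> = transpose y (m p) (m p)" unfolding r' by (simp only: comp_apply m_def[of p])
    finally have m': "m ?p = y" by simp
    show "(case z of (p, y) \<Rightarrow> (transpose y (m p) \<circ> p, m p)) \<in> ?A"
      using z p' m' mY[OF p] y by auto
    show "(case case z of (p, y) \<Rightarrow> (transpose y (m p) \<circ> p, m p) of
        (p, y) \<Rightarrow> (transpose y (m p) \<circ> p, m p)) = z"
      using m' by (simp add: z comp_assoc[symmetric] transpose_commute[of _ y])
    have sgn: "sign ?p = - sign p"
      using y YN mY[OF p] by (intro sign_transpose_comp[OF P[OF p]]) auto
    have "tabloid lam (transpose x (m p) \<circ> (?p \<circ> t)) =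
        tabloid lam ((transpose x y \<circ> transpose x (m p)) \<circ> (p \<circ> t))"
      using transpose_conj[OF ne(1) y(2) ne(2)] by (metis comp_assoc)
    also have "\<dots> = tabloid lam (transpose x y \<circ> (p \<circ> t))"
      unfolding comp_assoc tabloid_comp[of _ "transpose x y"] same[OF p] ..
    finally show "F (case z of (p, y) \<Rightarrow> (transpose y (m p) \<circ> p, m p)) = - F z"
      by (simp only: z F_def prod.case sgn of_int_minus mult_minus_left)
  qed
  also have "(\<Sum>z\<in>?B. F z) = (\<Sum>p\<in>?C. of_int (sign p) * of_bool (T = tabloid lam (p \<circ> t)))"
    using mY by (intro sum.reindex_bij_witness[where i = "\<lambda>p. (p, m p)" and j = fst])
      (auto simp: F_def same)
  finally show ?thesis by (simp only: polytabloid_def[of lam t] add_0)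
qed

text \<open>Moving one entry of row \<open>i\<close> to row \<open>0\<close> defines a map between permutation modules that kills
  polytabloids: an entry \<open>z\<close> that has been moved up shares row \<open>0\<close> with the entry \<open>w z p\<close> above it
  in its column, and exchanging these two reverses the sign. The left-hand side is a coefficient of
  the image of a polytabloid under this map.\<close>

lemma polytabloid_row_relation:
  fixes lam :: "nat list"
  assumes srt: "sorted_wrt (\<ge>) lam" and t: "is_tableau lam t" and s: "is_tableau lam s"
    and T: "T = tabloid lam s" and y: "y \<in> T ! i" and i: "0 < i" "i < length lam"
  shows "polytabloid lam t T + (\<Sum>z\<in>T ! 0. polytabloid lam t (map ((`) (transpose z y)) T)) = (0::'k::field_char_0)"
proof -
  let ?C = "col_stabilizer lam t" and ?N = "{1..sum_list lam}" and ?Z = "insert y (T ! 0)"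
  let ?sw = "\<lambda>z. map ((`) (transpose z y)) T"
  note P = col_stabilizer_permutes
  have row: "T ! k = tableau_row lam s k" if "k < length lam" for k using that T by (simp add: tabloid_nth)
  have l0: "0 < length lam" using i by linarith
  note row0 = row[OF l0]
  have len: "length T = length lam" by (simp add: T tabloid_def)
  have y0: "y \<notin> T ! 0" using y i tableau_row_disjoint[OF s, of y i 0] by (auto simp: row row0)
  have TN: "T ! 0 \<subseteq> ?N" and yN: "y \<in> ?N" using tableau_entry[OF s] y i by (auto simp: row row0 tableau_row_def)
  have fin0: "finite (T ! 0)" using TN finite_subset by blast
  have ZN: "?Z \<subseteq> ?N" using TN yN by auto
  define col where "col z = snd (inv_into (young_diagram lam) t z)" for z
  have inj: "inj_on t (young_diagram lam)" using t by (simp add: is_tableau_def bij_betw_def)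
  have col_t: "col (t c) = snd c" if "c \<in> young_diagram lam" for c
    using that inj by (simp add: col_def)
  have col_p: "col (p (t c)) = snd c" if p: "p \<in> ?C" and c: "c \<in> young_diagram lam" for p c
  proof -
    obtain a b where ab: "c = (a, b)" by (cases c)
    have "p (t c) \<in> tableau_col lam t b"
      using c ab by (intro col_stabilizer_mem[OF p]) (auto simp: tableau_col_def)
    then show ?thesis using ab col_t by (auto simp: tableau_col_def)
  qed
  \<comment> \<open>the entry at the top of the column of \<open>z\<close> in the tableau \<open>p \<circ> t\<close>\<close>
  define w where "w z p = p (t (0, col z))" for z and p :: "nat \<Rightarrow> nat"
  let ?A = "{zp \<in> ?Z \<times> ?C. ?sw (fst zp) = tabloid lam (snd zp \<circ> t)}"
  have key: "z \<in> tableau_row lam (p \<circ> t) i \<and> w z p \<in> ?Z \<and> w z p \<noteq> z \<and> transpose z (w z p) \<circ> p \<in> ?C \<and>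
      ?sw (w z p) = tabloid lam (transpose z (w z p) \<circ> (p \<circ> t)) \<and> w (w z p) (transpose z (w z p) \<circ> p) = z"
    if zp: "(z, p) \<in> ?A" for z p
  proof -
    from zp have z: "z \<in> ?Z" and p: "p \<in> ?C" and eq: "?sw z = tabloid lam (p \<circ> t)" by auto
    have pt: "is_tableau lam (p \<circ> t)" by (rule is_tableau_comp[OF t P[OF p]])
    have rows: "transpose z y ` (T ! k) = tableau_row lam (p \<circ> t) k" if "k < length lam" for k
      using arg_cong[OF eq, of "\<lambda>L. L ! k"] that len by (simp add: tabloid_nth)
    have zi: "z \<in> tableau_row lam (p \<circ> t) i"
      using rows[OF i(2)] y by (metis imageI transpose_apply_second)
    then obtain j where j: "(i, j) \<in> young_diagram lam" "z = p (t (i, j))" by (auto simp: tableau_row_def)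
    have "lam ! i \<le> lam ! 0" using srt i by (auto simp: sorted_wrt_iff_nth_less)
    then have j0: "(0, j) \<in> young_diagram lam" using j i by (auto simp: young_diagram_def)
    have cz: "col z = j" using col_p[OF p j(1)] j(2) by simp
    have wz: "w z p = p (t (0, j))" by (simp add: w_def cz)
    have w0: "w z p \<in> tableau_row lam (p \<circ> t) 0" using j0 wz by (force simp: tableau_row_def)
    then have "w z p \<in> transpose z y ` (T ! 0)" using rows[OF l0] by simp
    then have wZ: "w z p \<in> ?Z" using z y0 by (auto simp: transpose_def split: if_splits)
    have wne: "w z p \<noteq> z" using tableau_row_disjoint[OF pt w0, of i] zi i by auto
    have "z \<in> tableau_col lam (p \<circ> t) j" "w z p \<in> tableau_col lam (p \<circ> t) j"
      using j j0 wz by (force simp: tableau_col_def)+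
    then have "transpose z (w z p) \<in> ?C"
      using transpose_col_stabilizer[OF t, of z j "w z p"] by (simp add: col_stabilizer_col[OF p])
    then have p': "transpose z (w z p) \<circ> p \<in> ?C" using p by (rule col_stabilizer_comp)
    have "?sw (w z p) = map ((`) (transpose z (w z p))) (?sw z)"
    proof -
      consider "z = y" | "w z p = y" "z \<noteq> y" | "z \<noteq> y" "w z p \<noteq> y" by blast
      then show ?thesis
      proof cases
        case 1 then show ?thesis by (simp add: image_image transpose_commute[of y] map_idI)
      next
        case 2 then show ?thesis by (simp add: image_image map_idI)
      next
        case 3
        then have "z \<in> T ! 0" "w z p \<in> T ! 0" using z wZ by auto
        then have "tabloid lam (transpose z (w z p) \<circ> s) = T"
          using tabloid_transpose_same_row[OF s] row0 T by simp
        then have fx: "map ((`) (transpose z (w z p))) T = T" by (simp add: T tabloid_comp)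
        have "transpose z (w z p) \<circ> transpose z y = transpose (w z p) y \<circ> transpose z (w z p)"
          using 3 wne by (auto simp: fun_eq_iff transpose_def)
        then have "map ((`) (transpose z (w z p))) (?sw z) =
            map ((`) (transpose (w z p) y)) (map ((`) (transpose z (w z p))) T)"
          by (simp add: image_comp comp_def[of "(`) _"] )
        then show ?thesis unfolding fx by simp
      qed
    qed
    also have "\<dots> = tabloid lam (transpose z (w z p) \<circ> (p \<circ> t))" by (simp only: eq tabloid_comp[of _ "transpose _ _"])
    finally have sw: "?sw (w z p) = tabloid lam (transpose z (w z p) \<circ> (p \<circ> t))" .
    have "col (w z p) = j" unfolding wz using col_p[OF p j0] by simp
    then have "w (w z p) (transpose z (w z p) \<circ> p) = z"
      by (simp add: w_def[of "w z p"]) (simp add: wz)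
    then show ?thesis using zi wZ wne p' sw by blast
  qed
  define G :: "nat \<times> (nat \<Rightarrow> nat) \<Rightarrow> 'k" where "G = (\<lambda>(z, p). of_int (sign p))"
  have "(\<Sum>zp\<in>?A. G zp) = 0"
  proof (rule sum_antisymmetric_involution[where i = "\<lambda>(z, p). (w z p, transpose z (w z p) \<circ> p)"])
    fix zp assume A: "zp \<in> ?A"
    obtain z p where zp: "zp = (z, p)" by (cases zp)
    note k = key[OF A[unfolded zp]]
    have p: "p permutes ?N" and z: "z \<in> ?Z" using A zp P by auto
    show "(case zp of (z, p) \<Rightarrow> (w z p, transpose z (w z p) \<circ> p)) \<in> ?A"
      using k by (simp add: zp comp_assoc)
    show "(case case zp of (z, p) \<Rightarrow> (w z p, transpose z (w z p) \<circ> p) of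
        (z, p) \<Rightarrow> (w z p, transpose z (w z p) \<circ> p)) = zp"
      using k by (simp add: zp comp_assoc[symmetric] transpose_commute[of _ z])
    have "sign (transpose z (w z p) \<circ> p) = - sign p"
      using k z ZN by (intro sign_transpose_comp[OF p]) auto
    then show "G (case zp of (z, p) \<Rightarrow> (w z p, transpose z (w z p) \<circ> p)) = - G zp"
      by (simp only: zp G_def prod.case of_int_minus)
  qed
  moreover have "(\<Sum>zp\<in>?A. G zp) = (\<Sum>zp\<in>?Z \<times> ?C. of_bool (?sw (fst zp) = tabloid lam (snd zp \<circ> t)) * G zp)"
    using fin0 by (intro sum.mono_neutral_cong_left) auto
  moreover have "\<dots> = (\<Sum>z\<in>?Z. polytabloid lam t (?sw z))"
    unfolding polytabloid_def sum.cartesian_product G_def by (intro sum.cong) (auto simp: mult.commute)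
  moreover have "\<dots> = polytabloid lam t T + (\<Sum>z\<in>T ! 0. polytabloid lam t (?sw z))"
    using fin0 y0 by simp
  ultimately show ?thesis by simp
qed

section \<open>Transpositions and contents\<close>

definition content_sum :: "nat list \<Rightarrow> int" where
  "content_sum lam = (\<Sum>(i, j)\<in>young_diagram lam. int j - int i)"

lemma sorted_young_diagram_up:
  assumes "sorted_wrt (\<ge>) lam" "(i, j) \<in> young_diagram lam" "i' \<le> i"
  shows "(i', j) \<in> young_diagram lam"
proof -
  have "lam ! i \<le> lam ! i'" using assms by (cases "i' = i") (auto simp: young_diagram_def sorted_wrt_iff_nth_less)
  then show ?thesis using assms by (auto simp: young_diagram_def)
qed

text \<open>In the column-by-column order of the cells, every pair of cells is met once when one runs through
  the earlier cells of each cell.\<close>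

definition earlier_cells :: "nat list \<Rightarrow> nat \<times> nat \<Rightarrow> (nat \<times> nat) set" where
  "earlier_cells lam c = {d \<in> young_diagram lam. snd d < snd c \<or> snd d = snd c \<and> fst d < fst c}"

text \<open>Each column further left contributes one copy of the polytabloid by the Garnir relation, and each
  cell above in the same column contributes its negative, so the factor is the content.\<close>

lemma sum_earlier_transpositions:
  fixes T :: "nat set list"
  assumes srt: "sorted_wrt (\<ge>) lam" and t: "is_tableau lam t" and c: "(i, j) \<in> young_diagram lam"
  shows "(\<Sum>d\<in>earlier_cells lam (i, j). polytabloid lam (transpose (t (i, j)) (t d) \<circ> t) T)
    = of_int (int j - int i) * (polytabloid lam t T :: 'k::field_char_0)"
proof -
  let ?e = "\<lambda>d. polytabloid lam (transpose (t (i, j)) (t d) \<circ> t) T :: 'k"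
  let ?col = "\<lambda>j'. (\<lambda>i'. (i', j')) ` {i'. (i', j') \<in> young_diagram lam}"
  let ?L = "\<Union>j'\<in>{..<j}. ?col j'" and ?U = "(\<lambda>i'. (i', j)) ` {..<i}"
  have fincol: "finite {i'. (i', j') \<in> young_diagram lam}" for j'
    by (rule finite_subset[of _ "{..<length lam}"]) (auto simp: young_diagram_def)
  have split: "earlier_cells lam (i, j) = ?L \<union> ?U"
    using sorted_young_diagram_up[OF srt c] c by (auto simp: earlier_cells_def)
  have "(\<Sum>d\<in>?L. ?e d) = (\<Sum>j'\<in>{..<j}. \<Sum>d\<in>?col j'. ?e d)"
    using fincol by (intro sum.UNION_disjoint) auto
  also have "\<dots> = (\<Sum>j'\<in>{..<j}. polytabloid lam t T)"
  proof (intro sum.cong refl)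
    fix j' assume j': "j' \<in> {..<j}"
    have "(\<Sum>d\<in>?col j'. ?e d) =
        (\<Sum>y\<in>tableau_col lam t j'. polytabloid lam (transpose (t (i, j)) y \<circ> t) T)"
    proof (rule sum.reindex_bij_witness[where i = "inv_into (young_diagram lam) t" and j = t])
      have inj: "inj_on t (young_diagram lam)" using t by (simp add: is_tableau_def bij_betw_def)
      show "inv_into (young_diagram lam) t (t a) = a" if "a \<in> ?col j'" for a
        using that inj by auto
      show "t (inv_into (young_diagram lam) t y) = y" "inv_into (young_diagram lam) t y \<in> ?col j'"
        if "y \<in> tableau_col lam t j'" for y
        using that inj by (auto simp: tableau_col_def)
    qed (auto simp: tableau_col_def)
    also have "\<dots> = polytabloid lam t T"
      using j' c by (intro garnir_relation[OF t, of j' j]) (auto simp: tableau_col_def)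
    finally show "(\<Sum>d\<in>?col j'. ?e d) = polytabloid lam t T" .
  qed
  finally have L: "(\<Sum>d\<in>?L. ?e d) = of_nat j * polytabloid lam t T" by simp
  have "(\<Sum>d\<in>?U. ?e d) = (\<Sum>d\<in>?U. - polytabloid lam t T)"
  proof (intro sum.cong refl)
    fix d assume "d \<in> ?U"
    then obtain i' where d: "d = (i', j)" "i' < i" by auto
    then have d': "d \<in> young_diagram lam" using sorted_young_diagram_up[OF srt c, of i'] by simp
    then have "transpose (t (i, j)) (t d) \<in> col_stabilizer lam t"
      using c d by (intro transpose_col_stabilizer[OF t, of _ j]) (auto simp: tableau_col_def)
    moreover have "t (i, j) \<noteq> t d" using tableau_eq_iff[OF t c d'] d by simp
    ultimately show "?e d = - polytabloid lam t T"
      by (simp add: polytabloid_col_stabilizer sign_swap_id fun_scale_def)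
  qed
  also have "\<dots> = - of_nat i * polytabloid lam t T"
    by (simp add: card_image inj_on_def)
  finally have U: "(\<Sum>d\<in>?U. ?e d) = - of_nat i * polytabloid lam t T" .
  have "(\<Sum>d\<in>earlier_cells lam (i, j). ?e d) = (\<Sum>d\<in>?L. ?e d) + (\<Sum>d\<in>?U. ?e d)"
    unfolding split using fincol by (intro sum.union_disjoint) auto
  then show ?thesis unfolding L U by (simp add: algebra_simps)
qed

lemma sum_transpositions_polytabloid:
  fixes T :: "nat set list"
  assumes srt: "sorted_wrt (\<ge>) lam" and t: "is_tableau lam t"
  defines "P \<equiv> {(x, y). x \<in> {1..sum_list lam} \<and> y \<in> {1..sum_list lam} \<and> x \<noteq> y}"
  shows "(\<Sum>(x, y)\<in>P. perm_act (transpose x y) (polytabloid lam t) T)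
    = of_int (2 * content_sum lam) * (polytabloid lam t T :: 'k::field_char_0)"
proof -
  let ?D = "young_diagram lam"
  let ?e = "\<lambda>(c, d). polytabloid lam (transpose (t c) (t d) \<circ> t) T :: 'k"
  let ?E = "Sigma ?D (earlier_cells lam)"
  have finE: "finite ?E"
    by (intro finite_SigmaI) (auto simp: earlier_cells_def)
  have bij: "bij_betw t ?D {1..sum_list lam}" using t by (simp add: is_tableau_def)
  have "(\<Sum>(x, y)\<in>P. perm_act (transpose x y) (polytabloid lam t) T) =
      (\<Sum>(x, y)\<in>P. polytabloid lam (transpose x y \<circ> t) T :: 'k)"
    by (intro sum.cong) (auto simp: P_def perm_act_polytabloid permutes_swap_id)
  also have "\<dots> = (\<Sum>cd\<in>{(c, d). c \<in> ?D \<and> d \<in> ?D \<and> c \<noteq> d}. ?e cd)"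
  proof (rule sum.reindex_bij_witness[where j = "\<lambda>(x, y). (inv_into ?D t x, inv_into ?D t y)"
        and i = "\<lambda>(c, d). (t c, t d)"], goal_cases)
    case (1 a) then show ?case using bij by (auto simp: P_def bij_betw_inv_into_right)
  next
    case (2 a)
    then obtain x y where xy: "a = (x, y)" "x \<in> {1..sum_list lam}" "y \<in> {1..sum_list lam}" "x \<noteq> y"
      unfolding P_def by blast
    then obtain c d where "c \<in> ?D" "d \<in> ?D" "x = t c" "y = t d"
      using bij_betw_imp_surj_on[OF bij] by blast
    then have a: "a = (t c, t d)" "c \<in> ?D" "d \<in> ?D" "t c \<noteq> t d" using xy by auto
    then show ?case using bij by (auto simp: bij_betw_inv_into_left)
  next
    case (3 b) then show ?case using bij by (auto simp: bij_betw_inv_into_left)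
  next
    case (4 b) then show ?case using tableau_entry[OF t] tableau_eq_iff[OF t] by (auto simp: P_def)
  next
    case (5 a) then show ?case using bij by (auto simp: P_def bij_betw_inv_into_right)
  qed
  also have "{(c, d). c \<in> ?D \<and> d \<in> ?D \<and> c \<noteq> d} = ?E \<union> prod.swap ` ?E"
    by (auto simp: earlier_cells_def image_iff)
  also have "(\<Sum>cd\<in>?E \<union> prod.swap ` ?E. ?e cd) = (\<Sum>cd\<in>?E. ?e cd) + (\<Sum>cd\<in>prod.swap ` ?E. ?e cd)"
    using finE by (intro sum.union_disjoint) (auto simp: earlier_cells_def)
  also have "(\<Sum>cd\<in>prod.swap ` ?E. ?e cd) = (\<Sum>cd\<in>?E. ?e cd)"
    by (subst sum.reindex) (auto simp: case_prod_unfold transpose_commute)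
  also have "(\<Sum>cd\<in>?E. ?e cd) = (\<Sum>c\<in>?D. \<Sum>d\<in>earlier_cells lam c. ?e (c, d))"
    by (subst sum.Sigma) (auto simp: earlier_cells_def)
  also have "\<dots> = (\<Sum>c\<in>?D. of_int (int (snd c) - int (fst c)) * polytabloid lam t T)"
    by (intro sum.cong refl) (auto simp: sum_earlier_transpositions[OF srt t, simplified])
  also have "\<dots> = of_int (content_sum lam) * polytabloid lam t T"
    by (simp add: content_sum_def sum_distrib_right case_prod_unfold)
  finally show ?thesis by (simp add: algebra_simps)
qed

lemma specht_module_eq_on_span:
  assumes f: "Vector_Spaces.linear fun_scale fun_scale f" and g: "Vector_Spaces.linear fun_scale fun_scale g"
    and eq: "\<And>t. is_tableau lam t \<Longrightarrow> f (polytabloid lam t) = g (polytabloid lam t)"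
    and v: "v \<in> specht_module lam"
  shows "f v = (g v :: 'b \<Rightarrow> 'k::field_char_0)"
proof -
  interpret f: Vector_Spaces.linear fun_scale fun_scale f by (rule f)
  interpret g: Vector_Spaces.linear fun_scale fun_scale g by (rule g)
  show ?thesis using v unfolding specht_module_def
  proof (induction rule: fn.span_induct_alt)
    case base then show ?case by (simp only: f.zero g.zero)
  next
    case (step c x y)
    then have "f x = g x" using eq by blast
    then show ?case by (simp only: f.add f.scale g.add g.scale step(2))
  qed
qed

lemma linear_sum_perm_act:
  fixes c :: "'i \<Rightarrow> 'k::field"
  shows "Vector_Spaces.linear fun_scale fun_scale
    (\<lambda>v :: nat set list \<Rightarrow> 'k. \<Sum>i\<in>I. fun_scale (c i) (perm_act (g i) v))"
proof -
  have "\<And>x. perm_act g v x = v (map ((`) (inv' g)) x)" for g and v :: "nat set list \<Rightarrow> 'k"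
    by (simp add: perm_act_def)
  then show ?thesis
    by unfold_locales (auto simp: fun_scale_def fun_eq_iff algebra_simps sum_fun_apply sum.distrib sum_distrib_left)
qed

lemma linear_fun_scale: "Vector_Spaces.linear fun_scale fun_scale (fun_scale (c::'k::field) :: ('a \<Rightarrow> 'k) \<Rightarrow> _)"
  by unfold_locales (auto simp: fun_scale_def fun_eq_iff algebra_simps)

text \<open>The sum of all transpositions acts as a scalar by
  \<open>sum_transpositions_polytabloid\<close>; since transpositions are conjugate, taking traces gives the value of the character. The factor \<open>2\<close> comes from counting
  every transposition twice.\<close>

lemma specht_character_transposition:
  assumes srt: "sorted_wrt (\<ge>) lam" and n: "sum_list lam = n" and ab: "a \<in> {1..n}" "b \<in> {1..n}" "a \<noteq> b"
  shows "of_nat (n * (n - 1)) * specht_character lam (transpose a b)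
    = of_int (2 * content_sum lam) * (specht_character lam id :: 'k::field_char_0)"
proof -
  let ?V = "specht_module lam :: (nat set list \<Rightarrow> 'k) set"
  let ?P = "{(x, y). x \<in> {1..n} \<and> y \<in> {1..n} \<and> x \<noteq> y}"
  let ?f = "\<lambda>v :: nat set list \<Rightarrow> 'k. \<Sum>xy\<in>?P. fun_scale 1 (perm_act (transpose (fst xy) (snd xy)) v)"
  obtain B :: "(nat set list \<Rightarrow> 'k) set" where B: "finite B" "is_basis_of B ?V"
    using specht_module_finite_basis by blast
  have f: "?f v = fun_scale (of_int (2 * content_sum lam)) v" if "v \<in> ?V" for v
  proof (rule specht_module_eq_on_span[OF linear_sum_perm_act linear_fun_scale _ that])
    fix t assume t: "is_tableau lam t"
    show "?f (polytabloid lam t) = fun_scale (of_int (2 * content_sum lam)) (polytabloid lam t)"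
    proof
      fix T
      show "?f (polytabloid lam t) T = fun_scale (of_int (2 * content_sum lam)) (polytabloid lam t) T"
        using sum_transpositions_polytabloid[OF srt t, of T, where 'k='k]
        by (simp add: n fun_scale_def sum_fun_apply case_prod_unfold)
    qed
  qed
  have conj: "specht_character lam (transpose x y) = (specht_character lam (transpose a b) :: 'k)"
    if xy: "x \<in> {1..n}" "y \<in> {1..n}" "x \<noteq> y" for x y
  proof -
    define h where "h = transpose (transpose x a b) y \<circ> transpose x a"
    have h: "h permutes {1..n}" unfolding h_def using ab xy
      by (intro permutes_compose permutes_swap_id) (auto simp: transpose_def)
    have ha: "h a = x" "h b = y" using ab xy by (auto simp: h_def transpose_def)
    have "h \<circ> transpose a b \<circ> inv' h = transpose x y"
    proof
      fix z
      obtain w where z: "z = h w" using permutes_surj[OF h] by blast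
      then show "(h \<circ> transpose a b \<circ> inv' h) z = transpose x y z"
        using permutes_inverses[OF h] ha permutes_inj[OF h] by (auto simp: transpose_def inj_eq)
    qed
    then show ?thesis
      using specht_character_conj[of "transpose a b" lam h, where 'k='k] h ab n by (simp add: permutes_swap_id)
  qed
  have "?P = {1..n} \<times> {1..n} - (\<lambda>x. (x, x)) ` {1..n}" by auto
  then have "card ?P = n * n - n"
    by (simp only:, subst card_Diff_subset) (auto simp: card_image inj_on_def card_cartesian_product)
  then have card: "card ?P = n * (n - 1)" by (simp add: algebra_simps)
  have "(\<Sum>xy\<in>?P. 1 * trace_on ?V (perm_act (transpose (fst xy) (snd xy)))) = trace_on ?V ?f"
    using B(2) specht_module_invariant[of "transpose _ _" lam, where 'k='k] n
    by (intro trace_on_sum[symmetric]) (auto simp: permutes_swap_id image_subset_iff)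
  also have "\<dots> = of_int (2 * content_sum lam) * of_nat (card B)"
    by (rule trace_on_scalar[OF B(2,1) f])
  also have "of_nat (card B) = (specht_character lam id :: 'k)"
    unfolding specht_character_def using trace_on_scalar[OF B(2,1), of "perm_act id" 1]
    by (simp add: fun_scale_def)
  also have "(\<Sum>xy\<in>?P. 1 * trace_on ?V (perm_act (transpose (fst xy) (snd xy)))) =
      (\<Sum>xy\<in>?P. specht_character lam (transpose a b))"
    using conj by (intro sum.cong) (auto simp: specht_character_def)
  finally show ?thesis by (simp only: sum_constant card)
qed

section \<open>Isotypic components for the permutations of a set of points\<close>

lemma permutes_disjoint_commute:
  assumes "z permutes A" "y permutes B" "A \<inter> B = {}"
  shows "z \<circ> y = y \<circ> z"
proof
  fix v
  consider "v \<in> A" | "v \<in> B" | "v \<notin> A" "v \<notin> B" by blast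
  then show "(z \<circ> y) v = (y \<circ> z) v"
  proof cases
    case 1
    then have "z v \<in> A" using permutes_in_image[OF assms(1)] by simp
    then have "z v \<notin> B" "v \<notin> B" using 1 assms(3) by auto
    then show ?thesis using permutes_not_in[OF assms(2)] by simp
  next
    case 2
    then have "y v \<in> B" using permutes_in_image[OF assms(2)] by simp
    then have "y v \<notin> A" "v \<notin> A" using 2 assms(3) by auto
    then show ?thesis using permutes_not_in[OF assms(1)] by simp
  next
    case 3 then show ?thesis using permutes_not_in[OF assms(1)] permutes_not_in[OF assms(2)] by simp
  qed
qed

definition isotypic :: "((nat \<Rightarrow> nat) \<Rightarrow> int) \<Rightarrow> nat set \<Rightarrow> nat list \<Rightarrow> (nat set list \<Rightarrow> 'k::field_char_0) set" where
  "isotypic eps A lam =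
     {v \<in> specht_module lam. \<forall>x. x permutes A \<longrightarrow> perm_act x v = fun_scale (of_int (eps x)) v}"

definition symmetrizer :: "((nat \<Rightarrow> nat) \<Rightarrow> int) \<Rightarrow> nat set \<Rightarrow> (nat set list \<Rightarrow> 'k::field_char_0) \<Rightarrow> nat set list \<Rightarrow> 'k" where
  "symmetrizer eps A v = (\<Sum>x | x permutes A. fun_scale (of_int (eps x)) (perm_act x v))"

definition linear_character :: "((nat \<Rightarrow> nat) \<Rightarrow> int) \<Rightarrow> nat set \<Rightarrow> bool" where
  "linear_character eps A \<longleftrightarrow> finite A \<and> (\<forall>x y. x permutes A \<longrightarrow> y permutes A \<longrightarrow>
     eps (x \<circ> y) = eps x * eps y \<and> eps x * eps x = 1)"

lemma linear_character_trivial: "finite A \<Longrightarrow> linear_character (\<lambda>x. 1) A"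
  by (simp add: linear_character_def)

lemma linear_character_sign: "finite A \<Longrightarrow> linear_character sign A"
  by (simp add: linear_character_def sign_comp_permutes)

lemma symmetrizer_linear: "Vector_Spaces.linear fun_scale fun_scale (symmetrizer eps A)"
  using linear_sum_perm_act unfolding symmetrizer_def .

lemma perm_act_symmetrizer:
  assumes eps: "linear_character eps A" and y: "y permutes A"
  shows "perm_act y (symmetrizer eps A v) = fun_scale (of_int (eps y)) (symmetrizer eps A v :: _ \<Rightarrow> 'k::field_char_0)"
proof
  fix T
  have "perm_act y (symmetrizer eps A v) T =
      (\<Sum>x | x permutes A. of_int (eps x) * perm_act y (perm_act x v) T)"
    by (simp add: perm_act_def[of y] symmetrizer_def sum_fun_apply fun_scale_def)
  also have "\<dots> = (\<Sum>x | x permutes A. of_int (eps x) * perm_act (y \<circ> x) v T)"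
    using y by (intro sum.cong) (auto simp: perm_act_comp permutes_bij)
  also have "\<dots> = (\<Sum>x | x permutes A. of_int (eps y) * (of_int (eps (y \<circ> x)) * perm_act (y \<circ> x) v T))"
  proof (intro sum.cong refl)
    fix x assume "x \<in> {x. x permutes A}"
    then have e: "eps (y \<circ> x) = eps y * eps x" "eps y * eps y = 1"
      using eps y unfolding linear_character_def by blast+
    have "eps y * eps (y \<circ> x) = eps x" by (simp only: e(1) mult.assoc[symmetric] e(2) mult_1_left)
    then have "of_int (eps y) * of_int (eps (y \<circ> x)) = (of_int (eps x) :: 'k)"
      by (simp only: of_int_mult[symmetric])
    then show "of_int (eps x) * perm_act (y \<circ> x) v T = of_int (eps y) * (of_int (eps (y \<circ> x)) * perm_act (y \<circ> x) v T)"
      by (simp only: mult.assoc[symmetric])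
  qed
  also have "\<dots> = (\<Sum>x | x permutes A. of_int (eps y) * (of_int (eps x) * perm_act x v T))"
    using setum_permutations_compose_left[OF y, of "\<lambda>x. of_int (eps y) * (of_int (eps x) * perm_act x v T)"] by simp
  also have "\<dots> = fun_scale (of_int (eps y)) (symmetrizer eps A v) T"
    by (simp add: symmetrizer_def sum_fun_apply fun_scale_def sum_distrib_left)
  finally show "perm_act y (symmetrizer eps A v) T = fun_scale (of_int (eps y)) (symmetrizer eps A v :: _ \<Rightarrow> 'k) T" .
qed

lemma symmetrizer_perm_act:
  assumes eps: "linear_character eps A" and y: "y permutes A"
  shows "symmetrizer eps A (perm_act y v) = fun_scale (of_int (eps y)) (symmetrizer eps A v :: _ \<Rightarrow> 'k::field_char_0)"
proof
  fix T
  have "symmetrizer eps A (perm_act y v) T =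
      (\<Sum>x | x permutes A. of_int (eps x) * perm_act (x \<circ> y) v T)"
    unfolding symmetrizer_def sum_fun_apply fun_scale_def
    using y by (intro sum.cong) (auto simp: perm_act_comp permutes_bij)
  also have "\<dots> = (\<Sum>x | x permutes A. of_int (eps y) * (of_int (eps (x \<circ> y)) * perm_act (x \<circ> y) v T))"
  proof (intro sum.cong refl)
    fix x assume "x \<in> {x. x permutes A}"
    then have e: "eps (x \<circ> y) = eps x * eps y" "eps y * eps y = 1"
      using eps y unfolding linear_character_def by blast+
    have "eps y * eps (x \<circ> y) = eps x" by (simp only: e(1) mult.left_commute[of _ "eps x"] e(2) mult_1_right)
    then have "of_int (eps y) * of_int (eps (x \<circ> y)) = (of_int (eps x) :: 'k)"
      by (simp only: of_int_mult[symmetric])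
    then show "of_int (eps x) * perm_act (x \<circ> y) v T = of_int (eps y) * (of_int (eps (x \<circ> y)) * perm_act (x \<circ> y) v T)"
      by (simp only: mult.assoc[symmetric])
  qed
  also have "\<dots> = (\<Sum>x | x permutes A. of_int (eps y) * (of_int (eps x) * perm_act x v T))"
    using sum_permutations_compose_right[OF y, of "\<lambda>x. of_int (eps y) * (of_int (eps x) * perm_act x v T)"] by simp
  also have "\<dots> = fun_scale (of_int (eps y)) (symmetrizer eps A v) T"
    by (simp add: symmetrizer_def sum_fun_apply fun_scale_def sum_distrib_left)
  finally show "symmetrizer eps A (perm_act y v) T = fun_scale (of_int (eps y)) (symmetrizer eps A v :: _ \<Rightarrow> 'k) T" .
qed

lemma isotypic_subspace: "fn.subspace (isotypic eps A lam)"
proof -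
  have lin: "perm_act x (v + w) = perm_act x v + perm_act x w"
      "perm_act x (fun_scale c v) = fun_scale c (perm_act x v)"
      "perm_act x 0 = 0" for x c and v w :: "nat set list \<Rightarrow> 'a"
    by (auto simp: perm_act_def fun_scale_def fun_eq_iff)
  have sub: "fn.subspace (specht_module lam)" by (rule specht_module_subspace)
  show ?thesis
    using fn.subspace_0[OF sub] fn.subspace_add[OF sub] fn.subspace_scale[OF sub]
    by (auto simp: isotypic_def fn.subspace_def lin fn.scale_right_distrib fn.scale_left_commute)
qed

lemma symmetrizer_specht_module:
  assumes "A \<subseteq> {1..sum_list lam}" "v \<in> specht_module lam"
  shows "symmetrizer eps A v \<in> specht_module lam"
  unfolding symmetrizer_def
proof (intro fn.subspace_sum fn.subspace_scale specht_module_subspace)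
  fix x assume "x \<in> {x. x permutes A}"
  then have "x permutes {1..sum_list lam}" using permutes_subset assms(1) by blast
  then show "perm_act x v \<in> specht_module lam" using specht_module_invariant assms(2) by blast
qed

lemma symmetrizer_isotypic:
  assumes "linear_character eps A" "A \<subseteq> {1..sum_list lam}" "v \<in> specht_module lam"
  shows "symmetrizer eps A v \<in> isotypic eps A lam"
  using assms symmetrizer_specht_module perm_act_symmetrizer by (auto simp: isotypic_def)

lemma symmetrizer_of_isotypic:
  assumes "linear_character eps A" "v \<in> isotypic eps A lam"
  shows "symmetrizer eps A v = fun_scale (fact (card A)) (v :: _ \<Rightarrow> 'k::field_char_0)"
proof
  fix T
  have "of_int (eps x) * (of_int (eps x) * v T) = v T" if "x permutes A" for x
  proof -
    have "eps x * eps x = 1" using assms(1) that by (simp add: linear_character_def)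
    then have "of_int (eps x) * of_int (eps x) = (1 :: 'k)" by (simp only: of_int_mult[symmetric]) simp
    then show ?thesis by (simp only: mult.assoc[symmetric]) simp
  qed
  moreover have "perm_act x v T = of_int (eps x) * v T" if "x permutes A" for x
    using assms(2) that by (simp add: isotypic_def fun_scale_def)
  ultimately have "symmetrizer eps A v T = (\<Sum>x | x permutes A. v T)"
    unfolding symmetrizer_def sum_fun_apply fun_scale_def by (intro sum.cong) auto
  moreover have "card {x. x permutes A} = fact (card A)"
    using assms(1) by (intro card_permutations) (auto simp: linear_character_def)
  ultimately show "symmetrizer eps A v T = fun_scale (fact (card A)) v T"
    by (simp add: fun_scale_def)
qed

lemma isotypic_finite_basis:
  obtains B :: "(nat set list \<Rightarrow> 'k::field_char_0) set" where "finite B" "is_basis_of B (isotypic eps A lam)"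
proof -
  obtain B :: "(nat set list \<Rightarrow> 'k) set" where B: "finite B" "is_basis_of B (specht_module lam)"
    using specht_module_finite_basis by blast
  have "isotypic eps A lam \<subseteq> (specht_module lam :: (_ \<Rightarrow> 'k) set)" by (auto simp: isotypic_def)
  from subspace_finite_basis[OF B(2,1) isotypic_subspace this] that show ?thesis by blast
qed

text \<open>A permutation that fixes the points of \<open>A\<close> commutes with the permutations of \<open>A\<close>.\<close>

lemma perm_act_isotypic:
  assumes A: "A \<subseteq> {1..sum_list lam}" and g: "g permutes {1..sum_list lam} - A"
    and v: "v \<in> isotypic eps A lam"
  shows "perm_act g v \<in> (isotypic eps A lam :: (_ \<Rightarrow> 'k::field_char_0) set)"
proof -
  have gN: "g permutes {1..sum_list lam}" using permutes_subset[OF g] by blast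
  note gV = specht_module_invariant[OF gN, where 'k='k]
  have "perm_act x (perm_act g v) = fun_scale (of_int (eps x)) (perm_act g v)" if x: "x permutes A" for x
  proof -
    have "x \<circ> g = g \<circ> x" using x g by (rule permutes_disjoint_commute) blast
    then have "perm_act x (perm_act g v) = perm_act g (perm_act x v)"
      using permutes_bij[OF g] permutes_bij[OF x] by (simp add: perm_act_comp)
    also have "\<dots> = fun_scale (of_int (eps x)) (perm_act g v)"
      using v x by (simp add: isotypic_def) (simp add: perm_act_def fun_scale_def)
    finally show ?thesis .
  qed
  then show ?thesis using v gV by (auto simp: isotypic_def)
qed

text \<open>The operator that averages over \<open>A\<close> maps the Specht module into the isotypic component and acts on
  it as a multiple of the identity, so only the trace on this component is left.\<close>

lemma character_average_eq_trace:
  assumes eps: "linear_character eps A" and A: "A \<subseteq> {1..sum_list lam}"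
    and g: "g permutes {1..sum_list lam} - A"
  shows "(\<Sum>x | x permutes A. of_int (eps x) * specht_character lam (x \<circ> g))
    = (fact (card A) * trace_on (isotypic eps A lam) (perm_act g) :: 'k::field_char_0)"
proof -
  let ?V = "specht_module lam :: (nat set list \<Rightarrow> 'k) set" and ?X = "{x. x permutes A}"
  let ?W = "isotypic eps A lam :: (nat set list \<Rightarrow> 'k) set"
  let ?f = "\<lambda>v :: nat set list \<Rightarrow> 'k. \<Sum>x\<in>?X. fun_scale (of_int (eps x)) (perm_act (x \<circ> g) v)"
  have gN: "g permutes {1..sum_list lam}" using permutes_subset[OF g] by blast
  have xN: "x permutes {1..sum_list lam}" if "x permutes A" for x using permutes_subset[OF that A] .
  note gV = specht_module_invariant[OF gN, where 'k='k]
  obtain B where B: "finite B" "is_basis_of B ?V" using specht_module_finite_basis by blast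
  obtain B' where B': "finite B'" "is_basis_of B' ?W" by (rule isotypic_finite_basis)
  have f: "?f v = symmetrizer eps A (perm_act g v)" for v
    unfolding symmetrizer_def using permutes_bij[OF g]
    by (intro sum.cong) (auto simp: perm_act_comp permutes_bij)
  have WV: "?W \<subseteq> ?V" by (auto simp: isotypic_def)
  have fW: "?f v \<in> ?W" if "v \<in> ?V" for v
    unfolding f using gV that by (intro symmetrizer_isotypic eps A) blast
  note gW = perm_act_isotypic[OF A g, where 'k='k]
  have "(\<Sum>x\<in>?X. of_int (eps x) * specht_character lam (x \<circ> g)) = trace_on ?V ?f"
    unfolding specht_character_def
  proof (rule trace_on_sum[OF B(2), symmetric])
    fix x v assume "x \<in> ?X" "v \<in> ?V"
    then show "perm_act (x \<circ> g) v \<in> ?V"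
      using specht_module_invariant[OF permutes_compose[OF gN xN], of x] by blast
  qed
  also have "\<dots> = trace_on ?W ?f"
    using fW WV by (intro trace_on_subspace[OF linear_sum_perm_act B(2,1) isotypic_subspace]) auto
  also have "\<dots> = trace_on ?W (\<lambda>v. \<Sum>u\<in>{()}. fun_scale (fact (card A)) (perm_act g v))"
    by (intro trace_on_cong[OF B'(2)]) (simp add: f symmetrizer_of_isotypic[OF eps gW])
  also have "\<dots> = fact (card A) * trace_on ?W (perm_act g)"
    using gW by (subst trace_on_sum[OF B'(2)]) auto
  finally show ?thesis .
qed

text \<open>Up to a nonzero factor, the symmetrizer is a projection onto the isotypic component.\<close>

lemma isotypic_eq_span:
  assumes eps: "linear_character eps A" and A: "A \<subseteq> {1..sum_list lam}"
    and E: "E \<subseteq> specht_module lam"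
    and gen: "\<And>t. is_tableau lam t \<Longrightarrow> symmetrizer eps A (polytabloid lam t) \<in> fn.span (symmetrizer eps A ` E)"
  shows "isotypic eps A lam = (fn.span (symmetrizer eps A ` E) :: (nat set list \<Rightarrow> 'k::field_char_0) set)"
proof
  let ?P = "symmetrizer eps A :: (nat set list \<Rightarrow> 'k) \<Rightarrow> _"
  interpret P: Vector_Spaces.linear fun_scale fun_scale ?P by (rule symmetrizer_linear)
  show "fn.span (?P ` E) \<subseteq> isotypic eps A lam"
    using E symmetrizer_isotypic[OF eps A] by (intro fn.span_minimal isotypic_subspace) blast
  show "isotypic eps A lam \<subseteq> fn.span (?P ` E)"
  proof
    fix v :: "nat set list \<Rightarrow> 'k" assume v: "v \<in> isotypic eps A lam"
    then have "v \<in> specht_module lam" by (simp add: isotypic_def)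
    then have "?P v \<in> ?P ` fn.span {polytabloid lam t |t. is_tableau lam t}"
      unfolding specht_module_def by (rule imageI)
    also have "\<dots> = fn.span (?P ` {polytabloid lam t |t. is_tableau lam t})"
      by (rule P.span_image[symmetric])
    also have "\<dots> \<subseteq> fn.span (?P ` E)"
      using gen by (intro fn.span_minimal) auto
    finally have "fun_scale (inverse (fact (card A))) (?P v) \<in> fn.span (?P ` E)"
      by (rule fn.span_scale)
    then show "v \<in> fn.span (?P ` E)"
      unfolding symmetrizer_of_isotypic[OF eps v] by (simp add: fn.scale_scale)
  qed
qed

lemma trace_on_zero_space:
  assumes "f 0 = 0"
  shows "trace_on {0 :: 'a \<Rightarrow> 'k::field} f = 0"
proof -
  have "is_basis_of {} ({0} :: ('a \<Rightarrow> 'k) set)" by (simp add: is_basis_of_def fn.independent_empty)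
  from trace_on_scalar[OF this, of f 0] assms show ?thesis by simp
qed

lemma symmetrizer_transpose_polytabloid:
  assumes eps: "linear_character eps A" and A: "A \<subseteq> {1..sum_list lam}" and xy: "x \<in> A" "y \<in> A"
  shows "symmetrizer eps A (polytabloid lam (transpose x y \<circ> t))
    = fun_scale (of_int (eps (transpose x y))) (symmetrizer eps A (polytabloid lam t) :: _ \<Rightarrow> 'k::field_char_0)"
proof -
  have p: "transpose x y permutes A" using xy by (rule permutes_swap_id)
  have "polytabloid lam (transpose x y \<circ> t) = perm_act (transpose x y) (polytabloid lam t :: _ \<Rightarrow> 'k)"
    using permutes_subset[OF p A] by (rule perm_act_polytabloid[symmetric])
  then show ?thesis by (simp only: symmetrizer_perm_act[OF eps p])
qed

text \<open>Points of \<open>A\<close> are moved to the first row one by one. If \<open>a\<close> is not yet there, exchanging it with the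
  entry \<open>z\<close> at the top of its column changes the sign of the polytabloid. If \<open>z\<close> belongs to \<open>A\<close> as
  well, the symmetrizer does not notice this exchange, and the symmetrized polytabloid is zero.\<close>

lemma row_symmetrizer_span:
  assumes srt: "sorted_wrt (\<ge>) lam" and A: "A \<subseteq> {1..sum_list lam}" and t: "is_tableau lam t"
  shows "symmetrizer (\<lambda>_. 1) A (polytabloid lam t) \<in>
    (fn.span (symmetrizer (\<lambda>_. 1) A ` {polytabloid lam s |s. is_tableau lam s \<and> A \<subseteq> tableau_row lam s 0})
      :: (nat set list \<Rightarrow> 'k::field_char_0) set)"
  using t
proof (induction "card (A - tableau_row lam t 0)" arbitrary: t rule: less_induct)
  case (less t)
  note t = less.prems
  let ?P = "symmetrizer (\<lambda>_. 1) A :: (nat set list \<Rightarrow> 'k) \<Rightarrow> _"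
  let ?S = "fn.span (?P ` {polytabloid lam s |s. is_tableau lam s \<and> A \<subseteq> tableau_row lam s 0})"
  interpret P: Vector_Spaces.linear fun_scale fun_scale ?P by (rule symmetrizer_linear)
  have finA: "finite A" using A finite_subset by blast
  show ?case
  proof (cases "A \<subseteq> tableau_row lam t 0")
    case True then show ?thesis using t by (intro fn.span_base) auto
  next
    case False
    then obtain a where a: "a \<in> A" "a \<notin> tableau_row lam t 0" by blast
    then obtain i j where ij: "(i, j) \<in> young_diagram lam" "a = t (i, j)"
      using tableau_obtain_cell[OF t] A by blast
    define z where "z = t (0, j)"
    have d0: "(0, j) \<in> young_diagram lam" using sorted_young_diagram_up[OF srt ij(1)] by simp
    then have z0: "z \<in> tableau_row lam t 0" by (auto simp: tableau_row_def z_def)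
    then have az: "a \<noteq> z" using a by auto
    have zN: "z \<in> {1..sum_list lam}" using tableau_entry[OF t d0] by (simp add: z_def)
    have c: "transpose a z \<in> col_stabilizer lam t"
      using ij d0 by (intro transpose_col_stabilizer[OF t, of _ j]) (auto simp: tableau_col_def z_def)
    have neg: "polytabloid lam (transpose a z \<circ> t) = - (polytabloid lam t :: _ \<Rightarrow> 'k)"
      using polytabloid_col_stabilizer[OF c, where 'k='k] az by (simp add: sign_swap_id fun_scale_def fun_eq_iff)
    have Pt: "?P (polytabloid lam t) = - ?P (polytabloid lam (transpose a z \<circ> t))"
      unfolding neg by (simp add: P.neg)
    show ?thesis
    proof (cases "z \<in> A")
      case True
      have "?P (polytabloid lam (transpose a z \<circ> t)) = ?P (polytabloid lam t)"
        using symmetrizer_transpose_polytabloid[OF linear_character_trivial[OF finA] A a(1) True, of t, where 'k='k]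
        by simp
      with Pt have "?P (polytabloid lam t) = - ?P (polytabloid lam t)" by simp
      then have "?P (polytabloid lam t) = 0" by (simp add: fun_eq_iff)
      then show ?thesis by (simp only: fn.span_zero)
    next
      case False
      let ?t = "transpose a z \<circ> t"
      have t': "is_tableau lam ?t"
        using a A zN by (intro is_tableau_comp[OF t] permutes_swap_id) auto
      have "A - tableau_row lam ?t 0 \<subseteq> A - tableau_row lam t 0 - {a}"
      proof
        fix b assume b: "b \<in> A - tableau_row lam ?t 0"
        have "a \<in> tableau_row lam ?t 0" unfolding tableau_row_comp using z0 by (force simp: image_iff)
        then have "b \<noteq> a" "b \<noteq> z" using b False by auto
        then have "b \<notin> tableau_row lam t 0"
          using b unfolding tableau_row_comp by (force simp: image_iff)
        then show "b \<in> A - tableau_row lam t 0 - {a}" using b \<open>b \<noteq> a\<close> by simp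
      qed
      moreover have "card (A - tableau_row lam t 0 - {a}) < card (A - tableau_row lam t 0)"
        using a finA by (intro card_Diff1_less) auto
      ultimately have "card (A - tableau_row lam ?t 0) < card (A - tableau_row lam t 0)"
        using finA by (meson card_mono finite_Diff le_less_trans)
      from less.hyps[OF this t'] show ?thesis unfolding Pt by (rule fn.span_neg)
    qed
  qed
qed

text \<open>Points of \<open>A\<close> are moved to the first column one by one, by the Garnir relation for a point \<open>y\<close>
  outside the first column. Exchanging \<open>y\<close> with another point of \<open>A\<close> gives the negative after
  antisymmetrization; such terms are collected on the left-hand side, where the coefficient
  becomes a positive integer. All other terms have one more point of \<open>A\<close> in the first column.\<close>

lemma column_antisymmetrizer_span:
  assumes A: "A \<subseteq> {1..sum_list lam}" and t: "is_tableau lam t"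
  shows "symmetrizer sign A (polytabloid lam t) \<in>
    (fn.span (symmetrizer sign A ` {polytabloid lam s |s. is_tableau lam s \<and> A \<subseteq> tableau_col lam s 0})
      :: (nat set list \<Rightarrow> 'k::field_char_0) set)"
  using t
proof (induction "card (A - tableau_col lam t 0)" arbitrary: t rule: less_induct)
  case (less t)
  note t = less.prems
  let ?P = "symmetrizer sign A :: (nat set list \<Rightarrow> 'k) \<Rightarrow> _"
  let ?S = "fn.span (?P ` {polytabloid lam s |s. is_tableau lam s \<and> A \<subseteq> tableau_col lam s 0})"
  interpret P: Vector_Spaces.linear fun_scale fun_scale ?P by (rule symmetrizer_linear)
  have finA: "finite A" using A finite_subset by blast
  show ?case
  proof (cases "A \<subseteq> tableau_col lam t 0")
    case True then show ?thesis using t by (intro fn.span_base) auto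
  next
    case False
    then obtain y where y: "y \<in> A" "y \<notin> tableau_col lam t 0" by blast
    then obtain i j where ij: "(i, j) \<in> young_diagram lam" "y = t (i, j)"
      using tableau_obtain_cell[OF t] A by blast
    then have yj: "y \<in> tableau_col lam t j" by (auto simp: tableau_col_def)
    then have j: "0 < j" using y by (cases j) auto
    let ?C = "tableau_col lam t 0"
    have CN: "?C \<subseteq> {1..sum_list lam}" using tableau_entry[OF t] by (auto simp: tableau_col_def)
    then have finC: "finite ?C" using finite_subset by blast
    let ?e = "\<lambda>z. polytabloid lam (transpose y z \<circ> t) :: _ \<Rightarrow> 'k"
    define R where "R = (\<Sum>z\<in>?C - A. ?P (?e z))"
    have "polytabloid lam t = (\<Sum>z\<in>?C. ?e z)"
      using garnir_relation[OF t j yj, where 'k='k] by (simp add: fun_eq_iff sum_fun_apply)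
    then have "?P (polytabloid lam t) = (\<Sum>z\<in>?C. ?P (?e z))" by (simp only: P.sum)
    also have "?C = (?C \<inter> A) \<union> (?C - A)" by auto
    also have "(\<Sum>z\<in>(?C \<inter> A) \<union> (?C - A). ?P (?e z)) = (\<Sum>z\<in>?C \<inter> A. ?P (?e z)) + (\<Sum>z\<in>?C - A. ?P (?e z))"
      using finC by (intro sum.union_disjoint) auto
    also have "(\<Sum>z\<in>?C \<inter> A. ?P (?e z)) = (\<Sum>z\<in>?C \<inter> A. - ?P (polytabloid lam t))"
    proof (intro sum.cong refl)
      fix z assume z: "z \<in> ?C \<inter> A"
      then have "z \<noteq> y" using y by auto
      then show "?P (?e z) = - ?P (polytabloid lam t)"
        using symmetrizer_transpose_polytabloid[OF linear_character_sign[OF finA] A y(1), of z t, where 'k='k] z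
        by (simp add: sign_swap_id)
    qed
    also have "\<dots> = fun_scale (- of_nat (card (?C \<inter> A))) (?P (polytabloid lam t))"
      by (simp add: fun_eq_iff sum_fun_apply fun_scale_def)
    finally have "?P (polytabloid lam t) = fun_scale (- of_nat (card (?C \<inter> A))) (?P (polytabloid lam t)) + R"
      unfolding R_def .
    then have "fun_scale (of_nat (Suc (card (?C \<inter> A)))) (?P (polytabloid lam t)) = R"
      by (simp add: fun_eq_iff fun_scale_def algebra_simps)
    also have "R \<in> ?S" unfolding R_def
    proof (intro fn.span_sum)
      fix z assume z: "z \<in> ?C - A"
      let ?t = "transpose y z \<circ> t"
      have t': "is_tableau lam ?t"
        using y A z CN by (intro is_tableau_comp[OF t] permutes_swap_id) auto
      have "A - tableau_col lam ?t 0 \<subseteq> A - ?C - {y}"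
      proof
        fix b assume b: "b \<in> A - tableau_col lam ?t 0"
        have "y \<in> tableau_col lam ?t 0" unfolding tableau_col_comp using z by (force simp: image_iff)
        then have "b \<noteq> y" "b \<noteq> z" using b z by auto
        then have "b \<notin> ?C"
          using b unfolding tableau_col_comp by (force simp: image_iff)
        then show "b \<in> A - ?C - {y}" using b \<open>b \<noteq> y\<close> by simp
      qed
      moreover have "card (A - ?C - {y}) < card (A - ?C)"
        using y finA by (intro card_Diff1_less) auto
      ultimately have "card (A - tableau_col lam ?t 0) < card (A - ?C)"
        using finA by (meson card_mono finite_Diff le_less_trans)
      from less.hyps[OF this t'] show "?P (?e z) \<in> ?S" .
    qed
    finally have "fun_scale (inverse (of_nat (Suc (card (?C \<inter> A)))))
        (fun_scale (of_nat (Suc (card (?C \<inter> A)))) (?P (polytabloid lam t))) \<in> ?S"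
      by (rule fn.span_scale)
    then show ?thesis by (simp add: fn.scale_scale del: of_nat_Suc)
  qed
qed

text \<open>The tableau \<open>s'\<close> is meant to arise from \<open>s\<close> by deleting the row or column that contains the \<open>a\<close>
  largest points.\<close>

lemma col_stabilizer_fixing:
  assumes n: "sum_list lam = n" and n': "sum_list lam' = n - a" and a: "a \<le> n"
    and C1: "\<And>j. tableau_col lam s j - {n-a<..n} \<in> insert {} (range (tableau_col lam' s'))"
    and C2: "\<And>j. tableau_col lam' s' j \<in> range (\<lambda>j. tableau_col lam s j - {n-a<..n})"
  shows "{p \<in> col_stabilizer lam s. \<forall>x\<in>{n-a<..n}. p x = x} = col_stabilizer lam' s'"
proof (rule equalityI; rule subsetI)
  fix p assume "p \<in> {p \<in> col_stabilizer lam s. \<forall>x\<in>{n-a<..n}. p x = x}"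
  then have p: "p permutes {1..n}" "\<And>j. p ` tableau_col lam s j = tableau_col lam s j"
    and fx: "\<And>x. x \<in> {n-a<..n} \<Longrightarrow> p x = x" by (auto simp: col_stabilizer_def n)
  have "p permutes {1..n-a}"
    using p(1) by (rule permutes_superset) (use fx in auto)
  moreover have "p ` tableau_col lam' s' j = tableau_col lam' s' j" for j
  proof -
    obtain j' where j': "tableau_col lam' s' j = tableau_col lam s j' - {n-a<..n}" using C2 by blast
    have "p ` {n-a<..n} = {n-a<..n}" using fx by force
    then show ?thesis unfolding j' using p by (simp add: image_set_diff permutes_inj)
  qed
  ultimately show "p \<in> col_stabilizer lam' s'" by (simp add: col_stabilizer_def n')
next
  fix p assume "p \<in> col_stabilizer lam' s'"
  then have p: "p permutes {1..n-a}" "\<And>j. p ` tableau_col lam' s' j = tableau_col lam' s' j"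
    by (auto simp: col_stabilizer_def n')
  have fx: "p x = x" if "x \<in> {n-a<..n}" for x using that p(1) by (intro permutes_not_in) auto
  have "p permutes {1..n}" using p(1) by (rule permutes_subset) auto
  moreover have "p ` tableau_col lam s j = tableau_col lam s j" for j
  proof -
    have "p ` (tableau_col lam s j - {n-a<..n}) = tableau_col lam s j - {n-a<..n}"
      using C1[of j] p(2) by (metis (no_types, lifting) image_empty image_iff insert_iff)
    moreover have "p ` (tableau_col lam s j \<inter> {n-a<..n}) = tableau_col lam s j \<inter> {n-a<..n}"
      using fx by force
    ultimately show ?thesis by (metis Diff_partition Int_Diff_Un image_Un inf_commute)
  qed
  ultimately show "p \<in> {p \<in> col_stabilizer lam s. \<forall>x\<in>{n-a<..n}. p x = x}"
    using fx by (simp add: col_stabilizer_def n)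
qed

text \<open>If the tabloid \<open>T\<close> forces the column permutations that contribute to its coefficient to fix the \<open>a\<close>
  largest points, this coefficient is a coefficient for the smaller tableau.\<close>

lemma polytabloid_restrict:
  assumes "sum_list lam = n" "sum_list lam' = n - a" "a \<le> n"
    and "\<And>j. tableau_col lam s j - {n-a<..n} \<in> insert {} (range (tableau_col lam' s'))"
    and "\<And>j. tableau_col lam' s' j \<in> range (\<lambda>j. tableau_col lam s j - {n-a<..n})"
    and fx: "\<And>p. p \<in> col_stabilizer lam s \<Longrightarrow> T = tabloid lam (p \<circ> s) \<Longrightarrow> \<forall>x\<in>{n-a<..n}. p x = x"
    and eq: "\<And>p. p \<in> col_stabilizer lam' s' \<Longrightarrow> T = tabloid lam (p \<circ> s) \<longleftrightarrow> T' = tabloid lam' (p \<circ> s')"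
  shows "polytabloid lam s T = (polytabloid lam' s' T' :: 'k::field_char_0)"
proof -
  have "polytabloid lam s T = (\<Sum>p\<in>{p \<in> col_stabilizer lam s. \<forall>x\<in>{n-a<..n}. p x = x}.
      of_int (sign p) * of_bool (T = tabloid lam (p \<circ> s)) :: 'k)"
    unfolding polytabloid_def using fx by (intro sum.mono_neutral_right) auto
  also have "\<dots> = polytabloid lam' s' T'"
    unfolding col_stabilizer_fixing[OF assms(1-5)] polytabloid_def
    by (intro sum.cong refl) (simp add: eq)
  finally show ?thesis .
qed

text \<open>This reduces the removal of a row or of a column to the construction of a map \<open>h\<close> that identifies
  the isotypic component with the Specht module of the smaller partition.\<close>

lemma character_average_via_intertwiner:
  fixes h :: "(nat set list \<Rightarrow> 'k::field_char_0) \<Rightarrow> nat set list \<Rightarrow> 'k"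
  assumes h: "Vector_Spaces.linear fun_scale fun_scale h"
    and eps: "linear_character eps A" and A: "A \<subseteq> {1..sum_list lam}"
    and g: "g permutes {1..sum_list lam} - A"
    and im: "h ` isotypic eps A lam = specht_module lam'"
    and ker: "\<And>v. v \<in> isotypic eps A lam \<Longrightarrow> h v = 0 \<Longrightarrow> v = 0"
    and comm: "\<And>v. v \<in> isotypic eps A lam \<Longrightarrow> h (perm_act g v) = perm_act g (h v)"
  shows "(\<Sum>x | x permutes A. of_int (eps x) * specht_character lam (x \<circ> g))
    = (fact (card A) * specht_character lam' g :: 'k)"
proof -
  obtain B where B: "finite B" "is_basis_of B (isotypic eps A lam :: (_ \<Rightarrow> 'k) set)" by (rule isotypic_finite_basis)
  have "trace_on (h ` isotypic eps A lam) (perm_act g) = trace_on (isotypic eps A lam) (perm_act g :: (_ \<Rightarrow> 'k) \<Rightarrow> _)"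
    using ker comm perm_act_isotypic[OF A g, where 'k='k] by (intro trace_on_intertwine[OF perm_act_linear perm_act_linear h B(2,1)]) auto
  then show ?thesis unfolding character_average_eq_trace[OF eps A g] im specht_character_def[of lam'] by simp
qed

section \<open>Removing the first row\<close>

lemma specht_module_row_relation:
  assumes "sorted_wrt (\<ge>) lam" and "is_tableau lam s" "T = tabloid lam s" "y \<in> T ! i" "0 < i" "i < length lam"
    and v: "v \<in> specht_module lam"
  shows "v T + (\<Sum>z\<in>T ! 0. v (map ((`) (transpose z y)) T)) = (0::'k::field_char_0)"
  using v unfolding specht_module_def
proof (induction rule: fn.span_induct_alt)
  case base then show ?case by simp
next
  case (step c x v)
  then obtain t where t: "is_tableau lam t" "x = polytabloid lam t" by blast
  have "x T + (\<Sum>z\<in>T ! 0. x (map ((`) (transpose z y)) T)) = 0"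
    using polytabloid_row_relation[OF assms(1) t(1) assms(2-6), where 'k='k] t(2) by simp
  moreover have "(fun_scale c x + v) T + (\<Sum>z\<in>T ! 0. (fun_scale c x + v) (map ((`) (transpose z y)) T)) =
      c * (x T + (\<Sum>z\<in>T ! 0. x (map ((`) (transpose z y)) T))) +
      (v T + (\<Sum>z\<in>T ! 0. v (map ((`) (transpose z y)) T)))"
    by (simp add: fun_scale_def sum.distrib sum_distrib_left algebra_simps)
  ultimately show ?case using step(2) by simp
qed

text \<open>The coefficient at a tabloid is shown to vanish by induction on the number of points of \<open>A\<close> that are
  missing from its first row. The row relation for a missing point \<open>y\<close> exchanges \<open>y\<close> with the
  points of the first row: those in \<open>A\<close> give the same coefficient by invariance, the others lead to
  tabloids where fewer points are missing. So a positive multiple of the coefficient is zero.\<close>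

lemma row_invariant_determined:
  assumes srt: "sorted_wrt (\<ge>) lam" and ne: "lam \<noteq> []" and A: "A \<subseteq> {1..sum_list lam}" and cA: "card A = lam ! 0"
    and v: "v \<in> (isotypic (\<lambda>_. 1) A lam :: (_ \<Rightarrow> 'k::field_char_0) set)"
    and zero: "\<And>T. v (A # T) = 0"
  shows "v = 0"
proof -
  have vS: "v \<in> specht_module lam" and inv: "\<And>x. x permutes A \<Longrightarrow> perm_act x v = v"
    using v by (auto simp: isotypic_def fun_scale_def)
  have finA: "finite A" using A finite_subset by blast
  have tab: "v (tabloid lam s) = 0" if "is_tableau lam s" for s
    using that
  proof (induction "card (A - tableau_row lam s 0)" arbitrary: s rule: less_induct)
    case (less s)
    note s = less.prems
    let ?T = "tabloid lam s" and ?R = "tableau_row lam s 0"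
    have R: "?R = (\<lambda>j. s (0, j)) ` {..<lam ! 0}" using ne by (auto simp: tableau_row_def young_diagram_def)
    have inj: "inj_on (\<lambda>j. s (0, j)) {..<lam ! 0}"
      using tableau_eq_iff[OF s] ne by (auto simp: inj_on_def young_diagram_def)
    have cR: "card ?R = lam ! 0" unfolding R by (simp add: card_image[OF inj])
    have finR: "finite ?R" unfolding R by simp
    have T0: "?T ! 0 = ?R" using ne by (simp add: tabloid_nth)
    show ?case
    proof (cases "A \<subseteq> ?R")
      case True
      then have "A = ?R" using cA cR finR by (intro card_subset_eq) auto
      then have "?T = A # tl ?T" using ne T0 by (metis tabloid_def list.collapse hd_conv_nth length_0_conv length_map length_upt minus_nat.diff_0)
      then show ?thesis using zero[of "tl ?T"] by simp
    next
      case False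
      then obtain y where y: "y \<in> A" "y \<notin> ?R" by blast
      then obtain i j where ij: "(i, j) \<in> young_diagram lam" "y = s (i, j)"
        using tableau_obtain_cell[OF s] A by blast
      have il: "i < length lam" using ij by (simp add: young_diagram_def)
      have yi: "y \<in> tableau_row lam s i" using ij by (auto simp: tableau_row_def)
      then have i0: "0 < i" using y by (cases i) auto
      let ?sw = "\<lambda>z. v (map ((`) (transpose z y)) ?T)"
      have rel: "v ?T + (\<Sum>z\<in>?R. ?sw z) = 0"
        using specht_module_row_relation[OF srt s refl _ i0 il vS, of y] yi il by (simp add: tabloid_nth T0)
      have A1: "?sw z = v ?T" if "z \<in> ?R \<inter> A" for z
      proof -
        have "transpose z y permutes A" using that y by (intro permutes_swap_id) auto
        from fun_cong[OF inv[OF this], of ?T] show ?thesis by (simp add: perm_act_def)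
      qed
      have A2: "?sw z = 0" if z: "z \<in> ?R - A" for z
      proof -
        let ?t = "transpose z y \<circ> s"
        have zN: "z \<in> {1..sum_list lam}" using z tableau_entry[OF s] by (auto simp: tableau_row_def)
        have t': "is_tableau lam ?t"
          using y A zN by (intro is_tableau_comp[OF s] permutes_swap_id) auto
        have "A - tableau_row lam ?t 0 \<subseteq> A - ?R - {y}"
        proof
          fix b assume b: "b \<in> A - tableau_row lam ?t 0"
          have "y \<in> tableau_row lam ?t 0" unfolding tableau_row_comp using z by (force simp: image_iff)
          then have "b \<noteq> y" "b \<noteq> z" using b z by auto
          then have "b \<notin> ?R"
            using b unfolding tableau_row_comp by (force simp: image_iff)
          then show "b \<in> A - ?R - {y}" using b \<open>b \<noteq> y\<close> by simp
        qed
        moreover have "card (A - ?R - {y}) < card (A - ?R)"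
          using y finA by (intro card_Diff1_less) auto
        ultimately have "card (A - tableau_row lam ?t 0) < card (A - ?R)"
          using finA by (meson card_mono finite_Diff le_less_trans)
        from less.hyps[OF this t'] show ?thesis by (simp add: tabloid_comp)
      qed
      have "(\<Sum>z\<in>?R. ?sw z) = (\<Sum>z\<in>?R \<inter> A. ?sw z) + (\<Sum>z\<in>?R - A. ?sw z)"
        using finR by (subst sum.union_disjoint[symmetric]) (auto simp: Int_Diff_Un)
      also have "\<dots> = of_nat (card (?R \<inter> A)) * v ?T" using A1 A2 by simp
      finally have "of_nat (Suc (card (?R \<inter> A))) * v ?T = 0" using rel by (simp add: algebra_simps)
      then show ?thesis by (simp del: of_nat_Suc)
    qed
  qed
  show ?thesis
  proof
    fix T show "v T = 0 T"
    proof (rule ccontr)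
      assume "v T \<noteq> 0 T"
      then have "v T \<noteq> 0" by simp
      from specht_module_support[OF vS this] obtain s where "is_tableau lam s" "T = tabloid lam s" .
      then show False using tab \<open>v T \<noteq> 0\<close> by simp
    qed
  qed
qed

text \<open>The map \<open>h\<close> embeds the smaller diagram, \<open>C\<close> is the deleted row or column, and the deleted cells
  carry the largest entries.\<close>

lemma is_tableau_split:
  assumes D: "young_diagram lam = C \<union> h ` young_diagram mu" and disj: "C \<inter> h ` young_diagram mu = {}"
    and inj: "inj h" and n: "sum_list lam = k + sum_list mu"
    and C: "bij_betw s C {sum_list mu<..k + sum_list mu}"
  shows "is_tableau lam s \<longleftrightarrow> is_tableau mu (s \<circ> h)"
proof -
  let ?H = "h ` young_diagram mu" and ?m = "sum_list mu"
  have "bij_betw h (young_diagram mu) ?H" using inj by (auto simp: bij_betw_def intro: inj_on_subset)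
  then have mu: "is_tableau mu (s \<circ> h) \<longleftrightarrow> bij_betw s ?H {1..?m}"
    unfolding is_tableau_def by (rule bij_betw_comp_iff[symmetric])
  have lam: "is_tableau lam s \<longleftrightarrow> bij_betw s (C \<union> ?H) {1..k + ?m}"
    by (simp only: is_tableau_def D n)
  have N: "{1..k + ?m} = {?m<..k + ?m} \<union> {1..?m}" by auto
  show ?thesis unfolding lam mu
  proof
    assume b: "bij_betw s (C \<union> ?H) {1..k + ?m}"
    then have inj_s: "inj_on s (C \<union> ?H)" by (rule bij_betw_imp_inj_on)
    have "s ` ?H = s ` (C \<union> ?H) - s ` C"
      using inj_on_image_set_diff[OF inj_s, of "C \<union> ?H" C] disj by (metis Diff_cancel Diff_subset Int_commute Un_Diff Diff_triv Un_upper1 sup_bot_left)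
    also have "\<dots> = {1..?m}"
      using b C by (auto simp: bij_betw_def)
    finally show "bij_betw s ?H {1..?m}"
      using inj_s by (auto simp: bij_betw_def intro: inj_on_subset)
  next
    assume "bij_betw s ?H {1..?m}"
    with C show "bij_betw s (C \<union> ?H) {1..k + ?m}"
      unfolding N by (rule bij_betw_combine) auto
  qed
qed

lemma young_diagram_Cons:
  "young_diagram (a # lam) = (\<lambda>j. (0, j)) ` {..<a} \<union> (\<lambda>(i, j). (Suc i, j)) ` young_diagram lam"
  by (auto simp: young_diagram_def image_iff nth_Cons less_Suc_eq_0_disj split: nat.splits)

lemma is_tableau_Cons:
  assumes "bij_betw s ((\<lambda>j. (0, j)) ` {..<a}) {sum_list lam<..a + sum_list lam}"
  shows "is_tableau (a # lam) s \<longleftrightarrow> is_tableau lam (\<lambda>(i, j). s (Suc i, j))"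
proof -
  have "s \<circ> (\<lambda>(i, j). (Suc i, j)) = (\<lambda>(i, j). s (Suc i, j))" by auto
  moreover have "(\<lambda>j. (0, j)) ` {..<a} \<inter> (\<lambda>(i, j). (Suc i, j)) ` young_diagram lam = {}" by auto
  moreover have "inj (\<lambda>(i, j). (Suc i, j))" by (auto simp: inj_on_def)
  ultimately show ?thesis
    using is_tableau_split[OF young_diagram_Cons _ _ _ assms] by simp
qed

lemma is_tableau_tl:
  assumes s: "is_tableau (a # lam) s" and row: "tableau_row (a # lam) s 0 = {sum_list lam<..a + sum_list lam}"
  shows "is_tableau lam (\<lambda>(i, j). s (Suc i, j))"
proof -
  have "s ` (\<lambda>j. (0, j)) ` {..<a} = {sum_list lam<..a + sum_list lam}"
    unfolding row[symmetric] by (auto simp: tableau_row_def young_diagram_def)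
  moreover have "inj_on s ((\<lambda>j. (0, j)) ` {..<a})"
    by (rule inj_on_subset[OF bij_betw_imp_inj_on[OF s[unfolded is_tableau_def]]]) (simp only: young_diagram_Cons Un_upper1)
  ultimately show ?thesis using s is_tableau_Cons by (auto simp: bij_betw_def)
qed

text \<open>A column permutation that preserves the first row fixes its entries, since it cannot move them to
  another column.\<close>

lemma polytabloid_Cons:
  assumes s: "is_tableau (a # lam) s" and row: "tableau_row (a # lam) s 0 = {sum_list lam<..a + sum_list lam}"
  shows "polytabloid (a # lam) s ({sum_list lam<..a + sum_list lam} # T)
    = (polytabloid lam (\<lambda>(i, j). s (Suc i, j)) T :: 'k::field_char_0)"
proof -
  let ?n = "a + sum_list lam" and ?s = "\<lambda>(i, j). s (Suc i, j)" and ?lam = "a # lam"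
  have A: "{?n - a<..?n} = {sum_list lam<..?n}" by simp
  have col: "tableau_col lam ?s j = tableau_col ?lam s j - {?n - a<..?n}" for j
  proof -
    have "tableau_col ?lam s j - tableau_row ?lam s 0 = tableau_col lam ?s j"
    proof (intro equalityI subsetI)
      fix x assume x: "x \<in> tableau_col ?lam s j - tableau_row ?lam s 0"
      then obtain i where i: "(i, j) \<in> young_diagram ?lam" "x = s (i, j)" by (auto simp: tableau_col_def)
      moreover have "i \<noteq> 0"
      proof
        assume "i = 0"
        then have "x \<in> tableau_row ?lam s 0" using i unfolding tableau_row_def by blast
        then show False using x by blast
      qed
      ultimately show "x \<in> tableau_col lam ?s j"
        by (auto simp: tableau_col_def young_diagram_def gr0_conv_Suc)
    next
      fix x assume "x \<in> tableau_col lam ?s j"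
      then obtain i where i: "(Suc i, j) \<in> young_diagram ?lam" "x = s (Suc i, j)"
        by (auto simp: tableau_col_def young_diagram_def)
      then have "x \<in> tableau_row ?lam s (Suc i)" by (auto simp: tableau_row_def)
      then have "x \<notin> tableau_row ?lam s 0" using tableau_row_disjoint[OF s] by blast
      then show "x \<in> tableau_col ?lam s j - tableau_row ?lam s 0" using i by (auto simp: tableau_col_def)
    qed
    then show ?thesis unfolding row A ..
  qed
  show ?thesis
  proof (rule polytabloid_restrict[where n = ?n and a = a])
    show "tableau_col ?lam s j - {?n - a<..?n} \<in> insert {} (range (tableau_col lam ?s))" for j
      unfolding col[symmetric] by blast
    show "tableau_col lam ?s j \<in> range (\<lambda>j. tableau_col ?lam s j - {?n - a<..?n})" for j
      unfolding col by blast
  next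
    fix p assume p: "p \<in> col_stabilizer ?lam s" and eq: "{sum_list lam<..?n} # T = tabloid ?lam (p \<circ> s)"
    have "tabloid ?lam (p \<circ> s) ! 0 = {sum_list lam<..?n}" by (simp add: eq[symmetric])
    then have pr: "p ` tableau_row ?lam s 0 = tableau_row ?lam s 0"
      unfolding row by (simp add: tabloid_nth tableau_row_comp row)
    show "\<forall>x\<in>{?n - a<..?n}. p x = x"
    proof
      fix x assume "x \<in> {?n - a<..?n}"
      then have xr: "x \<in> tableau_row ?lam s 0" unfolding row A .
      then obtain j where j: "(0, j) \<in> young_diagram ?lam" "x = s (0, j)" by (auto simp: tableau_row_def)
      then have "x \<in> tableau_col ?lam s j" unfolding tableau_col_def by blast
      with p have "p x \<in> tableau_col ?lam s j" by (rule col_stabilizer_mem)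
      then obtain i where i: "(i, j) \<in> young_diagram ?lam" "p x = s (i, j)" unfolding tableau_col_def by blast
      have "p x \<in> tableau_row ?lam s 0" using pr xr by blast
      moreover have "p x \<in> tableau_row ?lam s i" using i unfolding tableau_row_def by blast
      ultimately have "i = 0" using tableau_row_disjoint[OF s] by blast
      then show "p x = x" using i j by simp
    qed
  next
    fix p assume "p \<in> col_stabilizer lam ?s"
    then have p: "p permutes {1..sum_list lam}" by (rule col_stabilizer_permutes)
    have "p x = x" if "x \<in> {sum_list lam<..?n}" for x using that by (intro permutes_not_in[OF p]) auto
    then have "p ` {sum_list lam<..?n} = {sum_list lam<..?n}" by simp
    then have r0: "tableau_row ?lam (p \<circ> s) 0 = {sum_list lam<..?n}" by (simp only: tableau_row_comp row)
    have rS: "tableau_row ?lam (p \<circ> s) \<circ> Suc = tableau_row lam (p \<circ> ?s)"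
      by (simp add: fun_eq_iff tableau_row_def young_diagram_def)
    have "[0..<length ?lam] = 0 # map Suc [0..<length lam]"
      by (simp add: map_Suc_upt upt_conv_Cons del: upt_Suc)
    then have "tabloid ?lam (p \<circ> s) = {sum_list lam<..?n} # tabloid lam (p \<circ> ?s)"
      unfolding tabloid_def by (simp only: list.map map_map r0 rS)
    then show "({sum_list lam<..?n} # T = tabloid ?lam (p \<circ> s)) = (T = tabloid lam (p \<circ> ?s))" by simp
  qed auto
qed

lemma finite_tableau_row [simp]: "finite (tableau_row lam t i)"
  by (rule finite_subset[of _ "t ` young_diagram lam"]) (auto simp: tableau_row_def)

lemma card_tableau_row:
  assumes s: "is_tableau lam s" and i: "i < length lam"
  shows "card (tableau_row lam s i) = lam ! i"
proof -
  have R: "tableau_row lam s i = (\<lambda>j. s (i, j)) ` {..<lam ! i}"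
    using i by (auto simp: tableau_row_def young_diagram_def)
  have "inj_on (\<lambda>j. s (i, j)) {..<lam ! i}"
    using tableau_eq_iff[OF s] i by (auto simp: inj_on_def young_diagram_def)
  then show ?thesis unfolding R by (simp add: card_image)
qed

lemma symmetrizer_polytabloid:
  assumes "A \<subseteq> {1..sum_list lam}"
  shows "symmetrizer eps A (polytabloid lam t)
    = (\<Sum>x | x permutes A. fun_scale (of_int (eps x)) (polytabloid lam (x \<circ> t) :: _ \<Rightarrow> 'k::field_char_0))"
  unfolding symmetrizer_def
  using permutes_subset[OF _ assms] by (intro sum.cong refl) (simp add: perm_act_polytabloid)

lemma character_average_vanish:
  assumes eps: "linear_character eps A" and A: "A \<subseteq> {1..sum_list lam}" and g: "g permutes {1..sum_list lam} - A"
    and zero: "\<And>t. is_tableau lam t \<Longrightarrow> symmetrizer eps A (polytabloid lam t) = (0 :: _ \<Rightarrow> 'k::field_char_0)"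
  shows "(\<Sum>x | x permutes A. of_int (eps x) * specht_character lam (x \<circ> g)) = (0 :: 'k)"
proof -
  have "isotypic eps A lam = (fn.span (symmetrizer eps A ` {}) :: (_ \<Rightarrow> 'k) set)"
    by (rule isotypic_eq_span[OF eps A]) (simp_all add: zero)
  then have "isotypic eps A lam = {0 :: _ \<Rightarrow> 'k}" by simp
  moreover have "perm_act g (0 :: _ \<Rightarrow> 'k) = 0" by (simp add: perm_act_def fun_eq_iff)
  ultimately show ?thesis
    using character_average_eq_trace[OF eps A g, where 'k='k] by (simp add: trace_on_zero_space)
qed

text \<open>A tableau cannot have more points in its first row than the row has cells, so the generators of
  the isotypic component provided by \<open>row_symmetrizer_span\<close> do not exist.\<close>

lemma row_average_vanish:
  assumes srt: "sorted_wrt (\<ge>) lam" and A: "A \<subseteq> {1..sum_list lam}"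
    and big: "\<And>x xs. lam = x # xs \<Longrightarrow> x < card A"
    and g: "g permutes {1..sum_list lam} - A" and ne: "lam \<noteq> []"
  shows "(\<Sum>x | x permutes A. specht_character lam (x \<circ> g)) = (0 :: 'k::field_char_0)"
proof -
  have finA: "finite A" using A finite_subset by blast
  have no: "\<not> A \<subseteq> tableau_row lam s 0" if s: "is_tableau lam s" for s
  proof
    assume "A \<subseteq> tableau_row lam s 0"
    then have "card A \<le> card (tableau_row lam s 0)" by (intro card_mono) auto
    then have "card A \<le> lam ! 0" using card_tableau_row[OF s, of 0] ne by simp
    moreover have "lam ! 0 < card A" using big ne by (cases lam) auto
    ultimately show False by simp
  qed
  have "symmetrizer (\<lambda>_. 1) A (polytabloid lam t) = (0 :: _ \<Rightarrow> 'k)" if t: "is_tableau lam t" for t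
  proof -
    have "{polytabloid lam s |s. is_tableau lam s \<and> A \<subseteq> tableau_row lam s 0} = ({} :: (_ \<Rightarrow> 'k) set)" using no by blast
    with row_symmetrizer_span[OF srt A t, where 'k='k] show ?thesis by simp
  qed
  from character_average_vanish[OF linear_character_trivial[OF finA] A g this] show ?thesis by simp
qed

lemma tableau_extend_row:
  assumes t: "is_tableau lam t"
  defines "s \<equiv> (\<lambda>(i, j). case i of 0 \<Rightarrow> sum_list lam + 1 + j | Suc i' \<Rightarrow> t (i', j))"
  shows "is_tableau (a # lam) s" "tableau_row (a # lam) s 0 = {sum_list lam<..a + sum_list lam}"
    "(\<lambda>(i, j). s (Suc i, j)) = t"
proof -
  have "bij_betw (\<lambda>j. s (0, j)) {..<a} {sum_list lam<..a + sum_list lam}"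
    unfolding s_def by (rule bij_betw_byWitness[where f' = "\<lambda>x. x - sum_list lam - 1"]) auto
  then have b: "bij_betw s ((\<lambda>j. (0, j)) ` {..<a}) {sum_list lam<..a + sum_list lam}"
    by (auto simp: bij_betw_def inj_on_def image_image)
  show st: "(\<lambda>(i, j). s (Suc i, j)) = t" by (simp add: s_def)
  show "is_tableau (a # lam) s" unfolding is_tableau_Cons[OF b] st by (rule t)
  have "tableau_row (a # lam) s 0 = s ` (\<lambda>j. (0, j)) ` {..<a}"
    by (auto simp: tableau_row_def young_diagram_def)
  then show "tableau_row (a # lam) s 0 = {sum_list lam<..a + sum_list lam}"
    using b by (simp add: bij_betw_def)
qed

text \<open>Here \<open>X s\<close> stands for the first row or for the first column of the tableau \<open>s\<close>.\<close>

lemma isotypic_image_eq_specht_module: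
  fixes h :: "(nat set list \<Rightarrow> 'k::field_char_0) \<Rightarrow> nat set list \<Rightarrow> 'k"
  assumes h: "Vector_Spaces.linear fun_scale fun_scale h"
    and eps: "linear_character eps A" and A: "A \<subseteq> {1..sum_list lam}"
    and gen: "\<And>t. is_tableau lam t \<Longrightarrow> symmetrizer eps A (polytabloid lam t) \<in>
      (fn.span (symmetrizer eps A ` {polytabloid lam s |s. is_tableau lam s \<and> A \<subseteq> X s}) :: (_ \<Rightarrow> 'k) set)"
    and sound: "\<And>s. is_tableau lam s \<Longrightarrow> A \<subseteq> X s \<Longrightarrow>
      \<exists>t c. is_tableau mu t \<and> h (symmetrizer eps A (polytabloid lam s)) = fun_scale c (polytabloid mu t)"
    and complete: "\<And>t. is_tableau mu t \<Longrightarrow> \<exists>s c. is_tableau lam s \<and> A \<subseteq> X s \<and> c \<noteq> 0 \<and>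
      h (symmetrizer eps A (polytabloid lam s)) = fun_scale c (polytabloid mu t)"
  shows "h ` isotypic eps A lam = specht_module mu"
proof -
  interpret h: Vector_Spaces.linear fun_scale fun_scale h by (rule h)
  let ?P = "symmetrizer eps A :: (_ \<Rightarrow> 'k) \<Rightarrow> _"
  let ?E = "{polytabloid lam s |s. is_tableau lam s \<and> A \<subseteq> X s} :: (_ \<Rightarrow> 'k) set"
  have "isotypic eps A lam = fn.span (?P ` ?E)"
  proof (rule isotypic_eq_span[OF eps A _ gen])
    have "?E \<subseteq> {polytabloid lam s |s. is_tableau lam s}" by blast
    then show "?E \<subseteq> specht_module lam" unfolding specht_module_def using fn.span_superset by (rule subset_trans)
  qed
  then have W: "h ` isotypic eps A lam = fn.span (h ` ?P ` ?E)" by (simp only: h.span_image)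
  show ?thesis unfolding W specht_module_def fn.span_eq
  proof (intro conjI subsetI)
    fix w assume "w \<in> h ` ?P ` ?E"
    then obtain s where s: "is_tableau lam s" "A \<subseteq> X s" "w = h (?P (polytabloid lam s))" by blast
    then obtain t c where t: "is_tableau mu t" and w: "w = fun_scale c (polytabloid mu t)" using sound by blast
    show "w \<in> fn.span {polytabloid mu t |t. is_tableau mu t}"
      unfolding w using t by (intro fn.span_scale fn.span_base) blast
  next
    fix w :: "nat set list \<Rightarrow> 'k" assume "w \<in> {polytabloid mu t |t. is_tableau mu t}"
    then obtain t where t: "is_tableau mu t" "w = polytabloid mu t" by blast
    obtain s c where s: "is_tableau lam s" "A \<subseteq> X s" "c \<noteq> 0" "h (?P (polytabloid lam s)) = fun_scale c w"
      using complete[OF t(1)] t(2) by blast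
    have "polytabloid lam s \<in> ?E" using s(1,2) by blast
    then have "h (?P (polytabloid lam s)) \<in> fn.span (h ` ?P ` ?E)"
      by (rule fn.span_base[OF imageI[OF imageI]])
    then have "fun_scale (inverse c) (fun_scale c w) \<in> fn.span (h ` ?P ` ?E)"
      unfolding s(4) by (rule fn.span_scale)
    then show "w \<in> fn.span (h ` ?P ` ?E)" using s(3) by (simp add: fn.scale_scale)
  qed
qed

text \<open>Reading off the coefficients at the tabloids with first row \<open>A\<close> identifies the vectors invariant
  under \<open>Sym A\<close> with the Specht module of the partition without its first row.\<close>

lemma row_average_removal:
  assumes srt: "sorted_wrt (\<ge>) (a # lam)" and g: "g permutes {1..sum_list lam}"
  shows "(\<Sum>x | x permutes {sum_list lam<..a + sum_list lam}. specht_character (a # lam) (x \<circ> g))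
    = (fact a * specht_character lam g :: 'k::field_char_0)"
proof -
  let ?lam = "a # lam" and ?A = "{sum_list lam<..a + sum_list lam}"
  let ?W = "isotypic (\<lambda>_. 1) ?A ?lam :: (_ \<Rightarrow> 'k) set"
  let ?P = "symmetrizer (\<lambda>_. 1) ?A :: (_ \<Rightarrow> 'k) \<Rightarrow> _"
  define h :: "(nat set list \<Rightarrow> 'k) \<Rightarrow> nat set list \<Rightarrow> 'k" where "h v = (\<lambda>T. v (?A # T))" for v
  have lin: "Vector_Spaces.linear fun_scale fun_scale h"
    by unfold_locales (auto simp: h_def fun_scale_def fun_eq_iff algebra_simps)
  have A: "?A \<subseteq> {1..sum_list ?lam}" by auto
  have lc: "linear_character (\<lambda>_. 1) ?A" by (rule linear_character_trivial) simp
  have "{1..sum_list ?lam} - ?A = {1..sum_list lam}" by auto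
  with g have g': "g permutes {1..sum_list ?lam} - ?A" by simp
  have row: "tableau_row ?lam s 0 = ?A" if s: "is_tableau ?lam s" and "?A \<subseteq> tableau_row ?lam s 0" for s
  proof -
    have "card ?A = card (tableau_row ?lam s 0)" using card_tableau_row[OF s, of 0] by simp
    then show ?thesis using card_subset_eq[OF finite_tableau_row that(2)] by simp
  qed
  have hP: "h (?P (polytabloid ?lam s)) = fun_scale (fact a) (polytabloid lam (\<lambda>(i, j). s (Suc i, j)))"
    if s: "is_tableau ?lam s" and r: "tableau_row ?lam s 0 = ?A" for s
  proof
    fix T
    have "h (?P (polytabloid ?lam s)) T = (\<Sum>x | x permutes ?A. polytabloid ?lam (x \<circ> s) (?A # T))"
      by (simp add: h_def symmetrizer_polytabloid[OF A] sum_fun_apply fun_scale_def)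
    also have "\<dots> = (\<Sum>x | x permutes ?A. polytabloid lam (\<lambda>(i, j). s (Suc i, j)) T)"
    proof (intro sum.cong refl)
      fix x assume "x \<in> {x. x permutes ?A}"
      then have x: "x permutes ?A" by simp
      have s': "is_tableau ?lam (x \<circ> s)"
        using permutes_subset[OF x A] by (rule is_tableau_comp[OF s])
      have r': "tableau_row ?lam (x \<circ> s) 0 = ?A" unfolding tableau_row_comp r by (rule permutes_image[OF x])
      have "polytabloid ?lam (x \<circ> s) (?A # T) = (polytabloid lam (\<lambda>(i, j). (x \<circ> s) (Suc i, j)) T :: 'k)"
        by (rule polytabloid_Cons[OF s' r'])
      also have "polytabloid lam (\<lambda>(i, j). (x \<circ> s) (Suc i, j)) = (polytabloid lam (\<lambda>(i, j). s (Suc i, j)) :: _ \<Rightarrow> 'k)"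
      proof (rule polytabloid_cong)
        fix c assume c: "c \<in> young_diagram lam"
        then have "(\<lambda>(i, j). s (Suc i, j)) c \<in> {1..sum_list lam}"
          using tableau_entry[OF is_tableau_tl[OF s r]] by blast
        then have "(\<lambda>(i, j). s (Suc i, j)) c \<notin> ?A" by auto
        then show "(\<lambda>(i, j). (x \<circ> s) (Suc i, j)) c = (\<lambda>(i, j). s (Suc i, j)) c"
          using permutes_not_in[OF x] by (simp add: case_prod_unfold)
      qed
      finally show "polytabloid ?lam (x \<circ> s) (?A # T) = (polytabloid lam (\<lambda>(i, j). s (Suc i, j)) T :: 'k)" .
    qed
    also have "\<dots> = fact a * polytabloid lam (\<lambda>(i, j). s (Suc i, j)) T"
      by (simp add: card_permutations[of ?A a])
    finally show "h (?P (polytabloid ?lam s)) T = fun_scale (fact a) (polytabloid lam (\<lambda>(i, j). s (Suc i, j))) T"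
      by (simp add: fun_scale_def)
  qed
  have im: "h ` ?W = specht_module lam"
  proof (rule isotypic_image_eq_specht_module[OF lin lc A row_symmetrizer_span[OF srt A]])
    fix s assume s: "is_tableau ?lam s" "?A \<subseteq> tableau_row ?lam s 0"
    show "\<exists>t c. is_tableau lam t \<and> h (?P (polytabloid ?lam s)) = fun_scale c (polytabloid lam t)"
      using is_tableau_tl[OF s(1) row[OF s]] hP[OF s(1) row[OF s]] by blast
  next
    fix t assume t: "is_tableau lam t"
    define s where "s = (\<lambda>(i, j). case i of 0 \<Rightarrow> sum_list lam + 1 + j | Suc i' \<Rightarrow> t (i', j))"
    have s: "is_tableau ?lam s" "tableau_row ?lam s 0 = ?A" "(\<lambda>(i, j). s (Suc i, j)) = t"
      unfolding s_def by (rule tableau_extend_row[OF t])+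
    show "\<exists>s c. is_tableau ?lam s \<and> ?A \<subseteq> tableau_row ?lam s 0 \<and> c \<noteq> 0 \<and>
        h (?P (polytabloid ?lam s)) = fun_scale c (polytabloid lam t)"
      using s(1,2) hP[OF s(1,2)] unfolding s(3) by (intro exI[of _ s] exI[of _ "fact a"]) simp
  qed
  have "(\<Sum>x | x permutes ?A. of_int 1 * specht_character ?lam (x \<circ> g))
      = (fact (card ?A) * specht_character lam g :: 'k)"
  proof (rule character_average_via_intertwiner[OF lin lc A g' im])
    fix v assume v: "v \<in> ?W" and "h v = 0"
    then have "v (?A # T) = 0" for T by (simp add: h_def fun_eq_iff)
    then show "v = 0" using v by (intro row_invariant_determined[OF srt _ A]) auto
  next
    fix v assume "v \<in> ?W"
    have "inv' g ` ?A = ?A"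
      using permutes_not_in[OF permutes_inv[OF g]] by auto
    then show "h (perm_act g v) = perm_act g (h v)" by (simp add: h_def perm_act_def fun_eq_iff)
  qed
  then show ?thesis by simp
qed

section \<open>Removing the first column\<close>

lemma tableau_row_subset: "is_tableau lam t \<Longrightarrow> tableau_row lam t i \<subseteq> {1..sum_list lam}"
  using tableau_entry unfolding tableau_row_def by blast

text \<open>Rows of length one disappear; in a partition they come last.\<close>

definition remove_column :: "nat list \<Rightarrow> nat list" where
  "remove_column lam = map (\<lambda>x. x - 1) (takeWhile (\<lambda>x. 1 < x) lam)"

lemma young_diagram_remove_column:
  assumes srt: "sorted_wrt (\<ge>) lam"
  shows "young_diagram (remove_column lam) = {(i, j). (i, Suc j) \<in> young_diagram lam}"
proof -
  let ?t = "takeWhile (\<lambda>x. 1 < x) lam"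
  have key: "i < length ?t \<longleftrightarrow> i < length lam \<and> 1 < lam ! i" for i
  proof
    assume i: "i < length ?t"
    then have "?t ! i \<in> set ?t" by simp
    then show "i < length lam \<and> 1 < lam ! i"
      using i length_takeWhile_le[of "\<lambda>x. 1 < x" lam] by (auto simp: takeWhile_nth dest: set_takeWhileD)
  next
    assume i: "i < length lam \<and> 1 < lam ! i"
    show "i < length ?t"
    proof (rule ccontr)
      assume "\<not> i < length ?t"
      then have "length ?t \<le> i" by simp
      moreover have "\<not> 1 < lam ! length ?t"
        using nth_length_takeWhile[of "\<lambda>x. 1 < x" lam] i calculation by auto
      moreover have "lam ! i \<le> lam ! length ?t"
        using sorted_wrt_nth_less[OF srt, of "length ?t" i] i \<open>length ?t \<le> i\<close> by (cases "length ?t = i") auto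
      ultimately show False using i by linarith
    qed
  qed
  have val: "remove_column lam ! i = lam ! i - 1" if "i < length ?t" for i
    using that by (simp add: remove_column_def takeWhile_nth)
  have "(i, j) \<in> young_diagram (remove_column lam) \<longleftrightarrow> (i, Suc j) \<in> young_diagram lam" for i j
  proof (cases "i < length ?t")
    case True
    then have "i < length lam" "i < length (remove_column lam)" using key by (auto simp: remove_column_def)
    then show ?thesis using val[OF True] by (auto simp: young_diagram_def)
  next
    case False
    then have "(i, j) \<notin> young_diagram (remove_column lam)" by (simp add: young_diagram_def remove_column_def)
    moreover have "(i, Suc j) \<notin> young_diagram lam" using False key[of i] by (auto simp: young_diagram_def)
    ultimately show ?thesis by simp
  qed
  then show ?thesis by auto
qed

lemma length_remove_column: "length (remove_column lam) \<le> length lam"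
  by (simp add: remove_column_def length_takeWhile_le)

lemma first_column: "\<forall>k\<in>set lam. 0 < k \<Longrightarrow> (i, 0) \<in> young_diagram lam \<longleftrightarrow> i < length lam"
  by (auto simp: young_diagram_def)

lemma young_diagram_split_column:
  assumes srt: "sorted_wrt (\<ge>) lam" and pos: "\<forall>k\<in>set lam. 0 < k"
  shows "young_diagram lam = (\<lambda>i. (i, 0)) ` {..<length lam} \<union> (\<lambda>(i, j). (i, Suc j)) ` young_diagram (remove_column lam)"
proof (rule equalityI; rule subsetI)
  fix c assume c: "c \<in> young_diagram lam"
  obtain i j where ij: "c = (i, j)" by (cases c)
  show "c \<in> (\<lambda>i. (i, 0)) ` {..<length lam} \<union> (\<lambda>(i, j). (i, Suc j)) ` young_diagram (remove_column lam)"
  proof (cases j)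
    case 0 then show ?thesis using c ij by (auto simp: young_diagram_def)
  next
    case (Suc k)
    then have "(i, k) \<in> young_diagram (remove_column lam)"
      using c ij by (simp add: young_diagram_remove_column[OF srt])
    then show ?thesis using ij Suc by (force simp: image_iff)
  qed
next
  fix c assume "c \<in> (\<lambda>i. (i, 0)) ` {..<length lam} \<union> (\<lambda>(i, j). (i, Suc j)) ` young_diagram (remove_column lam)"
  then show "c \<in> young_diagram lam"
    using first_column[OF pos] by (auto simp: young_diagram_remove_column[OF srt])
qed

lemma sum_list_remove_column:
  assumes srt: "sorted_wrt (\<ge>) lam" and pos: "\<forall>k\<in>set lam. 0 < k"
  shows "sum_list lam = length lam + sum_list (remove_column lam)"
proof -
  have "sum_list lam = card ((\<lambda>i. (i, 0::nat)) ` {..<length lam} \<union> (\<lambda>(i, j). (i, Suc j)) ` young_diagram (remove_column lam))"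
    unfolding young_diagram_split_column[OF assms, symmetric] card_young_diagram ..
  also have "\<dots> = card ((\<lambda>i. (i, 0::nat)) ` {..<length lam}) + card ((\<lambda>(i, j). (i, Suc j)) ` young_diagram (remove_column lam))"
    by (intro card_Un_disjoint) auto
  also have "\<dots> = length lam + sum_list (remove_column lam)"
    by (subst (1 2) card_image) (auto simp: inj_on_def card_young_diagram)
  finally show ?thesis .
qed

text \<open>As for rows: the first column is too short to contain \<open>A\<close>.\<close>

lemma column_average_vanish:
  assumes A: "A \<subseteq> {1..sum_list lam}" and big: "length lam < card A"
    and g: "g permutes {1..sum_list lam} - A"
  shows "(\<Sum>x | x permutes A. of_int (sign x) * specht_character lam (x \<circ> g)) = (0 :: 'k::field_char_0)"
proof -
  have finA: "finite A" using A finite_subset by blast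
  have no: "\<not> A \<subseteq> tableau_col lam s 0" for s
  proof
    assume "A \<subseteq> tableau_col lam s 0"
    also have "\<dots> \<subseteq> (\<lambda>i. s (i, 0)) ` {..<length lam}" by (auto simp: tableau_col_def young_diagram_def)
    finally have "card A \<le> card ((\<lambda>i. s (i, 0)) ` {..<length lam})" by (intro card_mono) auto
    also have "\<dots> \<le> length lam" using card_image_le[of "{..<length lam}"] by simp
    finally show False using big by simp
  qed
  have "symmetrizer sign A (polytabloid lam t) = (0 :: _ \<Rightarrow> 'k)" if t: "is_tableau lam t" for t
  proof -
    have "{polytabloid lam s |s. is_tableau lam s \<and> A \<subseteq> tableau_col lam s 0} = ({} :: (_ \<Rightarrow> 'k) set)" using no by blast
    with column_antisymmetrizer_span[OF A t, where 'k='k] show ?thesis by simp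
  qed
  from character_average_vanish[OF linear_character_sign[OF finA] A g this] show ?thesis .
qed

text \<open>The inverse of removing a column, on tabloids: the new points \<open>m + 1, m + 2, \<dots>\<close> go into the rows
  from top to bottom, and the rows below those of \<open>T\<close> consist of a new point only.\<close>

definition add_column :: "nat \<Rightarrow> nat \<Rightarrow> nat set list \<Rightarrow> nat set list" where
  "add_column m b T = map (\<lambda>i. insert (m + 1 + i) (if i < length T then T ! i else {})) [0..<b]"

lemma is_tableau_column:
  assumes srt: "sorted_wrt (\<ge>) lam" and pos: "\<forall>k\<in>set lam. 0 < k"
    and "bij_betw s ((\<lambda>i. (i, 0)) ` {..<length lam})
      {sum_list (remove_column lam)<..length lam + sum_list (remove_column lam)}"
  shows "is_tableau lam s \<longleftrightarrow> is_tableau (remove_column lam) (\<lambda>(i, j). s (i, Suc j))"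
proof -
  have "s \<circ> (\<lambda>(i, j). (i, Suc j)) = (\<lambda>(i, j). s (i, Suc j))" by auto
  moreover have "(\<lambda>i. (i, 0)) ` {..<length lam} \<inter> (\<lambda>(i, j). (i, Suc j)) ` young_diagram (remove_column lam) = {}"
    by auto
  moreover have "inj (\<lambda>(i, j). (i, Suc j))" by (auto simp: inj_on_def)
  ultimately show ?thesis
    using is_tableau_split[OF young_diagram_split_column[OF srt pos] _ _ sum_list_remove_column[OF srt pos] assms(3)]
    by simp
qed

lemma is_tableau_remove_column:
  assumes srt: "sorted_wrt (\<ge>) lam" and pos: "\<forall>k\<in>set lam. 0 < k" and s: "is_tableau lam s"
    and col: "tableau_col lam s 0 = {sum_list (remove_column lam)<..length lam + sum_list (remove_column lam)}"
  shows "is_tableau (remove_column lam) (\<lambda>(i, j). s (i, Suc j))"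
proof -
  have "s ` (\<lambda>i. (i, 0)) ` {..<length lam} = tableau_col lam s 0"
    using first_column[OF pos] by (auto simp: tableau_col_def)
  moreover have "inj_on s ((\<lambda>i. (i, 0)) ` {..<length lam})"
    by (rule inj_on_subset[OF bij_betw_imp_inj_on[OF s[unfolded is_tableau_def]]])
      (simp only: young_diagram_split_column[OF srt pos] Un_upper1)
  ultimately show ?thesis using s is_tableau_column[OF srt pos] by (auto simp: bij_betw_def col)
qed

text \<open>If the points of the first column stay in it and return to their rows, they are fixed; so a column
  permutation that contributes to the left-hand side permutes the other columns only.\<close>

lemma polytabloid_add_column:
  assumes srt: "sorted_wrt (\<ge>) lam" and pos: "\<forall>k\<in>set lam. 0 < k" and s: "is_tableau lam s"
  defines "m \<equiv> sum_list (remove_column lam)"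
  assumes col: "\<And>i. i < length lam \<Longrightarrow> s (i, 0) = m + 1 + i"
    and len: "length T = length (remove_column lam)" and disj: "\<And>S. S \<in> set T \<Longrightarrow> S \<inter> {m<..length lam + m} = {}"
  shows "polytabloid lam s (add_column m (length lam) T)
    = (polytabloid (remove_column lam) (\<lambda>(i, j). s (i, Suc j)) T :: 'k::field_char_0)"
proof -
  let ?b = "length lam" and ?mu = "remove_column lam" and ?s = "\<lambda>(i, j). s (i, Suc j)"
  have n: "sum_list lam = ?b + m" using sum_list_remove_column[OF srt pos] by (simp add: m_def)
  have A: "{?b + m - ?b<..?b + m} = {m<..?b + m}" by simp
  have col0: "tableau_col lam s 0 = {m<..?b + m}"
  proof -
    have "tableau_col lam s 0 = (\<lambda>i. m + 1 + i) ` {..<?b}"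
    proof (rule equalityI; rule subsetI)
      fix x assume "x \<in> tableau_col lam s 0"
      then show "x \<in> (\<lambda>i. m + 1 + i) ` {..<?b}"
        using first_column[OF pos] col by (auto simp: tableau_col_def)
    next
      fix x assume "x \<in> (\<lambda>i. m + 1 + i) ` {..<?b}"
      then obtain i where i: "i < ?b" "x = s (i, 0)" using col by auto
      then have "(i, 0) \<in> young_diagram lam" using first_column[OF pos] by simp
      then show "x \<in> tableau_col lam s 0" using i unfolding tableau_col_def by blast
    qed
    also have "\<dots> = {m<..?b + m}"
    proof (rule equalityI; rule subsetI)
      fix x assume "x \<in> {m<..?b + m}"
      then show "x \<in> (\<lambda>i. m + 1 + i) ` {..<?b}" by (intro image_eqI[of _ _ "x - m - 1"]) auto
    qed auto
    finally show ?thesis .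
  qed
  have s': "is_tableau ?mu ?s"
    using is_tableau_remove_column[OF srt pos s] col0 unfolding m_def by simp
  have colS: "tableau_col ?mu ?s j = tableau_col lam s (Suc j)" for j
    by (simp add: tableau_col_def young_diagram_remove_column[OF srt])
  have colD: "tableau_col lam s (Suc j) - {m<..?b + m} = tableau_col lam s (Suc j)" for j
    using tableau_col_disjoint[OF s] unfolding col0[symmetric] by blast
  have lm: "length ?mu \<le> ?b" by (rule length_remove_column)
  have row': "tableau_row lam s i = insert (m + 1 + i) (if i < length ?mu then tableau_row ?mu ?s i else {})"
    if i: "i < ?b" for i
  proof -
    have "tableau_row lam s i = insert (s (i, 0)) {s (i, Suc j) |j. (i, Suc j) \<in> young_diagram lam}"
    proof (rule equalityI; rule subsetI)
      fix x assume "x \<in> tableau_row lam s i"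
      then obtain j where "(i, j) \<in> young_diagram lam" "x = s (i, j)" by (auto simp: tableau_row_def)
      then show "x \<in> insert (s (i, 0)) {s (i, Suc j) |j. (i, Suc j) \<in> young_diagram lam}" by (cases j) auto
    next
      fix x assume "x \<in> insert (s (i, 0)) {s (i, Suc j) |j. (i, Suc j) \<in> young_diagram lam}"
      then show "x \<in> tableau_row lam s i"
        using i first_column[OF pos, of i] unfolding tableau_row_def by blast
    qed
    moreover have "{s (i, Suc j) |j. (i, Suc j) \<in> young_diagram lam} = tableau_row ?mu ?s i"
      by (simp add: tableau_row_def young_diagram_remove_column[OF srt])
    moreover have "tableau_row ?mu ?s i = {}" if "\<not> i < length ?mu"
      using that by (simp add: tableau_row_def young_diagram_def)
    ultimately show ?thesis using col[OF i] by simp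
  qed
  have nth: "add_column m ?b T ! i = insert (m + 1 + i) (if i < length ?mu then T ! i else {})" if "i < ?b" for i
    using that len by (simp add: add_column_def)
  show ?thesis
  proof (rule polytabloid_restrict[where n = "?b + m" and a = ?b])
    show "tableau_col lam s j - {?b + m - ?b<..?b + m} \<in> insert {} (range (tableau_col ?mu ?s))" for j
    proof (cases j)
      case 0 then show ?thesis unfolding A by (simp only: col0 Diff_cancel insertI1)
    next
      case (Suc k)
      then have "tableau_col lam s j - {?b + m - ?b<..?b + m} = tableau_col ?mu ?s k"
        unfolding A colS by (simp only: colD)
      then show ?thesis by (simp only: insertI2 rangeI)
    qed
    show "tableau_col ?mu ?s j \<in> range (\<lambda>j. tableau_col lam s j - {?b + m - ?b<..?b + m})" for j
      unfolding A colS by (rule range_eqI[where x = "Suc j"]) (simp only: colD)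
    show "sum_list ?mu = ?b + m - ?b" by (simp add: m_def)
  next
    fix p assume p: "p \<in> col_stabilizer lam s" and eq: "add_column m ?b T = tabloid lam (p \<circ> s)"
    show "\<forall>x\<in>{?b + m - ?b<..?b + m}. p x = x"
    proof
      fix x assume "x \<in> {?b + m - ?b<..?b + m}"
      then have x: "x = m + 1 + (x - m - 1)" "x - m - 1 < ?b" by auto
      define i where "i = x - m - 1"
      have i: "i < ?b" "x = s (i, 0)" using x col unfolding i_def by auto
      then have c: "(i, 0) \<in> young_diagram lam" using first_column[OF pos] by simp
      have "x \<in> tableau_col lam s 0" using i c unfolding tableau_col_def by blast
      with p have "p x \<in> tableau_col lam s 0" by (rule col_stabilizer_mem)
      then have pB: "p x \<in> {m<..?b + m}" unfolding col0 .
      have "x \<in> tableau_row lam s i" using i c unfolding tableau_row_def by blast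
      then have "p x \<in> tabloid lam (p \<circ> s) ! i" using i by (simp add: tabloid_nth tableau_row_comp)
      then have "p x \<in> insert (m + 1 + i) (if i < length ?mu then T ! i else {})"
        unfolding eq[symmetric] nth[OF i(1)] .
      moreover have "p x \<notin> T ! i" if "i < length ?mu" using disj[of "T ! i"] that len pB by auto
      ultimately have "p x = m + 1 + i" by (auto split: if_splits)
      then show "p x = x" using i col by simp
    qed
  next
    fix p assume "p \<in> col_stabilizer ?mu ?s"
    then have p: "p permutes {1..m}" unfolding m_def by (rule col_stabilizer_permutes)
    have px: "p (m + 1 + i) = m + 1 + i" for i by (intro permutes_not_in[OF p]) auto
    have R: "tabloid lam (p \<circ> s) ! i =
        insert (m + 1 + i) (if i < length ?mu then tabloid ?mu (p \<circ> ?s) ! i else {})" if i: "i < ?b" for i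
      using i by (simp only: tabloid_nth tableau_row_comp row' image_insert px image_empty if_distrib[of "(`) p"] cong: if_cong)
    have nin: "m + 1 + i \<notin> tabloid ?mu (p \<circ> ?s) ! k" if "k < length ?mu" for i k
    proof
      assume "m + 1 + i \<in> tabloid ?mu (p \<circ> ?s) ! k"
      then have "m + 1 + i \<in> tableau_row ?mu (p \<circ> ?s) k" using that by (simp add: tabloid_nth)
      moreover have "is_tableau ?mu (p \<circ> ?s)" using p unfolding m_def by (rule is_tableau_comp[OF s'])
      then have "tableau_row ?mu (p \<circ> ?s) k \<subseteq> {1..m}" unfolding m_def by (rule tableau_row_subset)
      ultimately show False by auto
    qed
    have ninT: "m + 1 + i \<notin> T ! i" if "i < length ?mu" for i
      using disj[of "T ! i"] that len lm by auto
    show "(add_column m ?b T = tabloid lam (p \<circ> s)) = (T = tabloid ?mu (p \<circ> ?s))"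
    proof
      assume eq: "add_column m ?b T = tabloid lam (p \<circ> s)"
      show "T = tabloid ?mu (p \<circ> ?s)"
      proof (rule nth_equalityI)
        show "length T = length (tabloid ?mu (p \<circ> ?s))" by (simp add: len tabloid_def)
        fix i assume "i < length T"
        then have i: "i < length ?mu" "i < ?b" using len lm by auto
        have "insert (m + 1 + i) (T ! i) = insert (m + 1 + i) (tabloid ?mu (p \<circ> ?s) ! i)"
          using nth[OF i(2)] R[OF i(2)] i(1) eq by simp
        then show "T ! i = tabloid ?mu (p \<circ> ?s) ! i" by (simp only: insert_ident[OF ninT[OF i(1)] nin[OF i(1), of i]])
      qed
    next
      assume eq: "T = tabloid ?mu (p \<circ> ?s)"
      show "add_column m ?b T = tabloid lam (p \<circ> s)"
      proof (rule nth_equalityI)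
        show "length (add_column m ?b T) = length (tabloid lam (p \<circ> s))" by (simp add: add_column_def tabloid_def)
        fix i assume "i < length (add_column m ?b T)"
        then have i: "i < ?b" by (simp add: add_column_def)
        show "add_column m ?b T ! i = tabloid lam (p \<circ> s) ! i" by (simp only: nth[OF i] R[OF i] eq[symmetric])
      qed
    qed
  qed (use n in auto)
qed

lemma tableau_extend_column:
  assumes srt: "sorted_wrt (\<ge>) lam" and pos: "\<forall>k\<in>set lam. 0 < k" and t: "is_tableau (remove_column lam) t"
  defines "s \<equiv> (\<lambda>(i, j). case j of 0 \<Rightarrow> sum_list (remove_column lam) + 1 + i | Suc j' \<Rightarrow> t (i, j'))"
  shows "is_tableau lam s" "\<And>i. s (i, 0) = sum_list (remove_column lam) + 1 + i"
    "(\<lambda>(i, j). s (i, Suc j)) = t"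
proof -
  let ?m = "sum_list (remove_column lam)"
  have "bij_betw (\<lambda>i. s (i, 0)) {..<length lam} {?m<..length lam + ?m}"
    unfolding s_def by (rule bij_betw_byWitness[where f' = "\<lambda>x. x - ?m - 1"]) auto
  then have b: "bij_betw s ((\<lambda>i. (i, 0)) ` {..<length lam}) {?m<..length lam + ?m}"
    by (auto simp: bij_betw_def inj_on_def image_image)
  show st: "(\<lambda>(i, j). s (i, Suc j)) = t" by (simp add: s_def)
  show "is_tableau lam s" unfolding is_tableau_column[OF srt pos b] st by (rule t)
  show "s (i, 0) = ?m + 1 + i" for i by (simp add: s_def)
qed

lemma rearrange_permutes:
  assumes "finite B" "bij_betw f B B"
  shows "(\<lambda>x. if x \<in> B then f x else x) permutes B"
  using assms(2) by (intro bij_imp_permutes) (auto cong: bij_betw_cong)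

text \<open>The coefficients of \<open>v\<close> at tabloids whose first column can be taken to consist of the largest
  points, in increasing order. Lists of the wrong length and lists that already contain one of
  these points are excluded because \<open>add_column\<close> would not remember them.\<close>

definition strip_column :: "nat list \<Rightarrow> (nat set list \<Rightarrow> 'k::zero) \<Rightarrow> nat set list \<Rightarrow> 'k" where
  "strip_column lam v = (\<lambda>T. if length T = length (remove_column lam) \<and>
     (\<forall>S\<in>set T. S \<inter> {sum_list (remove_column lam)<..length lam + sum_list (remove_column lam)} = {})
     then v (add_column (sum_list (remove_column lam)) (length lam) T) else 0)"

lemma strip_column_polytabloid:
  assumes srt: "sorted_wrt (\<ge>) lam" and pos: "\<forall>k\<in>set lam. 0 < k" and s: "is_tableau lam s"
    and col: "\<And>i. i < length lam \<Longrightarrow> s (i, 0) = sum_list (remove_column lam) + 1 + i"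
    and s': "is_tableau (remove_column lam) (\<lambda>(i, j). s (i, Suc j))"
  shows "strip_column lam (polytabloid lam s) = (polytabloid (remove_column lam) (\<lambda>(i, j). s (i, Suc j)) :: _ \<Rightarrow> 'k::field_char_0)"
proof
  fix T
  let ?mu = "remove_column lam" and ?s = "\<lambda>(i, j). s (i, Suc j)" and ?m = "sum_list (remove_column lam)"
  let ?valid = "length T = length ?mu \<and> (\<forall>S\<in>set T. S \<inter> {?m<..length lam + ?m} = {})"
  show "strip_column lam (polytabloid lam s) T = (polytabloid ?mu ?s T :: 'k)"
  proof (cases ?valid)
    case True
    then show ?thesis
      using polytabloid_add_column[OF srt pos s col, of T, where 'k='k] by (simp add: strip_column_def)
  next
    case False
    have "polytabloid ?mu ?s T = (0 :: 'k)"
    proof (rule ccontr)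
      assume "polytabloid ?mu ?s T \<noteq> (0 :: 'k)"
      from polytabloid_support[OF s' this] obtain u where u: "is_tableau ?mu u" "T = tabloid ?mu u" .
      have "S \<inter> {?m<..length lam + ?m} = {}" if "S \<in> set T" for S
      proof -
        have "S \<subseteq> {1..?m}" using that u(2) tableau_entry[OF u(1)] by (auto simp: tabloid_def tableau_row_def)
        then show ?thesis by auto
      qed
      moreover have "length T = length ?mu" by (simp add: u(2) tabloid_def)
      ultimately show False using False by blast
    qed
    then show ?thesis using False by (auto simp: strip_column_def)
  qed
qed

text \<open>A tabloid with two points of \<open>A\<close> in the same row has coefficient zero, since the transposition of
  the two changes the sign of \<open>v\<close> but not the tabloid. Every other tabloid with a nonzero
  coefficient has one point of \<open>A\<close> in each row, and a permutation of \<open>A\<close> brings these points into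
  increasing order.\<close>

lemma column_antiinvariant_determined:
  assumes srt: "sorted_wrt (\<ge>) lam" and pos: "\<forall>k\<in>set lam. 0 < k"
  defines "m \<equiv> sum_list (remove_column lam)"
  assumes v: "v \<in> (isotypic sign {m<..length lam + m} lam :: (_ \<Rightarrow> 'k::field_char_0) set)"
    and zero: "strip_column lam v = 0"
  shows "v = 0"
proof (rule ccontr)
  let ?b = "length lam" and ?mu = "remove_column lam"
  let ?B = "{m<..?b + m}"
  have vS: "v \<in> specht_module lam"
    and anti: "\<And>x. x permutes ?B \<Longrightarrow> perm_act x v = fun_scale (of_int (sign x)) v"
    using v by (auto simp: isotypic_def)
  have n: "sum_list lam = ?b + m" using sum_list_remove_column[OF srt pos] by (simp add: m_def)
  assume "v \<noteq> 0"
  then obtain T where T: "v T \<noteq> 0" by (auto simp: fun_eq_iff)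
  from specht_module_support[OF vS T] obtain s where s: "is_tableau lam s" "T = tabloid lam s" .
  have inv: "v (map ((`) x) T) \<noteq> 0" if x: "x permutes ?B" for x
  proof -
    have x': "inv' x permutes ?B" by (rule permutes_inv[OF x])
    have "perm_act (inv' x) v T = of_int (sign (inv' x)) * v T"
      unfolding anti[OF x'] by (simp add: fun_scale_def)
    then show ?thesis using T by (simp add: perm_act_def permutes_inv_inv[OF x] sign_def split: if_splits)
  qed
  have rowex: "\<exists>i<?b. x \<in> tableau_row lam s i" if x: "x \<in> ?B" for x
  proof -
    have "x \<in> {1..sum_list lam}" using x n by auto
    then obtain i j where "(i, j) \<in> young_diagram lam" "x = s (i, j)" using tableau_obtain_cell[OF s(1)] by blast
    then show ?thesis by (auto simp: tableau_row_def young_diagram_def)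
  qed
  define r where "r x = (SOME i. i < ?b \<and> x \<in> tableau_row lam s i)" for x
  have r: "r x < ?b \<and> x \<in> tableau_row lam s (r x)" if "x \<in> ?B" for x
    using someI_ex[OF rowex[OF that, unfolded bex_simps]] unfolding r_def by blast
  have rinj: "inj_on r ?B"
  proof (rule inj_onI, rule ccontr)
    fix x y assume xy: "x \<in> ?B" "y \<in> ?B" "r x = r y" "x \<noteq> y"
    have p: "transpose x y permutes ?B" using xy by (intro permutes_swap_id)
    have "tabloid lam (transpose x y \<circ> s) = tabloid lam s"
      using r[OF xy(1)] r[OF xy(2)] xy(3) by (intro tabloid_transpose_same_row[OF s(1), of _ "r x"]) auto
    then have "map ((`) (transpose x y)) T = T" by (simp add: s(2) tabloid_comp)
    then have "v T = - v T"
      using fun_cong[OF anti[OF p], of T] xy(4) by (simp add: perm_act_def fun_scale_def sign_swap_id)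
    then show False using T by simp
  qed
  \<comment> \<open>send the point of \<open>A\<close> in row \<open>i\<close> to the \<open>i\<close>-th point of \<open>A\<close>\<close>
  define f where "f x = m + 1 + r x" for x
  have finj: "inj_on f ?B" using rinj by (auto simp: f_def inj_on_def)
  have "f ` ?B \<subseteq> ?B" using r by (fastforce simp: f_def)
  then have fB: "f ` ?B = ?B" using finj by (intro endo_inj_surj) auto
  define x where "x = (\<lambda>y. if y \<in> ?B then f y else y)"
  have x: "x permutes ?B" unfolding x_def using finj fB by (intro rearrange_permutes) (auto simp: bij_betw_def)
  have xs: "is_tableau lam (x \<circ> s)" using x by (intro is_tableau_comp[OF s(1)] permutes_subset[OF x]) (auto simp: n)
  have mem: "m + 1 + i \<in> tableau_row lam (x \<circ> s) i" if i: "i < ?b" for i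
  proof -
    have "m + 1 + i \<in> f ` ?B" unfolding fB using i by auto
    then obtain y where y: "y \<in> ?B" "f y = m + 1 + i" by auto
    then have "r y = i" "x y = m + 1 + i" by (auto simp: f_def x_def)
    then show ?thesis using r[OF y(1)] unfolding tableau_row_comp by (metis imageI)
  qed
  have only: "y = m + 1 + i" if i: "i < ?b" and y: "y \<in> tableau_row lam (x \<circ> s) i" "y \<in> ?B" for i y
  proof -
    have "y - m - 1 < ?b" "y = m + 1 + (y - m - 1)" using y(2) by auto
    then have "y \<in> tableau_row lam (x \<circ> s) (y - m - 1)" using mem by metis
    then have "i = y - m - 1" using tableau_row_disjoint[OF xs y(1)] by blast
    then show ?thesis using \<open>y = m + 1 + (y - m - 1)\<close> by simp
  qed
  define T' where "T' = map (\<lambda>i. tableau_row lam (x \<circ> s) i - ?B) [0..<length ?mu]"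
  have lm: "length ?mu \<le> ?b" by (rule length_remove_column)
  have "add_column m ?b T' = tabloid lam (x \<circ> s)"
  proof (rule nth_equalityI)
    show "length (add_column m ?b T') = length (tabloid lam (x \<circ> s))" by (simp add: add_column_def tabloid_def)
    fix i assume "i < length (add_column m ?b T')"
    then have i: "i < ?b" by (simp add: add_column_def)
    have inB: "m + 1 + i \<in> ?B" using i by auto
    have "insert (m + 1 + i) (if i < length ?mu then tableau_row lam (x \<circ> s) i - ?B else {}) = tableau_row lam (x \<circ> s) i"
    proof (cases "i < length ?mu")
      case True
      have "tableau_row lam (x \<circ> s) i \<inter> ?B = {m + 1 + i}"
        using mem[OF i] only[OF i] inB by blast
      then show ?thesis using True by auto
    next
      case False
      have "{j. (i, Suc j) \<in> young_diagram lam} = {}"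
        using False young_diagram_remove_column[OF srt] by (auto simp: young_diagram_def)
      then have "tableau_row lam (x \<circ> s) i \<subseteq> {(x \<circ> s) (i, 0)}"
      proof (intro subsetI)
        fix y assume "y \<in> tableau_row lam (x \<circ> s) i"
        then obtain j where "(i, j) \<in> young_diagram lam" "y = (x \<circ> s) (i, j)"
          unfolding tableau_row_def by blast
        then show "y \<in> {(x \<circ> s) (i, 0)}"
          using \<open>{j. (i, Suc j) \<in> young_diagram lam} = {}\<close> by (cases j) auto
      qed
      from subset_singletonD[OF this] mem[OF i] have "tableau_row lam (x \<circ> s) i = {m + 1 + i}"
        by (metis empty_iff singletonD)
      then show ?thesis using False by simp
    qed
    then show "add_column m ?b T' ! i = tabloid lam (x \<circ> s) ! i"
      using i by (cases "i < length ?mu") (simp_all add: add_column_def tabloid_nth T'_def)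
  qed
  moreover have "strip_column lam v T' = v (add_column m ?b T')"
    by (auto simp: strip_column_def T'_def m_def)
  ultimately have "v (tabloid lam (x \<circ> s)) = 0" using zero by simp
  then show False using inv[OF x] by (simp add: s(2) tabloid_comp)
qed

text \<open>The map \<open>strip_column\<close> identifies the sign-isotypic part with the Specht module of the partition
  without its first column.\<close>

lemma column_average_removal:
  assumes srt: "sorted_wrt (\<ge>) lam" and pos: "\<forall>k\<in>set lam. 0 < k"
  defines "m \<equiv> sum_list (remove_column lam)"
  assumes g: "g permutes {1..m}"
  shows "(\<Sum>x | x permutes {m<..length lam + m}. of_int (sign x) * specht_character lam (x \<circ> g))
    = (fact (length lam) * specht_character (remove_column lam) g :: 'k::field_char_0)"
proof -
  let ?mu = "remove_column lam" and ?A = "{m<..length lam + m}" and ?h = "strip_column lam"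
  let ?W = "isotypic sign ?A lam :: (_ \<Rightarrow> 'k) set"
  let ?P = "symmetrizer sign ?A :: (_ \<Rightarrow> 'k) \<Rightarrow> _"
  have n: "sum_list lam = length lam + m" using sum_list_remove_column[OF srt pos] by (simp add: m_def)
  have lin: "Vector_Spaces.linear fun_scale fun_scale (?h :: (_ \<Rightarrow> 'k) \<Rightarrow> _)"
    by unfold_locales (auto simp: strip_column_def fun_scale_def fun_eq_iff algebra_simps)
  interpret h: Vector_Spaces.linear fun_scale fun_scale "?h :: (_ \<Rightarrow> 'k) \<Rightarrow> _" by (rule lin)
  have A: "?A \<subseteq> {1..sum_list lam}" using n by auto
  have lc: "linear_character sign ?A" by (rule linear_character_sign) simp
  have "{1..sum_list lam} - ?A = {1..m}" using n by auto
  with g have g': "g permutes {1..sum_list lam} - ?A" by simp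
  have col0: "tableau_col lam s 0 = (\<lambda>i. s (i, 0)) ` {..<length lam}" for s
    using first_column[OF pos] by (auto simp: tableau_col_def)
  have col: "tableau_col lam s 0 = ?A" if "?A \<subseteq> tableau_col lam s 0" for s
  proof -
    have fin: "finite (tableau_col lam s 0)" unfolding col0 by simp
    have "card (tableau_col lam s 0) \<le> length lam"
      unfolding col0 using card_image_le[of "{..<length lam}"] by simp
    then show ?thesis using card_seteq[OF fin that] by simp
  qed
  have hP: "?h (?P (polytabloid lam s)) = fun_scale (fact (length lam)) (?h (polytabloid lam s))"
    if s: "is_tableau lam s" and r: "tableau_col lam s 0 = ?A" for s
  proof -
    have "perm_act x (polytabloid lam s) = fun_scale (of_int (sign x)) (polytabloid lam s :: _ \<Rightarrow> 'k)"
      if x: "x permutes ?A" for x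
    proof -
      have xN: "x permutes {1..sum_list lam}" using x A by (rule permutes_subset)
      have "x ` tableau_col lam s j = tableau_col lam s j" for j
      proof (cases "j = 0")
        case True show ?thesis unfolding True r by (rule permutes_image[OF x])
      next
        case False
        have "x y = y" if "y \<in> tableau_col lam s j" for y
          using tableau_col_disjoint[OF s that, of 0] False r permutes_not_in[OF x] by blast
        then show ?thesis by simp
      qed
      then have "x \<in> col_stabilizer lam s" using xN by (simp add: col_stabilizer_def)
      then show ?thesis by (simp only: perm_act_polytabloid[OF xN] polytabloid_col_stabilizer)
    qed
    moreover have "polytabloid lam s \<in> (specht_module lam :: (_ \<Rightarrow> 'k) set)"
      using s unfolding specht_module_def by (intro fn.span_base) blast
    ultimately have "polytabloid lam s \<in> ?W" by (simp add: isotypic_def)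
    then have "?P (polytabloid lam s) = fun_scale (fact (length lam)) (polytabloid lam s)"
      using symmetrizer_of_isotypic[OF lc] by simp
    then show ?thesis by (simp only: h.scale)
  qed
  have im: "?h ` ?W = specht_module ?mu"
  proof (rule isotypic_image_eq_specht_module[OF lin lc A column_antisymmetrizer_span[OF A]])
    fix s assume s: "is_tableau lam s" "?A \<subseteq> tableau_col lam s 0"
    note c = col[OF s(2)]
    \<comment> \<open>reordering the entries of the first column of \<open>s\<close> only changes the sign\<close>
    define f where "f y = m + 1 + fst (inv_into (young_diagram lam) s y)" for y
    have inj: "inj_on s (young_diagram lam)" using s(1) by (simp add: is_tableau_def bij_betw_def)
    have fs: "f (s (i, 0)) = m + 1 + i" if "i < length lam" for i
      using that inj first_column[OF pos] by (simp add: f_def)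
    have "f ` ?A = (\<lambda>i. m + 1 + i) ` {..<length lam}"
      unfolding c[symmetric] col0 image_image using fs by (intro image_cong) auto
    also have "\<dots> = ?A"
    proof (rule equalityI; rule subsetI)
      fix x assume "x \<in> ?A"
      then show "x \<in> (\<lambda>i. m + 1 + i) ` {..<length lam}" by (intro image_eqI[of _ _ "x - m - 1"]) auto
    qed auto
    finally have "f ` ?A = ?A" .
    then have bij: "bij_betw f ?A ?A" by (simp add: bij_betw_def eq_card_imp_inj_on)
    define x where "x = (\<lambda>y. if y \<in> ?A then f y else y)"
    have x: "x permutes ?A" unfolding x_def using bij by (intro rearrange_permutes) auto
    have xN: "x permutes {1..sum_list lam}" using x A by (rule permutes_subset)
    let ?s = "x \<circ> s"
    have s2: "is_tableau lam ?s" using s(1) xN by (rule is_tableau_comp)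
    have c2: "tableau_col lam ?s 0 = ?A" unfolding tableau_col_comp c by (rule permutes_image[OF x])
    have e2: "?s (i, 0) = m + 1 + i" if "i < length lam" for i
    proof -
      have "s (i, 0) \<in> ?A" unfolding c[symmetric] col0 using that by blast
      then show ?thesis using fs[OF that] by (simp add: x_def)
    qed
    have s': "is_tableau ?mu (\<lambda>(i, j). ?s (i, Suc j))"
      using is_tableau_remove_column[OF srt pos s2] c2 unfolding m_def .
    have strip: "?h (polytabloid lam ?s) = (polytabloid ?mu (\<lambda>(i, j). ?s (i, Suc j)) :: _ \<Rightarrow> 'k)"
      using e2 unfolding m_def by (rule strip_column_polytabloid[OF srt pos s2 _ s'])
    have "?P (polytabloid lam ?s) = fun_scale (of_int (sign x)) (?P (polytabloid lam s))"
      by (simp only: perm_act_polytabloid[OF xN, symmetric] symmetrizer_perm_act[OF lc x])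
    then have "?P (polytabloid lam s) = fun_scale (of_int (sign x)) (?P (polytabloid lam ?s))"
      by (simp add: fn.scale_scale flip: of_int_mult)
    then have "?h (?P (polytabloid lam s)) =
        fun_scale (of_int (sign x) * fact (length lam)) (polytabloid ?mu (\<lambda>(i, j). ?s (i, Suc j)))"
      by (simp only: h.scale hP[OF s2 c2] strip fn.scale_scale)
    then show "\<exists>t c. is_tableau ?mu t \<and> ?h (?P (polytabloid lam s)) = fun_scale c (polytabloid ?mu t)"
      using s' by blast
  next
    fix t assume t: "is_tableau ?mu t"
    define s where "s = (\<lambda>(i, j). case j of 0 \<Rightarrow> sum_list ?mu + 1 + i | Suc j' \<Rightarrow> t (i, j'))"
    have s: "is_tableau lam s" "\<And>i. s (i, 0) = sum_list ?mu + 1 + i" "(\<lambda>(i, j). s (i, Suc j)) = t"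
      unfolding s_def by (rule tableau_extend_column[OF srt pos t])+
    have "?A \<subseteq> tableau_col lam s 0"
    proof
      fix x assume "x \<in> ?A"
      then show "x \<in> tableau_col lam s 0" unfolding col0 s(2) m_def[symmetric]
        by (intro image_eqI[of _ _ "x - m - 1"]) auto
    qed
    note c = col[OF this]
    have "?h (polytabloid lam s) = (polytabloid ?mu t :: _ \<Rightarrow> 'k)"
      unfolding s(3)[symmetric]
      by (rule strip_column_polytabloid[OF srt pos s(1) s(2)]) (simp only: s(3) t)
    then show "\<exists>s c. is_tableau lam s \<and> ?A \<subseteq> tableau_col lam s 0 \<and> c \<noteq> 0 \<and>
        ?h (?P (polytabloid lam s)) = fun_scale c (polytabloid ?mu t)"
      using s(1) c hP[OF s(1) c] by (intro exI[of _ s] exI[of _ "fact (length lam)"]) simp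
  qed
  have "(\<Sum>x | x permutes ?A. of_int (sign x) * specht_character lam (x \<circ> g))
      = (fact (card ?A) * specht_character ?mu g :: 'k)"
  proof (rule character_average_via_intertwiner[OF lin lc A g' im])
    fix v assume "v \<in> ?W" and "?h v = 0"
    then show "v = 0" unfolding m_def by (rule column_antiinvariant_determined[OF srt pos])
  next
    fix v assume "v \<in> ?W"
    let ?i = "inv' g"
    have ig: "?i permutes {1..m}" by (rule permutes_inv[OF g])
    have fixed: "?i (Suc (m + i)) = Suc (m + i)" for i by (intro permutes_not_in[OF ig]) auto
    have imA: "?i ` ?A = ?A" using permutes_not_in[OF ig] by auto
    have disj: "(?i ` S) \<inter> ?A = {} \<longleftrightarrow> S \<inter> ?A = {}" for S
      using image_Int[OF permutes_inj[OF ig], of S ?A] unfolding imA by (metis image_is_empty)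
    have shift: "add_column m (length lam) (map ((`) ?i) T) = map ((`) ?i) (add_column m (length lam) T)" for T
      by (simp add: add_column_def fixed)
    show "?h (perm_act g v) = perm_act g (?h v)"
      unfolding strip_column_def perm_act_def m_def[symmetric]
      by (simp add: shift disj cong: if_cong)
  qed
  then show ?thesis by simp
qed

section \<open>Class functions that vanish at cycles of length divisible by q\<close>

lemma sign_cycle_of_list:
  "distinct cs \<Longrightarrow> cs \<noteq> [] \<Longrightarrow> sign (cycle_of_list cs) = (-1) ^ (length cs - 1)"
proof (induction cs rule: cycle_of_list.induct)
  case (1 i j cs)
  have "sign (cycle_of_list (i # j # cs)) = sign (transpose i j) * sign (cycle_of_list (j # cs))"
    using permutation_of_cycle[of "j # cs"] by (simp add: sign_compose permutation_swap_id)
  also have "\<dots> = (-1) ^ (length (i # j # cs) - 1)"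
    using 1 by (simp add: sign_swap_id del: cycle_of_list.simps)
  finally show ?case .
qed auto

lemma perm_restrict_permutes:
  assumes "inj x" "x ` Y = Y"
  shows "perm_restrict x Y permutes Y"
proof (rule bij_imp_permutes)
  have "bij_betw x Y Y" using assms inj_on_subset[of x UNIV Y] by (simp add: bij_betw_def)
  then show "bij_betw (perm_restrict x Y) Y Y"
    by (subst bij_betw_cong[of Y _ x]) (simp_all add: perm_restrict_def)
qed (simp add: perm_restrict_def)

lemma perm_restrict_Un_comp:
  assumes "x ` Y = Y" "x ` Z = Z" "Y \<inter> Z = {}"
  shows "perm_restrict x (Y \<union> Z) = perm_restrict x Y \<circ> perm_restrict x Z"
proof
  fix v
  have "x v \<in> Z" if "v \<in> Z" using assms(2) that by blast
  then show "perm_restrict x (Y \<union> Z) v = (perm_restrict x Y \<circ> perm_restrict x Z) v"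
    using assms(3) by (cases "v \<in> Z") (auto simp: perm_restrict_def)
qed

text \<open>For \<open>e j = u ^ j\<close> this is the product of \<open>1 - u ^ m\<close> over the cycle lengths \<open>m\<close> of \<open>x\<close> on \<open>K\<close>. Using
  a periodic function \<open>e\<close> in place of the powers of a root of unity \<open>u\<close> avoids extending the field.\<close>

definition cycle_weight :: "(nat \<Rightarrow> 'k::field_char_0) \<Rightarrow> nat set \<Rightarrow> (nat \<Rightarrow> nat) \<Rightarrow> 'k" where
  "cycle_weight e K x =
     (\<Sum>Y | Y \<subseteq> K \<and> x ` Y = Y. (-1) ^ card Y * e (card Y) * of_int (sign (perm_restrict x Y)))"

text \<open>A cycle whose length is divisible by the period \<open>q\<close> is either contained in an invariant set \<open>Y\<close> or
  disjoint from it. Adding or removing it does not change \<open>e (card Y)\<close>, and it changes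
  \<open>(-1) ^ card Y\<close> times the sign by \<open>(-1) ^ m * (-1) ^ (m - 1) = -1\<close>, where \<open>m\<close> is its length.\<close>

lemma cycle_weight_zero:
  fixes e :: "nat \<Rightarrow> 'k::field_char_0"
  assumes K: "finite K" and x: "x permutes K" and i: "i \<in> K" and q: "q dvd least_power x i"
    and per: "\<And>j. e (j + q) = e j"
  shows "cycle_weight e K x = 0"
proof -
  have px: "permutation x" using x K permutation_permutes by blast
  define c where "c = set (support x i)"
  have cyc: "distinct (support x i)" by (rule cycle_of_permutation[OF px])
  have pos: "0 < least_power x i" by (rule least_power_of_permutation(2)[OF px])
  have cc: "card c = least_power x i" using distinct_card[OF cyc] by (simp add: c_def)
  have c_range: "c = range (\<lambda>j. (x ^^ j) i)" unfolding c_def by (rule support_set[OF px])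
  have cK: "c \<subseteq> K" unfolding c_range using permutes_in_image[OF permutes_funpow[OF x]] i by auto
  have fc: "finite c" using cK K finite_subset by blast
  have inj: "inj x" by (rule permutes_inj[OF x])
  have "x ` c \<subseteq> c" 
  proof
    fix y assume "y \<in> x ` c"
    then obtain j where "y = (x ^^ Suc j) i" unfolding c_range by auto
    then show "y \<in> c" unfolding c_range by blast
  qed
  then have xc: "x ` c = c" using fc inj by (intro endo_inj_surj) (auto intro: inj_on_subset)
  have rc: "perm_restrict x c = cycle_of_list (support x i)"
  proof
    fix v show "perm_restrict x c v = cycle_of_list (support x i) v"
    proof (cases "v \<in> c")
      case True
      then have "v \<in> set (support x i)" unfolding c_def .
      from cycle_restrict[OF px this] show ?thesis using True by (simp only: perm_restrict_def if_True)
    next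
      case False
      then have "v \<notin> set (support x i)" unfolding c_def .
      from id_outside_supp[OF this] show ?thesis using False by (simp only: perm_restrict_def if_False)
    qed
  qed
  have sc: "sign (perm_restrict x c) = (-1) ^ (card c - 1)"
    unfolding rc cc using sign_cycle_of_list[OF cyc] pos by simp
  have sub: "c \<subseteq> Y" if Y: "x ` Y = Y" and ne: "c \<inter> Y \<noteq> {}" for Y
  proof -
    obtain y where y: "y \<in> c" "y \<in> Y" using ne by blast
    have "(x ^^ j) y \<in> Y" for j by (induction j) (use y Y in auto)
    moreover have "c = set (support x y)"
    proof -
      have "set (support x y) \<inter> set (support x i) \<noteq> {}"
        using disjoint_support'[OF px, of y i] y(1) unfolding c_def by blast
      then show ?thesis
        using disjoint_support[OF px] unfolding c_def disjoint_def by blast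
    qed
    ultimately show ?thesis unfolding support_set[OF px] by auto
  qed
  let ?A = "{Y. Y \<subseteq> K \<and> x ` Y = Y}"
  let ?f = "\<lambda>Y. (-1) ^ card Y * e (card Y) * of_int (sign (perm_restrict x Y)) :: 'k"
  obtain r where r: "card c = q * r" using q cc by (auto simp: dvd_def)
  have per': "e (j + card c) = e j" for j
  proof -
    have "e (j + q * r) = e j" by (induction r) (simp_all add: per add.assoc[symmetric] add.commute[of q])
    then show ?thesis by (simp add: r)
  qed
  have flip: "?f (Y \<union> c) = - ?f Y" if Y: "Y \<in> ?A" "Y \<inter> c = {}" for Y
  proof -
    have fY: "finite Y" using Y K finite_subset by blast
    have p: "perm_restrict x Y permutes Y" "perm_restrict x c permutes c"
      using Y xc inj by (auto intro: perm_restrict_permutes)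
    have "sign (perm_restrict x (Y \<union> c)) = sign (perm_restrict x Y) * sign (perm_restrict x c)"
      unfolding perm_restrict_Un_comp[OF conjunct2[OF CollectD[OF Y(1)]] xc Y(2)]
      using p fY fc by (intro sign_compose) (auto simp: permutation_permutes)
    moreover have "card (Y \<union> c) = card Y + card c" using fY fc Y(2) by (rule card_Un_disjoint)
    moreover have "(-1) ^ card c * (-1) ^ (card c - 1) = (-1 :: 'k)"
      using pos cc by (cases "card c") (auto simp: power_add[symmetric])
    ultimately show ?thesis
      by (simp add: per' sc power_add algebra_simps)
  qed
  have dc: "Y - c \<in> ?A" if "Y \<in> ?A" for Y
    using that xc inj by (auto simp: image_set_diff)
  have uc: "Y \<union> c \<in> ?A" if "Y \<in> ?A" for Y
    using that xc cK by (auto simp: image_Un)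
  have "(\<Sum>Y\<in>?A. ?f Y) = 0"
  proof (rule sum_antisymmetric_involution[where i = "\<lambda>Y. if c \<subseteq> Y then Y - c else Y \<union> c"])
    fix Y assume Y: "Y \<in> ?A"
    show "(if c \<subseteq> Y then Y - c else Y \<union> c) \<in> ?A" using dc[OF Y] uc[OF Y] by (simp split: if_splits)
    have cne: "c \<noteq> {}" using pos cc fc by auto
    have dis: "Y \<inter> c = {}" if "\<not> c \<subseteq> Y" using sub[of Y] Y that by auto
    show "(if c \<subseteq> (if c \<subseteq> Y then Y - c else Y \<union> c) then (if c \<subseteq> Y then Y - c else Y \<union> c) - c
        else (if c \<subseteq> Y then Y - c else Y \<union> c) \<union> c) = Y"
      using cne dis by (cases "c \<subseteq> Y") auto
    show "?f (if c \<subseteq> Y then Y - c else Y \<union> c) = - ?f Y"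
    proof (cases "c \<subseteq> Y")
      case True
      then have eq: "(Y - c) \<union> c = Y" by auto
      have "(Y - c) \<inter> c = {}" by blast
      from flip[OF dc[OF Y] this] show ?thesis using True unfolding eq by simp
    next
      case False
      then show ?thesis using flip[OF Y dis] by simp
    qed
  qed
  then show ?thesis by (simp add: cycle_weight_def)
qed

text \<open>A permutation \<open>x\<close> of \<open>K\<close> with an invariant subset \<open>Y\<close> is a pair of permutations of \<open>K - Y\<close> and \<open>Y\<close>.\<close>

lemma cycle_weight_sum:
  fixes e :: "nat \<Rightarrow> 'k::field_char_0"
  assumes K: "finite K"
  shows "(\<Sum>x | x permutes K. cycle_weight e K x * F x)
    = (\<Sum>Y\<in>Pow K. (-1) ^ card Y * e (card Y) *
        (\<Sum>z | z permutes K - Y. \<Sum>y | y permutes Y. of_int (sign y) * F (z \<circ> y)))"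
proof -
  let ?c = "\<lambda>Y. (-1) ^ card Y * e (card Y) :: 'k"
  have fin: "finite {x. x permutes K}" using K by (rule finite_permutations)
  have "(\<Sum>x | x permutes K. cycle_weight e K x * F x)
      = (\<Sum>x | x permutes K. \<Sum>Y | Y \<in> Pow K \<and> x ` Y = Y. ?c Y * of_int (sign (perm_restrict x Y)) * F x)"
    by (simp add: cycle_weight_def sum_distrib_right)
  also have "\<dots> = (\<Sum>Y\<in>Pow K. \<Sum>x | x permutes K \<and> x ` Y = Y. ?c Y * of_int (sign (perm_restrict x Y)) * F x)"
    using sum.swap_restrict[of "{x. x permutes K}" "Pow K" "\<lambda>x Y. ?c Y * of_int (sign (perm_restrict x Y)) * F x" "\<lambda>x Y. x ` Y = Y"]
      fin K by simp
  also have "\<dots> = (\<Sum>Y\<in>Pow K. ?c Y *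
        (\<Sum>z | z permutes K - Y. \<Sum>y | y permutes Y. of_int (sign y) * F (z \<circ> y)))"
  proof (intro sum.cong refl)
    fix Y assume "Y \<in> Pow K"
    then have Y: "Y \<subseteq> K" by simp
    have "(\<Sum>x | x permutes K \<and> x ` Y = Y. ?c Y * of_int (sign (perm_restrict x Y)) * F x)
        = (\<Sum>(z, y)\<in>{z. z permutes K - Y} \<times> {y. y permutes Y}. ?c Y * (of_int (sign y) * F (z \<circ> y)))"
    proof (rule sum.reindex_bij_witness[where i = "\<lambda>(z, y). z \<circ> y" and j = "\<lambda>x. (perm_restrict x (K - Y), perm_restrict x Y)"])
      fix x assume "x \<in> {x. x permutes K \<and> x ` Y = Y}"
      then have x: "x permutes K" "x ` Y = Y" by auto
      have x': "x ` (K - Y) = K - Y" using x permutes_image[OF x(1)] by (simp add: image_set_diff permutes_inj)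
      have KY: "(K - Y) \<union> Y = K" using Y by blast
      have Diff_disjoint': "(K - Y) \<inter> Y = {}" by blast
      have "perm_restrict x K = x" using permutes_not_in[OF x(1)] by (auto simp: perm_restrict_def fun_eq_iff)
      then show e1: "(case (perm_restrict x (K - Y), perm_restrict x Y) of (z, y) \<Rightarrow> z \<circ> y) = x"
        using perm_restrict_Un_comp[OF x' x(2) Diff_disjoint'] KY by simp
      show "(perm_restrict x (K - Y), perm_restrict x Y) \<in> {z. z permutes K - Y} \<times> {y. y permutes Y}"
        using perm_restrict_permutes[OF permutes_inj[OF x(1)]] x(2) x' by simp
      show "(case (perm_restrict x (K - Y), perm_restrict x Y) of (z, y) \<Rightarrow> ?c Y * (of_int (sign y) * F (z \<circ> y)))
          = ?c Y * of_int (sign (perm_restrict x Y)) * F x"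
        using e1 by (simp add: mult.assoc)
    next
      fix zy assume "zy \<in> {z. z permutes K - Y} \<times> {y. y permutes Y}"
      then obtain z y where zy: "zy = (z, y)" "z permutes K - Y" "y permutes Y" by blast
      have zY: "z v = v" if "v \<in> Y" for v using permutes_not_in[OF zy(2)] that by simp
      have yN: "y v = v" if "v \<notin> Y" for v using permutes_not_in[OF zy(3)] that by simp
      have yin: "y v \<in> Y" if "v \<in> Y" for v using permutes_in_image[OF zy(3)] that by simp
      have "perm_restrict (z \<circ> y) Y = y" using zY yin yN by (auto simp: perm_restrict_def fun_eq_iff)
      moreover have "perm_restrict (z \<circ> y) (K - Y) = z"
        using yN permutes_not_in[OF zy(2)] by (auto simp: perm_restrict_def fun_eq_iff)
      ultimately show "(perm_restrict (case zy of (z, y) \<Rightarrow> z \<circ> y) (K - Y), perm_restrict (case zy of (z, y) \<Rightarrow> z \<circ> y) Y) = zy"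
        using zy by simp
      have "z \<circ> y permutes K"
        using permutes_subset[OF zy(2), of K] permutes_subset[OF zy(3) Y] by (intro permutes_compose) auto
      moreover have "(z \<circ> y) ` Y = Y"
      proof -
        have "(z \<circ> y) ` Y = z ` y ` Y" by (simp add: image_comp)
        also have "\<dots> = Y" unfolding permutes_image[OF zy(3)] using zY by simp
        finally show ?thesis .
      qed
      ultimately show "(case zy of (z, y) \<Rightarrow> z \<circ> y) \<in> {x. x permutes K \<and> x ` Y = Y}" using zy by simp
    qed
    then show "(\<Sum>x | x permutes K \<and> x ` Y = Y. ?c Y * of_int (sign (perm_restrict x Y)) * F x) =
        ?c Y * (\<Sum>z | z permutes K - Y. \<Sum>y | y permutes Y. of_int (sign y) * F (z \<circ> y))"
      by (simp add: sum.cartesian_product[symmetric] sum_distrib_left)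
  qed
  finally show ?thesis .
qed

section \<open>Averages over Young subgroups\<close>

text \<open>Up to the factor \<open>|A|! |B|!\<close>, this is the trace of \<open>g\<close> on the vectors of the Specht module that
  are invariant under \<open>Sym A\<close> and transform by the sign under \<open>Sym B\<close>, if \<open>g\<close> fixes \<open>A\<close> and \<open>B\<close>
  pointwise.\<close>

definition twisted_young_sum :: "nat list \<Rightarrow> nat set \<Rightarrow> nat set \<Rightarrow> (nat \<Rightarrow> nat) \<Rightarrow> 'k::field_char_0" where
  "twisted_young_sum lam A B g = (\<Sum>z | z permutes A. \<Sum>y | y permutes B. of_int (sign y) * specht_character lam (z \<circ> y \<circ> g))"

lemma conjugate_permutes:
  assumes "bij h" "p permutes A"
  shows "h \<circ> p \<circ> inv' h permutes h ` A"
proof -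
  have "bij (h \<circ> p \<circ> inv' h)"
    using assms by (intro bij_comp bij_imp_bij_inv) (auto intro: permutes_bij)
  moreover have "(h \<circ> p \<circ> inv' h) x = x" if x: "x \<notin> h ` A" for x
  proof -
    obtain y where y: "x = h y" using assms(1) by (metis bij_pointE)
    then have "y \<notin> A" using x by blast
    then show ?thesis using y assms bij_is_inj[OF assms(1)] by (simp add: permutes_not_in)
  qed
  ultimately show ?thesis unfolding permutes_def bij_iff by blast
qed

lemma sum_conjugate_permutes:
  fixes h :: "'a \<Rightarrow> 'a"
  assumes h: "bij h"
  shows "(\<Sum>p | p permutes h ` A. F p) = (\<Sum>p | p permutes A. F (h \<circ> p \<circ> inv' h))"
proof (rule sum.reindex_bij_witness[where i = "\<lambda>p. h \<circ> p \<circ> inv' h" and j = "\<lambda>p. inv' h \<circ> p \<circ> h"])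
  have c: "h \<circ> inv' h = id" "inv' h \<circ> h = id"
    using h by (auto simp: bij_is_surj surj_iff[symmetric] bij_is_inj)
  have hh: "h (inv' h x) = x" "inv' h (h x) = x" for x
    using c by (metis comp_apply id_apply)+
  fix p
  show e: "h \<circ> (inv' h \<circ> p \<circ> h) \<circ> inv' h = p"
    "inv' h \<circ> (h \<circ> p \<circ> inv' h) \<circ> h = p"
    by (auto simp: fun_eq_iff hh)
  show "inv' h \<circ> p \<circ> h \<in> {p. p permutes A}" if "p \<in> {p. p permutes h ` A}"
  proof -
    have "inv' h \<circ> p \<circ> inv' (inv' h) permutes inv' h ` h ` A"
      using that bij_imp_bij_inv[OF h] by (intro conjugate_permutes) auto
    then show ?thesis using h by (simp add: inv_inv_eq image_image hh)
  qed
  show "h \<circ> p \<circ> inv' h \<in> {p. p permutes h ` A}" if "p \<in> {p. p permutes A}"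
    using that conjugate_permutes[OF h] by simp
  show "F (h \<circ> (inv' h \<circ> p \<circ> h) \<circ> inv' h) = F p" unfolding e(1) ..
qed

lemma twisted_young_sum_conjugate:
  assumes h: "h permutes {1..sum_list lam}" and A: "A \<subseteq> {1..sum_list lam}" and B: "B \<subseteq> {1..sum_list lam}"
    and g: "g permutes {1..sum_list lam}" and hg: "h \<circ> g = g \<circ> h"
  shows "twisted_young_sum lam (h ` A) (h ` B) g = (twisted_young_sum lam A B g :: 'k::field_char_0)"
proof -
  let ?i = "inv' h"
  have bh: "bij h" by (rule permutes_bij[OF h])
  have hh: "h (?i x) = x" "?i (h x) = x" for x using permutes_inverses[OF h] by auto
  have gi: "?i (g x) = g (?i x)" for x using hg hh by (metis comp_apply)
  have sgn: "sign (h \<circ> y \<circ> ?i) = sign y" if y: "y permutes B" for y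
  proof -
    have yN: "y permutes {1..sum_list lam}" using y B by (rule permutes_subset)
    have hN: "permutation h" "permutation y" "permutation ?i"
      using h yN permutes_inv[OF h] permutation_permutes by blast+
    have "sign (h \<circ> y \<circ> ?i) = sign h * sign y * sign h"
      using hN by (simp add: sign_compose permutation_compose sign_inverse)
    then show ?thesis by (simp add: sign_def split: if_splits)
  qed
  have "twisted_young_sum lam (h ` A) (h ` B) g = (\<Sum>z | z permutes A. \<Sum>y | y permutes B.
      of_int (sign (h \<circ> y \<circ> ?i)) * specht_character lam (h \<circ> z \<circ> ?i \<circ> (h \<circ> y \<circ> ?i) \<circ> g) :: 'k)"
    unfolding twisted_young_sum_def sum_conjugate_permutes[OF bh] ..
  also have "\<dots> = twisted_young_sum lam A B g"
    unfolding twisted_young_sum_def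
  proof (intro sum.cong refl)
    fix z y assume "z \<in> {z. z permutes A}" "y \<in> {y. y permutes B}"
    then have z: "z permutes A" and y: "y permutes B" by auto
    have zyg: "z \<circ> y \<circ> g permutes {1..sum_list lam}"
      using permutes_subset[OF z A] permutes_subset[OF y B] g by (intro permutes_compose)
    have "h \<circ> z \<circ> ?i \<circ> (h \<circ> y \<circ> ?i) \<circ> g = h \<circ> (z \<circ> y \<circ> g) \<circ> ?i"
      by (simp add: fun_eq_iff hh gi)
    then have "specht_character lam (h \<circ> z \<circ> ?i \<circ> (h \<circ> y \<circ> ?i) \<circ> g) = (specht_character lam (z \<circ> y \<circ> g) :: 'k)"
      using specht_character_conj[OF zyg h] by simp
    then show "of_int (sign (h \<circ> y \<circ> ?i)) * specht_character lam (h \<circ> z \<circ> ?i \<circ> (h \<circ> y \<circ> ?i) \<circ> g)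
        = (of_int (sign y) * specht_character lam (z \<circ> y \<circ> g) :: 'k)"
      by (simp only: sgn[OF y])
  qed
  finally show ?thesis .
qed

text \<open>Some permutation of \<open>K\<close> maps \<open>A\<close> to \<open>A'\<close> and \<open>B\<close> to \<open>B'\<close>, and it commutes with \<open>g\<close>; so \<open>A\<close> and
  \<open>B\<close> can be assumed to be intervals.\<close>

lemma twisted_young_sum_cong_card:
  assumes n: "sum_list lam = n" and K: "K \<subseteq> {1..n}" and g: "g permutes {1..n} - K"
    and U: "A \<union> B = K" "A \<inter> B = {}" "A' \<union> B' = K" "A' \<inter> B' = {}" and c: "card A = card A'"
  shows "twisted_young_sum lam A B g = (twisted_young_sum lam A' B' g :: 'k::field_char_0)"
proof -
  have fin: "finite K" using K finite_subset by blast
  then have finA: "finite A" "finite B" "finite A'" "finite B'" using U by (auto intro: finite_subset)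
  have "card A + card B = card K" "card A' + card B' = card K"
    using U finA card_Un_disjoint by metis+
  then have cB: "card B = card B'" using c by simp
  obtain f1 where f1: "bij_betw f1 A A'" using finite_same_card_bij[OF finA(1,3) c] by blast
  obtain f2 where f2: "bij_betw f2 B B'" using finite_same_card_bij[OF finA(2,4) cB] by blast
  define h where "h x = (if x \<in> A then f1 x else if x \<in> B then f2 x else x)" for x
  have hA: "bij_betw h A A'" using f1 by (rule bij_betw_cong[THEN iffD1, rotated]) (simp add: h_def)
  have hB: "bij_betw h B B'" using f2 by (rule bij_betw_cong[THEN iffD1, rotated]) (use U(2) in \<open>auto simp: h_def\<close>)
  have "bij_betw h (A \<union> B) (A' \<union> B')" using hA hB U(4) by (rule bij_betw_combine)
  then have hK: "h permutes K" unfolding U(1,3) by (rule bij_imp_permutes) (use U(1) in \<open>auto simp: h_def\<close>)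
  have im: "h ` A = A'" "h ` B = B'" using hA hB by (auto simp: bij_betw_def)
  have "h \<circ> g = g \<circ> h" using hK g by (rule permutes_disjoint_commute) blast
  moreover have "h permutes {1..n}" "g permutes {1..n}"
    using permutes_subset[OF hK K] permutes_subset[OF g] by auto
  moreover have "A \<subseteq> {1..n}" "B \<subseteq> {1..n}" using U K by auto
  ultimately show ?thesis using twisted_young_sum_conjugate[of h lam A B g, where 'k='k] unfolding n im by simp
qed

lemma is_partition_tl:
  assumes "is_partition_of (x # lam) n"
  shows "is_partition_of lam (n - x)" "x \<le> n" "0 < x"
  using assms by (auto simp: is_partition_of_def)

lemma is_partition_remove_column:
  assumes "is_partition_of lam n"
  shows "is_partition_of (remove_column lam) (n - length lam)" "length lam \<le> n"
proof -
  have srt: "sorted_wrt (\<ge>) lam" and pos: "\<forall>k\<in>set lam. 0 < k" and n: "sum_list lam = n"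
    using assms by (auto simp: is_partition_of_def)
  have "sorted_wrt (\<ge>) (takeWhile (\<lambda>x. 1 < x) lam)"
    using srt by (metis sorted_wrt_append takeWhile_dropWhile_id)
  then have "sorted_wrt (\<ge>) (remove_column lam)"
    unfolding remove_column_def sorted_wrt_map by (rule sorted_wrt_mono_rel[rotated]) auto
  moreover have "\<forall>k\<in>set (remove_column lam). 0 < k"
    by (auto simp: remove_column_def dest: set_takeWhileD)
  ultimately show "is_partition_of (remove_column lam) (n - length lam)" "length lam \<le> n"
    using sum_list_remove_column[OF srt pos] n by (auto simp: is_partition_of_def)
qed

lemma remove_column_Cons_1:
  assumes "is_partition_of (1 # lam) n"
  shows "remove_column lam = []" "remove_column (1 # lam) = []"
  using assms by (cases lam; auto simp: is_partition_of_def remove_column_def)+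

lemma remove_column_Cons:
  "1 < x \<Longrightarrow> remove_column (x # lam) = (x - 1) # remove_column lam"
  by (simp add: remove_column_def)

text \<open>Removing the first column forgets only the number of rows of length one.\<close>

lemma column_recover:
  assumes "sorted_wrt (\<ge>) lam" "\<forall>k\<in>set lam. 0 < k"
  shows "lam = map Suc (remove_column lam) @ replicate (length lam - length (remove_column lam)) 1"
  using assms
proof (induction lam)
  case Nil then show ?case by (simp add: remove_column_def)
next
  case (Cons x lam)
  show ?case
  proof (cases "1 < x")
    case True
    then show ?thesis using Cons by (simp add: remove_column_Cons)
  next
    case False
    then have x: "x = 1" using Cons.prems by auto
    have "y = 1" if "y \<in> set lam" for y
    proof -
      have "y \<le> x" "0 < y" using that Cons.prems by auto
      then show ?thesis using x by simp
    qed
    then have "lam = replicate (length lam) 1" by (simp add: replicate_eqI)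
    then show ?thesis using x by (simp add: remove_column_def)
  qed
qed

lemma twisted_young_sum_swap:
  assumes "A \<inter> B = {}"
  shows "twisted_young_sum lam A B g = (\<Sum>y | y permutes B. of_int (sign y) * (\<Sum>z | z permutes A. specht_character lam (z \<circ> (y \<circ> g))))"
    "twisted_young_sum lam A B g = (\<Sum>z | z permutes A. \<Sum>y | y permutes B. of_int (sign y) * specht_character lam (y \<circ> (z \<circ> g)))"
proof -
  show "twisted_young_sum lam A B g = (\<Sum>y | y permutes B. of_int (sign y) * (\<Sum>z | z permutes A. specht_character lam (z \<circ> (y \<circ> g))))"
    unfolding twisted_young_sum_def comp_assoc by (subst sum.swap) (simp only: sum_distrib_left)
  have "z \<circ> y \<circ> g = y \<circ> (z \<circ> g)" if "z permutes A" "y permutes B" for z y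
    using permutes_disjoint_commute[OF that assms] by (simp add: comp_assoc)
  then show "twisted_young_sum lam A B g = (\<Sum>z | z permutes A. \<Sum>y | y permutes B. of_int (sign y) * specht_character lam (y \<circ> (z \<circ> g)))"
    unfolding twisted_young_sum_def by (intro sum.cong refl) simp
qed

text \<open>The sum vanishes if \<open>A\<close> has more points than the first row or \<open>B\<close> has more points than the first
  column. As \<open>k\<close> is at least the length of the first hook, in which the corner is counted only once,
  this leaves three cases. If \<open>A\<close> fills the first row, remove the row: what remains has \<open>length lam\<close>
  rows, so \<open>B\<close> must fill its first column or is too large. If \<open>A\<close> is shorter, then \<open>B\<close> fills the
  first column; remove the column first, and \<open>A\<close> fills the row that is left.\<close>

lemma twisted_young_sum_hook:
  assumes part: "is_partition_of (x # lam) n" and k: "k \<le> n" "x + length lam \<le> k"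
    and K: "A \<union> B = {n-k<..n}" "A \<inter> B = {}" and g: "g permutes {1..n-k}"
  shows "twisted_young_sum (x # lam) A B g = (if k = x + length lam \<and> card B \<in> {length lam, Suc (length lam)}
    then fact (card A) * fact (card B) * specht_character (remove_column lam) g else 0 :: 'k::field_char_0)"
proof -
  let ?lam = "x # lam"
  have srt: "sorted_wrt (\<ge>) ?lam" and pos: "\<forall>k\<in>set ?lam. 0 < k" and n: "sum_list ?lam = n"
    using part by (auto simp: is_partition_of_def)
  have srt': "sorted_wrt (\<ge>) lam" and pos': "\<forall>k\<in>set lam. 0 < k" using srt pos by auto
  have finAB: "finite A" "finite B" using K(1) by (metis finite_Un finite_greaterThanAtMost)+
  have card: "card A + card B = k"
    using card_Un_disjoint[OF finAB K(2)] k(1) unfolding K(1) by simp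
  have AN: "A \<subseteq> {1..sum_list ?lam}" "B \<subseteq> {1..sum_list ?lam}" 
  proof -
    have "A \<subseteq> {n-k<..n}" "B \<subseteq> {n-k<..n}" using K(1) by blast+
    moreover have "{n-k<..n} \<subseteq> {1..sum_list ?lam}" unfolding n by auto
    ultimately show "A \<subseteq> {1..sum_list ?lam}" "B \<subseteq> {1..sum_list ?lam}" by (blast intro: subset_trans)+
  qed
  have K': "{1..n} - {n-k<..n} = {1..n-k}" by auto
  have gN: "g permutes S" if "{1..n-k} \<subseteq> S" for S using g that by (rule permutes_subset)
  have "{1..n-k} \<inter> {n-k<..n} = {}" by auto
  then have "{1..n-k} \<inter> A = {}" "{1..n-k} \<inter> B = {}" using K(1) by blast+
  moreover have "{1..n-k} \<subseteq> {1..sum_list ?lam}" unfolding n by auto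
  ultimately have sub: "{1..n-k} \<subseteq> {1..sum_list ?lam} - A" "{1..n-k} \<subseteq> {1..sum_list ?lam} - B" by blast+
  have AB: "B \<subseteq> {1..sum_list ?lam} - A" "A \<subseteq> {1..sum_list ?lam} - B" using AN K(2) by blast+
  have yg: "y \<circ> g permutes {1..sum_list ?lam} - A" if "y permutes B" for y
    by (intro permutes_compose gN[OF sub(1)] permutes_subset[OF that AB(1)])
  have zg: "z \<circ> g permutes {1..sum_list ?lam} - B" if "z permutes A" for z
    by (intro permutes_compose gN[OF sub(2)] permutes_subset[OF that AB(2)])
  consider (wide) "x < card A" | (tall) "Suc (length lam) < card B"
    | (row) "card A = x" "card B \<in> {length lam, Suc (length lam)}"
    | (column) "Suc (card A) = x" "card B = Suc (length lam)"
    using card k(2) by (cases "card A = x"; force)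
  then show ?thesis
  proof cases
    case wide
    have "twisted_young_sum ?lam A B g = (0 :: 'k)"
      unfolding twisted_young_sum_swap(1)[OF K(2)]
      using wide row_average_vanish[OF srt AN(1) _ yg, where 'k='k] by (intro sum.neutral) auto
    moreover have "\<not> (k = x + length lam \<and> card B \<in> {length lam, Suc (length lam)})" using wide card by auto
    ultimately show ?thesis by (simp only: if_False)
  next
    case tall
    have "twisted_young_sum ?lam A B g = (0 :: 'k)"
      unfolding twisted_young_sum_swap(2)[OF K(2)]
      using tall column_average_vanish[OF AN(2) _ zg, where 'k='k] by (intro sum.neutral) auto
    then show ?thesis using tall by simp
  next
    case row
    let ?A = "{n-x<..n}" and ?B = "{n-k<..n-x}" and ?m = "sum_list lam"
    have m: "?m = n - x" "x \<le> n" using n by auto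
    have xk: "x \<le> k" using k(2) by simp
    have A': "?A = {?m<..x + ?m}" using m by auto
    have "twisted_young_sum ?lam A B g = (twisted_young_sum ?lam ?A ?B g :: 'k)"
      using row(1) m xk k(1) by (intro twisted_young_sum_cong_card[OF n _ _ K]) (auto simp: K' intro: gN)
    also have "\<dots> = (\<Sum>y | y permutes ?B. of_int (sign y) * (\<Sum>z | z permutes ?A. specht_character ?lam (z \<circ> (y \<circ> g))))"
      by (rule twisted_young_sum_swap(1)) auto
    also have "\<dots> = (\<Sum>y | y permutes ?B. of_int (sign y) * (fact x * specht_character lam (y \<circ> g)))"
    proof (intro sum.cong refl arg_cong2[where f = "(*)"])
      fix y assume "y \<in> {y. y permutes ?B}"
      then have y: "y permutes ?B" by simp
      have "y \<circ> g permutes {1..?m}"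
        using k(1) xk m by (intro permutes_compose permutes_subset[OF y] gN) auto
      then show "(\<Sum>z | z permutes ?A. specht_character ?lam (z \<circ> (y \<circ> g))) = (fact x * specht_character lam (y \<circ> g) :: 'k)"
        unfolding A' by (rule row_average_removal[OF srt])
    qed
    also have "\<dots> = fact x * (\<Sum>y | y permutes ?B. of_int (sign y) * specht_character lam (y \<circ> g))"
      by (simp add: sum_distrib_left algebra_simps)
    finally have eq: "twisted_young_sum ?lam A B g = (fact x * (\<Sum>y | y permutes ?B. of_int (sign y) * specht_character lam (y \<circ> g)) :: 'k)" .
    have cB: "card ?B = card B" using card row(1) k(1) by simp
    show ?thesis
    proof (cases "card B = length lam")
      case True
      have B': "?B = {sum_list (remove_column lam)<..length lam + sum_list (remove_column lam)}"
        using sum_list_remove_column[OF srt' pos'] m card row(1) True by auto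
      have g': "g permutes {1..sum_list (remove_column lam)}"
        using sum_list_remove_column[OF srt' pos'] m card row(1) True by (intro gN) auto
      have "(\<Sum>y | y permutes ?B. of_int (sign y) * specht_character lam (y \<circ> g))
          = (fact (length lam) * specht_character (remove_column lam) g :: 'k)"
        unfolding B' by (rule column_average_removal[OF srt' pos' g'])
      then show ?thesis using eq True row(1) card by simp
    next
      case False
      have "(\<Sum>y | y permutes ?B. of_int (sign y) * specht_character lam (y \<circ> g)) = (0 :: 'k)"
        using False row(2) cB m k(1) xk by (intro column_average_vanish gN) auto
      then show ?thesis using eq False row card by auto
    qed
  next
    case column
    let ?l = "Suc (length lam)" and ?mu = "remove_column ?lam"
    let ?B = "{n - ?l<..n}" and ?A = "{n-k<..n - ?l}" and ?m = "sum_list ?mu"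
    have m: "n = ?l + ?m" using sum_list_remove_column[OF srt pos] n by simp
    have lk: "?l \<le> k" using column card by simp
    have B': "?B = {?m<..length ?lam + ?m}" using m by auto
    have "twisted_young_sum ?lam A B g = (twisted_young_sum ?lam ?A ?B g :: 'k)"
      using column m lk k(1) card by (intro twisted_young_sum_cong_card[OF n _ _ K]) (auto simp: K' intro: gN)
    also have "\<dots> = (\<Sum>z | z permutes ?A. \<Sum>y | y permutes ?B. of_int (sign y) * specht_character ?lam (y \<circ> (z \<circ> g)))"
      by (rule twisted_young_sum_swap(2)) auto
    also have "\<dots> = (\<Sum>z | z permutes ?A. fact ?l * specht_character ?mu (z \<circ> g))"
    proof (intro sum.cong refl)
      fix z assume "z \<in> {z. z permutes ?A}"
      then have z: "z permutes ?A" by simp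
      have "z \<circ> g permutes {1..?m}"
        using k(1) lk m by (intro permutes_compose permutes_subset[OF z] gN) auto
      then show "(\<Sum>y | y permutes ?B. of_int (sign y) * specht_character ?lam (y \<circ> (z \<circ> g))) = (fact ?l * specht_character ?mu (z \<circ> g) :: 'k)"
        unfolding B' using column_average_removal[OF srt pos, of "z \<circ> g", where 'k='k] by simp
    qed
    also have "\<dots> = fact ?l * (\<Sum>z | z permutes ?A. specht_character ?mu (z \<circ> g))"
      by (simp add: sum_distrib_left)
    also have "(\<Sum>z | z permutes ?A. specht_character ?mu (z \<circ> g)) = (fact (card A) * specht_character (remove_column lam) g :: 'k)"
    proof (cases "x = 1")
      case True
      then have "card A = 0" using column by simp
      moreover have "?A = {}" using column card True k(1) by auto
      moreover have "remove_column lam = []" "?mu = []" using remove_column_Cons_1[of lam n] part True by auto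
      ultimately show ?thesis by simp
    next
      case False
      then have x: "1 < x" using pos by auto
      have mu: "?mu = (x - 1) # remove_column lam" by (rule remove_column_Cons[OF x])
      have part': "is_partition_of ?mu (n - length ?lam)" by (rule is_partition_remove_column(1)[OF part])
      have A': "?A = {sum_list (remove_column lam)<..(x - 1) + sum_list (remove_column lam)}"
        using m mu column card k(1) by auto
      have g': "g permutes {1..sum_list (remove_column lam)}"
        using m mu column card k(1) by (intro gN) auto
      have "sorted_wrt (\<ge>) ((x - 1) # remove_column lam)" using part' unfolding mu is_partition_of_def by blast
      then have "(\<Sum>z | z permutes ?A. specht_character ((x - 1) # remove_column lam) (z \<circ> g))
          = (fact (x - 1) * specht_character (remove_column lam) g :: 'k)"
        unfolding A' using g' by (rule row_average_removal)
      moreover have "card A = x - 1" using column by simp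
      ultimately show ?thesis unfolding mu by simp
    qed
    finally show ?thesis using column card by (simp add: algebra_simps)
  qed
qed

lemma sum_Pow_card:
  assumes "finite K"
  shows "(\<Sum>Y\<in>Pow K. if card Y = j then F else 0) = of_nat (card K choose j) * (F :: 'k::field_char_0)"
proof -
  have "(\<Sum>Y\<in>Pow K. if card Y = j then F else 0) = (\<Sum>Y\<in>{Y \<in> Pow K. card Y = j}. F)"
    using assms by (intro sum.inter_filter[symmetric]) simp
  also have "{Y \<in> Pow K. card Y = j} = {Y. Y \<subseteq> K \<and> card Y = j}" by auto
  finally show ?thesis using n_subsets[OF assms, of j] by simp
qed

text \<open>Only sets \<open>Y\<close> of the two sizes \<open>length lam\<close> and \<open>Suc (length lam)\<close> contribute, and the number of
  such sets compensates the factorials.\<close>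

lemma weighted_sum_hook:
  fixes e :: "nat \<Rightarrow> 'k::field_char_0"
  assumes part: "is_partition_of (x # lam) n" and k: "k \<le> n" "x + length lam \<le> k"
    and g: "g permutes {1..n-k}"
  shows "(\<Sum>p | p permutes {n-k<..n}. cycle_weight e {n-k<..n} p * specht_character (x # lam) (p \<circ> g))
    = (if k = x + length lam
       then fact k * (-1) ^ length lam * (e (length lam) - e (Suc (length lam))) * specht_character (remove_column lam) g
       else 0)"
proof -
  let ?K = "{n-k<..n}" and ?l = "length lam" and ?c = "specht_character (remove_column lam) g :: 'k"
  have cK: "card ?K = k" using k by simp
  have x0: "0 < x" using is_partition_tl(3)[OF part] .
  have "(\<Sum>p | p permutes ?K. cycle_weight e ?K p * specht_character (x # lam) (p \<circ> g))
      = (\<Sum>Y\<in>Pow ?K. (-1) ^ card Y * e (card Y) * twisted_young_sum (x # lam) (?K - Y) Y g)"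
    unfolding twisted_young_sum_def by (subst cycle_weight_sum) simp_all
  also have "\<dots> = (\<Sum>Y\<in>Pow ?K. if k = x + ?l \<and> card Y \<in> {?l, Suc ?l}
      then (-1) ^ card Y * e (card Y) * (fact (k - card Y) * fact (card Y) * ?c) else 0)"
  proof (intro sum.cong refl)
    fix Y assume "Y \<in> Pow ?K"
    then have Y: "Y \<subseteq> ?K" by simp
    then have "finite Y" using finite_subset by blast
    then have c: "card (?K - Y) = k - card Y" using card_Diff_subset[OF _ Y] cK by simp
    have KY: "(?K - Y) \<union> Y = ?K" "(?K - Y) \<inter> Y = {}" using Y by auto
    show "(-1) ^ card Y * e (card Y) * twisted_young_sum (x # lam) (?K - Y) Y g = (if k = x + ?l \<and> card Y \<in> {?l, Suc ?l}
      then (-1) ^ card Y * e (card Y) * (fact (k - card Y) * fact (card Y) * ?c) else 0)"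
      unfolding twisted_young_sum_hook[OF part k KY g] c by (simp only: if_distrib[of "(*) _"] mult_zero_right)
  qed
  also have "\<dots> = (if k = x + ?l then fact k * (-1) ^ ?l * (e ?l - e (Suc ?l)) * ?c else 0)"
  proof (cases "k = x + ?l")
    case True
    let ?F = "\<lambda>j. (-1) ^ j * e j * (fact (k - j) * fact j * ?c)"
    have "(\<Sum>Y\<in>Pow ?K. if k = x + ?l \<and> card Y \<in> {?l, Suc ?l} then ?F (card Y) else 0)
        = (\<Sum>Y\<in>Pow ?K. (if card Y = ?l then ?F ?l else 0) + (if card Y = Suc ?l then ?F (Suc ?l) else 0))"
      using True by (intro sum.cong) auto
    also have "\<dots> = of_nat (k choose ?l) * ?F ?l + of_nat (k choose Suc ?l) * ?F (Suc ?l)"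
      by (simp only: sum.distrib sum_Pow_card[OF finite_greaterThanAtMost] cK)
    also have "of_nat (k choose ?l) * ?F ?l = (fact ?l * fact (k - ?l) * of_nat (k choose ?l)) * ((-1) ^ ?l * e ?l * ?c)"
      by (simp add: algebra_simps)
    also have "of_nat (k choose Suc ?l) * ?F (Suc ?l) =
        (fact (Suc ?l) * fact (k - Suc ?l) * of_nat (k choose Suc ?l)) * ((-1) ^ Suc ?l * e (Suc ?l) * ?c)"
      by (simp only: mult.assoc mult.commute mult.left_commute)
    also have "fact ?l * fact (k - ?l) * of_nat (k choose ?l) = (fact k :: 'k)"
      using True by (metis binomial_fact_lemma le_add2 of_nat_fact of_nat_mult)
    also have "fact (Suc ?l) * fact (k - Suc ?l) * of_nat (k choose Suc ?l) = (fact k :: 'k)"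
    proof -
      have "Suc ?l \<le> k" using True x0 by simp
      then show ?thesis by (metis binomial_fact_lemma of_nat_fact of_nat_mult)
    qed
    finally show ?thesis using True by (simp add: algebra_simps)
  qed simp
  finally show ?thesis .
qed

section \<open>Characters that are proportional on regular permutations\<close>

lemma funpow_comp_commute:
  assumes "f \<circ> g = g \<circ> f"
  shows "(f \<circ> g) ^^ n = f ^^ n \<circ> g ^^ n"
proof (induction n)
  case (Suc n)
  have c: "g \<circ> f ^^ m = f ^^ m \<circ> g" for m
  proof (induction m)
    case (Suc m)
    have "g \<circ> f ^^ Suc m = (g \<circ> f) \<circ> f ^^ m" by (simp add: comp_assoc)
    also have "\<dots> = f \<circ> (g \<circ> f ^^ m)" by (simp only: assms[symmetric] comp_assoc)
    finally show ?case by (simp only: Suc.IH funpow.simps comp_assoc)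
  qed simp
  have "(f \<circ> g) ^^ Suc n = f \<circ> (g \<circ> f ^^ n) \<circ> g ^^ n"
    by (simp only: funpow.simps Suc.IH comp_assoc)
  also have "\<dots> = f ^^ Suc n \<circ> g ^^ Suc n" by (simp only: c funpow.simps comp_assoc)
  finally show ?case .
qed simp

lemma funpow_eq_id_dvd:
  assumes "f ^^ m = id" "m dvd n"
  shows "f ^^ n = id"
proof -
  obtain k where k: "n = m * k" using assms(2) by (auto simp: dvd_def)
  have "f ^^ n = (f ^^ m) ^^ k" unfolding k by (rule funpow_mult[symmetric])
  then show ?thesis by (simp only: assms(1) id_funpow)
qed

text \<open>If \<open>q\<close> is a prime power, this says that no cycle length is divisible by \<open>q\<close>.\<close>

definition regular :: "nat \<Rightarrow> nat \<Rightarrow> (nat \<Rightarrow> nat) \<Rightarrow> bool" where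
  "regular q n g \<longleftrightarrow> g permutes {1..n} \<and> (\<exists>m. \<not> q dvd m \<and> g ^^ m = id)"

text \<open>The hypothesis on \<open>q\<close> means that \<open>q\<close> is a prime power; it ensures that the least common multiple of
  the cycle lengths is not divisible by \<open>q\<close>.\<close>

lemma cycle_weight_nonzero:
  fixes e :: "nat \<Rightarrow> 'k::field_char_0"
  assumes q: "\<And>a b. q dvd lcm a b \<Longrightarrow> q dvd a \<or> q dvd b" "1 < q"
    and K: "finite K" and x: "x permutes K" and per: "\<And>j. e (j + q) = e j" and nz: "cycle_weight e K x \<noteq> 0"
  obtains m where "\<not> q dvd m" "x ^^ m = id"
proof -
  have px: "permutation x" using x K permutation_permutes by blast
  have nd: "\<not> q dvd least_power x i" if "i \<in> K" for i
  proof
    assume "q dvd least_power x i"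
    from cycle_weight_zero[where e = e, OF K x that this per] nz show False by blast
  qed
  have "\<exists>m. \<not> q dvd m \<and> (\<forall>i\<in>F. least_power x i dvd m)" if "finite F" "F \<subseteq> K" for F
    using that
  proof (induction F rule: finite_induct)
    case empty
    have "\<not> q dvd 1" using q(2) by simp
    then show ?case by blast
  next
    case (insert i F)
    then obtain m where m: "\<not> q dvd m" "\<forall>i\<in>F. least_power x i dvd m" by auto
    have "\<not> q dvd lcm m (least_power x i)" using q(1) m(1) nd insert.prems by blast
    moreover have "\<forall>j\<in>insert i F. least_power x j dvd lcm m (least_power x i)"
      using m(2) by (auto intro: dvd_lcmI1)
    ultimately show ?case by blast
  qed
  from this[OF K subset_refl] obtain m where m: "\<not> q dvd m" "\<forall>i\<in>K. least_power x i dvd m" by blast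
  have "(x ^^ m) i = i" for i
  proof (cases "i \<in> K")
    case True then show ?thesis using m(2) least_power_dvd[OF px] by blast
  next
    case False then show ?thesis using permutes_not_in[OF permutes_funpow[OF x]] by blast
  qed
  then have "x ^^ m = id" by (simp add: fun_eq_iff)
  then show ?thesis using that m(1) by blast
qed

text \<open>The terms with a permutation \<open>p \<circ> g\<close> that is not regular have weight zero.\<close>

lemma weighted_sum_transfer:
  fixes e :: "nat \<Rightarrow> 'k::field_char_0"
  assumes q: "\<And>a b. q dvd lcm a b \<Longrightarrow> q dvd a \<or> q dvd b" "1 < q"
    and per: "\<And>j. e (j + q) = e j"
    and eq: "\<And>g. regular q n g \<Longrightarrow> specht_character lam g = c * (specht_character mu g :: 'k)"
    and g: "regular q (n - k) g"
  shows "(\<Sum>p | p permutes {n-k<..n}. cycle_weight e {n-k<..n} p * specht_character lam (p \<circ> g))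
    = c * (\<Sum>p | p permutes {n-k<..n}. cycle_weight e {n-k<..n} p * (specht_character mu (p \<circ> g) :: 'k))"
proof -
  let ?K = "{n-k<..n}"
  have key: "cycle_weight e ?K p * specht_character lam (p \<circ> g) = c * (cycle_weight e ?K p * specht_character mu (p \<circ> g))"
    if p: "p permutes ?K" for p
  proof (cases "cycle_weight e ?K p = 0")
    case False
    obtain m where m: "\<not> q dvd m" "p ^^ m = id"
      by (rule cycle_weight_nonzero[OF q finite_greaterThanAtMost p per False])
    obtain m' where m': "\<not> q dvd m'" "g ^^ m' = id" and gp: "g permutes {1..n-k}"
      using g by (auto simp: regular_def)
    have comm: "p \<circ> g = g \<circ> p" using p gp by (rule permutes_disjoint_commute) auto
    have "p ^^ lcm m m' = id" "g ^^ lcm m m' = id"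
      using m m' by (auto intro: funpow_eq_id_dvd)
    then have "(p \<circ> g) ^^ lcm m m' = id" by (simp add: funpow_comp_commute[OF comm])
    moreover have "\<not> q dvd lcm m m'" using q(1) m m' by blast
    moreover have "p \<circ> g permutes {1..n}"
      by (intro permutes_compose permutes_subset[OF p] permutes_subset[OF gp]) auto
    ultimately have "regular q n (p \<circ> g)" by (auto simp: regular_def)
    from eq[OF this] show ?thesis by simp
  qed simp
  show ?thesis unfolding sum_distrib_left by (rule sum.cong) (use key in blast)+
qed

lemma content_sum_Cons:
  "2 * content_sum (x # lam) = 2 * content_sum lam - 2 * int (sum_list lam) + int x * (int x - 1)"
proof -
  let ?h = "\<lambda>(i, j :: nat). (Suc i, j)"
  have "content_sum (x # lam) = (\<Sum>(i, j)\<in>(\<lambda>j. (0, j)) ` {..<x}. int j - int i) + (\<Sum>(i, j)\<in>?h ` young_diagram lam. int j - int i)"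
    unfolding content_sum_def young_diagram_Cons by (intro sum.union_disjoint) auto
  also have "(\<Sum>(i, j)\<in>(\<lambda>j. (0, j)) ` {..<x}. int j - int i) = (\<Sum>j<x. int j)"
    by (subst sum.reindex) (auto simp: inj_on_def)
  also have "(\<Sum>(i, j)\<in>?h ` young_diagram lam. int j - int i) = (\<Sum>(i, j)\<in>young_diagram lam. (int j - int i) - 1)"
    by (subst sum.reindex) (auto simp: inj_on_def case_prod_unfold algebra_simps)
  also have "\<dots> = content_sum lam - int (sum_list lam)"
    by (simp add: content_sum_def case_prod_unfold sum_subtractf card_young_diagram)
  finally have "content_sum (x # lam) = (\<Sum>j<x. int j) + content_sum lam - int (sum_list lam)" by simp
  moreover have "2 * (\<Sum>j<x. int j) = int x * (int x - 1)"
    by (induction x) (auto simp: algebra_simps)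
  ultimately show ?thesis by (simp add: algebra_simps)
qed

lemma content_sum_remove_column:
  assumes srt: "sorted_wrt (\<ge>) lam" and pos: "\<forall>k\<in>set lam. 0 < k"
  shows "2 * content_sum lam = 2 * content_sum (remove_column lam) + 2 * int (sum_list (remove_column lam))
    - int (length lam) * (int (length lam) - 1)"
proof -
  let ?h = "\<lambda>(i :: nat, j). (i, Suc j)" and ?mu = "remove_column lam"
  note D = young_diagram_split_column[OF srt pos]
  have "content_sum lam = (\<Sum>(i, j)\<in>(\<lambda>i. (i, 0)) ` {..<length lam}. int j - int i) + (\<Sum>(i, j)\<in>?h ` young_diagram ?mu. int j - int i)"
    unfolding content_sum_def D by (intro sum.union_disjoint) auto
  also have "(\<Sum>(i, j)\<in>(\<lambda>i. (i, 0)) ` {..<length lam}. int j - int i) = - (\<Sum>i<length lam. int i)"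
    by (subst sum.reindex) (auto simp: inj_on_def sum_negf)
  also have "(\<Sum>(i, j)\<in>?h ` young_diagram ?mu. int j - int i) = (\<Sum>(i, j)\<in>young_diagram ?mu. (int j - int i) + 1)"
    by (subst sum.reindex) (auto simp: inj_on_def case_prod_unfold algebra_simps)
  also have "\<dots> = content_sum ?mu + int (sum_list ?mu)"
    by (simp add: content_sum_def case_prod_unfold sum.distrib card_young_diagram)
  finally have "content_sum lam = content_sum ?mu + int (sum_list ?mu) - (\<Sum>i<length lam. int i)" by simp
  moreover have "2 * (\<Sum>i<l. int i) = int l * (int l - 1)" for l :: nat
    by (induction l) (auto simp: algebra_simps)
  from this[of "length lam"] calculation show ?thesis by (simp add: algebra_simps)
qed

text \<open>Deleting the first hook moves every remaining cell one step along its diagonal and keeps its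
  content, and the contents in a hook with arm \<open>a\<close> and leg \<open>b\<close> add up to half of
  \<open>(a - b) * (a + b + 1)\<close>.\<close>

lemma content_sum_hook:
  assumes "sorted_wrt (\<ge>) lam" "\<forall>k\<in>set lam. 0 < k"
  shows "2 * content_sum (x # lam) = 2 * content_sum (remove_column lam)
    + (int x - int (length lam) - 1) * int (x + length lam)"
  using content_sum_Cons[of x lam] content_sum_remove_column[OF assms] sum_list_remove_column[OF assms]
  by (simp add: algebra_simps)

lemma regular_id: "1 < q \<Longrightarrow> regular q n id"
  unfolding regular_def by (intro conjI permutes_id exI[of _ 1]) auto

lemma regular_transposition:
  assumes "2 < q" "a \<in> {1..n}" "b \<in> {1..n}"
  shows "regular q n (transpose a b)"
proof -
  have "\<not> q dvd 2" using assms(1) by (auto dest: dvd_imp_le)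
  moreover have "transpose a b ^^ 2 = id" by (simp add: numeral_2_eq_2)
  ultimately show ?thesis using permutes_swap_id[OF assms(2,3)] unfolding regular_def by blast
qed

text \<open>Take the average over as many points as the longer of the two first hooks has cells. It does not
  vanish for the partition with this hook, hence not for the other one.\<close>

lemma hook_strip_proportional:
  assumes q: "\<And>a b. q dvd lcm a b \<Longrightarrow> q dvd a \<or> q dvd b" "2 < q"
    and lam: "is_partition_of (x # lam) n" and mu: "is_partition_of (y # mu) n"
    and eq: "\<And>g. regular q n g \<Longrightarrow> specht_character (x # lam) g = c * (specht_character (y # mu) g :: 'k::field_char_0)"
    and le: "y + length mu \<le> x + length lam"
  shows "x + length lam = y + length mu \<and>
    (\<exists>d. \<forall>g. regular q (n - (x + length lam)) g \<longrightarrow>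
      specht_character (remove_column lam) g = d * (specht_character (remove_column mu) g :: 'k))"
proof -
  let ?l = "length lam" and ?k = "x + length lam"
  have q1: "1 < q" using q(2) by simp
  \<comment> \<open>this choice makes the factor for \<open>lam\<close> nonzero; the factor for \<open>mu\<close> is then nonzero by \<open>key\<close>\<close>
  define e :: "nat \<Rightarrow> 'k" where "e j = of_bool (j mod q = ?l mod q)" for j
  have per: "e (j + q) = e j" for j by (simp add: e_def)
  have "Suc ?l mod q \<noteq> ?l mod q" using q(2) by (simp add: mod_Suc)
  then have e1: "e ?l - e (Suc ?l) = 1" by (simp add: e_def)
  have kn: "?k \<le> n"
  proof -
    have "length lam \<le> n - x" using is_partition_remove_column(2)[OF is_partition_tl(1)[OF lam]] .
    then show ?thesis using is_partition_tl(2)[OF lam] by simp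
  qed
  define a :: 'k where "a = fact ?k * (-1) ^ ?l"
  define b :: 'k where "b = (if ?k = y + length mu then fact ?k * (-1) ^ length mu * (e (length mu) - e (Suc (length mu))) else 0)"
  have a0: "a \<noteq> 0" by (simp add: a_def)
  have key: "a * specht_character (remove_column lam) g = c * b * specht_character (remove_column mu) g"
    if g: "regular q (n - ?k) g" for g
  proof -
    have gp: "g permutes {1..n - ?k}" using g by (simp add: regular_def)
    have "a * specht_character (remove_column lam) g
        = (\<Sum>p | p permutes {n - ?k<..n}. cycle_weight e {n - ?k<..n} p * specht_character (x # lam) (p \<circ> g))"
      unfolding weighted_sum_hook[OF lam kn order_refl gp] by (simp add: a_def e1)
    also have "\<dots> = c * (\<Sum>p | p permutes {n - ?k<..n}. cycle_weight e {n - ?k<..n} p * specht_character (y # mu) (p \<circ> g))"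
      by (rule weighted_sum_transfer[where e = e, OF q(1) q1 per eq g])
    also have "\<dots> = c * b * specht_character (remove_column mu) g"
      unfolding weighted_sum_hook[OF mu kn le gp] by (simp add: b_def)
    finally show ?thesis .
  qed
  have "a * specht_character (remove_column lam) id \<noteq> (0 :: 'k)"
    using a0 specht_character_id_nonzero[of "remove_column lam", where 'k='k] by simp
  then have "c * b \<noteq> 0" using key[OF regular_id] q(2) by auto
  then have k: "?k = y + length mu" by (auto simp: b_def split: if_splits)
  have "specht_character (remove_column lam) g = (c * b / a) * specht_character (remove_column mu) g"
    if "regular q (n - ?k) g" for g
    using key[OF that] a0 by (simp add: field_simps)
  then show ?thesis using k by blast
qed

text \<open>Proportionality is what the induction needs: the factors that appear when first hooks are removed
  may depend on the partition.\<close>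

lemma proportional_characters_imp_eq:
  assumes q: "\<And>a b. q dvd lcm a b \<Longrightarrow> q dvd a \<or> q dvd b" "2 < q"
    and "is_partition_of lam n" "is_partition_of mu n"
    and "\<And>g. regular q n g \<Longrightarrow> specht_character lam g = c * (specht_character mu g :: 'k::field_char_0)"
  shows "lam = mu"
  using assms(3-5)
proof (induction n arbitrary: lam mu c rule: less_induct)
  case (less n)
  note lam = less.prems(1) and mu = less.prems(2) and eq = less.prems(3)
  have idr: "regular q n id" using q(2) by (intro regular_id) simp
  have c0: "c \<noteq> 0"
  proof
    assume "c = 0"
    then have "specht_character lam id = (0 :: 'k)" using eq[OF idr] by (simp only: mult_zero_left)
    then show False using specht_character_id_nonzero by blast
  qed
  have eq': "specht_character mu g = inverse c * (specht_character lam g :: 'k)" if "regular q n g" for g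
    using eq[OF that] c0 by simp
  show ?case
  proof (cases "n = 0")
    case True
    then show ?thesis using lam mu by (cases lam; cases mu) (auto simp: is_partition_of_def)
  next
    case False
    then obtain x xs y ys where xs: "lam = x # xs" and ys: "mu = y # ys"
      using lam mu by (cases lam; cases mu) (auto simp: is_partition_of_def)
    note lx = lam[unfolded xs] and my = mu[unfolded ys]
    have k: "x + length xs = y + length ys"
      using hook_strip_proportional[OF q lx my eq[unfolded xs ys]] hook_strip_proportional[OF q my lx eq'[unfolded xs ys]]
      by linarith
    let ?k = "x + length xs"
    obtain d where d: "\<And>g. regular q (n - ?k) g \<Longrightarrow>
        specht_character (remove_column xs) g = d * (specht_character (remove_column ys) g :: 'k)"
      using hook_strip_proportional[OF q lx my eq[unfolded xs ys]] k by auto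
    have px: "is_partition_of xs (n - x)" "0 < x" and py: "is_partition_of ys (n - y)" "0 < y"
      using is_partition_tl[OF lx] is_partition_tl[OF my] by auto
    have "is_partition_of (remove_column xs) (n - ?k)" "is_partition_of (remove_column ys) (n - ?k)"
      using is_partition_remove_column(1)[OF px(1)] is_partition_remove_column(1)[OF py(1)] k by auto
    moreover have "n - ?k < n" using px(2) False by simp
    ultimately have rc: "remove_column xs = remove_column ys" using less.IH d by blast
    have sx: "sorted_wrt (\<ge>) xs" "\<forall>k\<in>set xs. 0 < k" and sy: "sorted_wrt (\<ge>) ys" "\<forall>k\<in>set ys. 0 < k"
      using px py by (auto simp: is_partition_of_def)
    have cs: "content_sum lam = content_sum mu"
    proof (cases "n = 1")
      case True
      have "lam = [1]" "mu = [1]"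
        using lx my px(2) py(2) True unfolding xs ys
        by (cases xs; cases ys; auto simp: is_partition_of_def)+
      then show ?thesis by simp
    next
      case n1: False
      then have ab: "1 \<in> {1..n}" "2 \<in> {1..n}" "(1::nat) \<noteq> 2" using False by auto
      have sl: "sorted_wrt (\<ge>) lam" "sum_list lam = n" and sm: "sorted_wrt (\<ge>) mu" "sum_list mu = n"
        using lam mu by (auto simp: is_partition_of_def)
      note tl = specht_character_transposition[OF sl ab, where 'k='k]
      note tm = specht_character_transposition[OF sm ab, where 'k='k]
      have tr: "specht_character lam (transpose 1 2) = c * (specht_character mu (transpose 1 2) :: 'k)"
        using q(2) ab by (intro eq regular_transposition) auto
      have "of_int (2 * content_sum lam) * specht_character lam id
          = of_nat (n * (n - 1)) * (c * specht_character mu (transpose 1 2) :: 'k)"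
        unfolding tl[symmetric] tr ..
      also have "\<dots> = c * (of_nat (n * (n - 1)) * specht_character mu (transpose 1 2))"
        by (simp only: mult.left_commute)
      also have "\<dots> = of_int (2 * content_sum mu) * (c * specht_character mu id)"
        unfolding tm by (simp only: mult.left_commute)
      also have "c * specht_character mu id = (specht_character lam id :: 'k)" by (rule eq[OF idr, symmetric])
      finally have "(of_int (2 * content_sum lam) :: 'k) = of_int (2 * content_sum mu)"
        by (simp only: mult_right_cancel[OF specht_character_id_nonzero])
      then show ?thesis by (simp only: of_int_eq_iff)
    qed
    have "(int x - int (length xs) - 1) * int ?k = (int y - int (length ys) - 1) * int ?k"
      using content_sum_hook[OF sx, of x, folded xs, unfolded rc]
        content_sum_hook[OF sy, of y, folded ys k] cs by linarith
    then have "int x - int (length xs) = int y - int (length ys)" using px(2) by simp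
    then have xy: "x = y" "length xs = length ys" using k by linarith+
    have "xs = ys"
      using column_recover[OF sx] column_recover[OF sy] rc xy(2) by metis
    then show ?thesis using xs ys xy by simp
  qed
qed

text \<open>Either \<open>4\<close> or an odd prime divides \<open>l\<close>. The prime \<open>2\<close> itself has to be avoided because
  transpositions are needed.\<close>

lemma prime_or_four_divisor:
  assumes "2 < (l::nat)"
  shows "\<exists>q. q dvd l \<and> 2 < q \<and> (\<forall>a b. q dvd lcm a b \<longrightarrow> q dvd a \<or> q dvd b)"
proof (cases "4 dvd l")
  case True
  have "4 dvd a \<or> 4 dvd b" if "4 dvd lcm a b" for a b :: nat
  proof (rule ccontr)
    assume no: "\<not> ?thesis"
    have half: "\<exists>u. odd u \<and> a dvd 2 * u" if "\<not> 4 dvd a" for a :: nat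
    proof (cases "even a")
      case True
      then obtain u where "a = 2 * u" by blast
      moreover have "odd u" using that calculation by auto
      ultimately show ?thesis by auto
    qed auto
    obtain u v where "odd u" "a dvd 2 * u" "odd v" "b dvd 2 * v" using half no by blast
    have "a dvd 2 * u * v" using \<open>a dvd 2 * u\<close> by (rule dvd_mult2)
    moreover have "b dvd u * (2 * v)" using \<open>b dvd 2 * v\<close> by (rule dvd_mult)
    ultimately have "a dvd 2 * (u * v)" "b dvd 2 * (u * v)" by (simp_all add: algebra_simps)
    have "odd (u * v)" using \<open>odd u\<close> \<open>odd v\<close> by simp
    from \<open>a dvd 2 * (u * v)\<close> \<open>b dvd 2 * (u * v)\<close> have "4 dvd 2 * (u * v)" using that by (meson dvd_trans lcm_least)
    then have "2 * 2 dvd 2 * (u * v)" by simp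
    then have "2 dvd u * v" by (rule dvd_mult_cancel) simp
    then show False using \<open>odd (u * v)\<close> by simp
  qed
  then show ?thesis using True by (intro exI[of _ 4]) auto
next
  case False
  obtain m where m: "m dvd l" "odd m" "m \<noteq> 1"
  proof (cases "even l")
    case True
    then obtain m where "l = 2 * m" by blast
    then show ?thesis using that[of m] False assms by auto
  next
    case odd: False
    then show ?thesis using that[of l] assms by auto
  qed
  obtain p where p: "Factorial_Ring.prime p" "p dvd m" using m prime_divisor_exists[of m] by (auto elim: dvdE)
  have "p \<noteq> 2" using p m(2) by auto
  then have "2 < p" using prime_ge_2_nat[OF p(1)] by simp
  moreover have "p dvd a \<or> p dvd b" if "p dvd lcm a b" for a b
  proof -
    have "lcm a b dvd a * b" by (intro lcm_least) auto
    then show ?thesis using that p(1) prime_dvd_mult_iff dvd_trans by blast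
  qed
  moreover have "p dvd l" using p(2) m(1) by (rule dvd_trans)
  ultimately show ?thesis by blast
qed

lemma sym_group_pow: "g [^]\<^bsub>sym_group n\<^esub> (m :: nat) = g ^^ m"
proof (induction m)
  case 0 then show ?case by (simp add: sym_group_def)
next
  case (Suc m)
  then show ?case by (simp add: sym_group_mult nat_pow_def) (simp add: sym_group_def funpow_swap1 fun_eq_iff)
qed

theorem corollary2p3:
  fixes n l :: nat and lam mu :: "nat list"
  assumes "n \<ge> 1"
    and "is_partition_of lam n" and "is_partition_of mu n"
    and "l > 2"
    and "\<And>g. g \<in> carrier (sym_group n) \<Longrightarrow> \<not> l dvd group.ord (sym_group n) g \<Longrightarrow>
           (specht_character lam g :: 'k::field_char_0) = specht_character mu g"
  shows "lam = mu"
proof -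
  obtain q where q: "q dvd l" "2 < q" "\<And>a b. q dvd lcm a b \<Longrightarrow> q dvd a \<or> q dvd b"
    using prime_or_four_divisor[OF assms(4)] by blast
  have "specht_character lam g = 1 * (specht_character mu g :: 'k)" if g: "regular q n g" for g
  proof -
    have c: "g \<in> carrier (sym_group n)" using g by (simp add: regular_def sym_group_carrier)
    obtain m where m: "\<not> q dvd m" "g ^^ m = id" using g by (auto simp: regular_def)
    have "g [^]\<^bsub>sym_group n\<^esub> m = \<one>\<^bsub>sym_group n\<^esub>" by (simp add: sym_group_pow m(2) sym_group_one)
    then have "group.ord (sym_group n) g dvd m"
      using group.pow_eq_id[OF sym_group_is_group c] by blast
    then have "\<not> l dvd group.ord (sym_group n) g" using m(1) q(1) dvd_trans by blast
    then show ?thesis using assms(5)[OF c] by simp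
  qed
  from proportional_characters_imp_eq[OF q(3,2) assms(2,3) this] show ?thesis .
qed

end
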